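(* Let $k\ge 1$ be an integer, let $\Omega$ be a macro element, let $\bar f\in C^{k+2}(\Omega;\mathbb R)$, and let $\overline{\mathcal T}_{h,\Omega}$ with $h<h_0$ be a symmetric triangulation of $\Omega$. Let $\bar f_h=\bar I_h^k(\bar f)\in C^0(\Omega;\mathbb R)$ be the piecewise Lagrange interpolation of degree $k$. If $\vec\beta\in\mathbb N_0^2$ satisfies $0\le|\vec\beta|\le k+2$ and $k+2-|\vec\beta|$ is even, then $$\left|\sum_{T\in\overline{\mathcal T}_{h,\Omega}}\int_T\big(\bar D^{\vec\beta}\bar f_h-\bar D^{\vec\beta}\bar f\big)\,d\bar\sigma\right|\le C\,h^{k+2-|\vec\beta|}\,\|\bar f\|_{C^{k+2}(\Omega)},$$ with a constant $C$ independent of $h$ and $\bar f$.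
   Context: A macro element $\Omega$ is a fixed nondegenerate closed planar triangle (one of the finitely many triangles of a fixed macro grid of mesh size $h_0$). After choosing an orthonormal basis of its plane, $\Omega\subset\mathbb R^2$; $\bar D^{\vec\beta}$ denotes partial derivatives with multi-index $\vec\beta$ and $d\bar\sigma$ is Lebesgue measure. For $h<h_0$, $\overline{\mathcal T}_{h,\Omega}$ is a conforming triangulation of $\Omega$ into closed triangles; the family of triangulations is uniformly shape regular and quasi-uniform with mesh size $h$ (the maximal element diameter). Constants may depend on $\Omega$, on $k$, and on the shape-regularity and quasi-uniformity constants. Interpolation: $T_{\mathrm{ref}}$ is the reference triangle (with a vertex at $0$), $F_T:T_{\mathrm{ref}}\to T$ is an affine bijection, and $\hat I^k$ is Lagrange interpolation by polynomials of degree $k$ at the standard degree-$k$ Lagrange nodes of $T_{\mathrm{ref}}$. Then $\bar I_h^k(\bar f)|_T=\hat I^k(\bar f\circ F_T)\circ F_T^{-1}$ for every $T\in\overline{\mathcal T}_{h,\Omega}$. Derivatives of $\bar f_h$ are taken elementwise. Symmetric pair: two elements $T_1,T_2\in\overline{\mathcal T}_{h,\Omega}$ form a symmetric pair if $T_1\cap T_2=\{\bar x_0\}$ is a single point and there are affine reference maps $F_{T_i}:T_{\mathrm{ref}}\to T_i$ (onto) with $F_{T_1}(0)=F_{T_2}(0)=\bar x_0$ and $F_{T_1}(\xi)-\bar x_0=\bar x_0-F_{T_2}(\xi)$ for all $\xi\in T_{\mathrm{ref}}$. Symmetric triangulation: $\overline{\mathcal T}_{h,\Omega}$ is symmetric if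 it is a disjoint union $\mathcal A_{h,\Omega}\,\dot\cup\,\mathcal B_{h,\Omega}$, where $\mathcal A_{h,\Omega}$ can be partitioned into disjoint symmetric pairs, and the unpaired elements satisfy $\bigcup_{T\in\mathcal B_{h,\Omega}}T\subset\{\bar x\in\Omega:\operatorname{dist}(\bar x,\partial\Omega)\le h\}$ and hence $|\mathcal B_{h,\Omega}|\le C_{\partial\Omega}h^{-1}$, with $C_{\partial\Omega}$ depending only on $\Omega$ and the shape-regularity and quasi-uniformity constants. *)

theory Defs
  imports "HOL-Analysis.Analysis" "HOL-Library.Disjoint_Sets"
begin

section \<open>Partial derivatives and \<open>C\<^sup>m\<close> functions on a closed planar domain\<close>

definition has_partial_deriv :: "2 \<Rightarrow> (real^2 \<Rightarrow> real) \<Rightarrow> real^2 \<Rightarrow> bool" where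
  "has_partial_deriv i f x \<longleftrightarrow> (\<lambda>t. f (x + t *\<^sub>R axis i 1)) differentiable (at 0)"

definition partial_deriv :: "2 \<Rightarrow> (real^2 \<Rightarrow> real) \<Rightarrow> real^2 \<Rightarrow> real" where
  "partial_deriv i f x = deriv (\<lambda>t. f (x + t *\<^sub>R axis i 1)) 0"

type_synonym multi_index = "nat \<times> nat"

definition mi_order :: "multi_index \<Rightarrow> nat" where
  "mi_order \<beta> = fst \<beta> + snd \<beta>"

definition partial_derivs :: "multi_index \<Rightarrow> (real^2 \<Rightarrow> real) \<Rightarrow> real^2 \<Rightarrow> real" where
  "partial_derivs \<beta> f = (partial_deriv 1 ^^ fst \<beta>) ((partial_deriv 2 ^^ snd \<beta>) f)"

text \<open>
  For a closed set \<open>S\<close> (always the closure of its interior below), \<open>C\<^sup>m(S)\<close> is understood as: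
  all iterated partial derivatives of order at most \<open>m\<close>, in any order of differentiation, exist
  in the interior of \<open>S\<close> and extend continuously to \<open>S\<close>; the function itself is continuous
  on \<open>S\<close>.
\<close>

definition extends_continuously :: "(real^2) set \<Rightarrow> (real^2 \<Rightarrow> real) \<Rightarrow> bool" where
  "extends_continuously S f \<longleftrightarrow> (\<exists>g. continuous_on S g \<and> (\<forall>x\<in>interior S. g x = f x))"

primrec C_derivs :: "nat \<Rightarrow> (real^2) set \<Rightarrow> (real^2 \<Rightarrow> real) \<Rightarrow> bool" where
  "C_derivs 0 S f \<longleftrightarrow> extends_continuously S f"
| "C_derivs (Suc m) S f \<longleftrightarrow> extends_continuously S f \<and>
     (\<forall>i. (\<forall>x\<in>interior S. has_partial_deriv i f x) \<and> C_derivs m S (partial_deriv i f))"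

definition C_on :: "nat \<Rightarrow> (real^2) set \<Rightarrow> (real^2 \<Rightarrow> real) \<Rightarrow> bool" where
  "C_on m S f \<longleftrightarrow> continuous_on S f \<and> C_derivs m S f"

text \<open>
  The derivative \<open>D\<^sup>\<beta> f\<close> as a function on the closed set \<open>S\<close>: it depends only on the values of
  \<open>f\<close> in the interior of \<open>S\<close> and is continued to the boundary by its limit. With \<open>S\<close> a mesh
  element this is the elementwise derivative of a piecewise function.
\<close>

definition D_on :: "(real^2) set \<Rightarrow> multi_index \<Rightarrow> (real^2 \<Rightarrow> real) \<Rightarrow> real^2 \<Rightarrow> real" where
  "D_on S \<beta> f x = (if x \<in> interior S then partial_derivs \<beta> f x
                   else Lim (at x within interior S) (partial_derivs \<beta> f))"

definition C_norm :: "nat \<Rightarrow> (real^2) set \<Rightarrow> (real^2 \<Rightarrow> real) \<Rightarrow> real" where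
  "C_norm m S f = (MAX \<beta>\<in>{\<beta>. mi_order \<beta> \<le> m}. SUP x\<in>S. \<bar>D_on S \<beta> f x\<bar>)"


section \<open>Triangulations\<close>

text \<open>
  The library's \<open>triangulation\<close> demands finitely many simplices, any two of which meet in a
  common (possibly empty) face.
\<close>

definition conforming_triangulation :: "(real^2) set \<Rightarrow> (real^2) set set \<Rightarrow> bool" where
  "conforming_triangulation \<Omega> \<T> \<longleftrightarrow>
     triangulation \<T> \<and> (\<forall>T\<in>\<T>. 2 simplex T) \<and> \<Union>\<T> = \<Omega>"

definition mesh_size :: "(real^2) set set \<Rightarrow> real" where
  "mesh_size \<T> = Max (diameter ` \<T>)"

definition inradius :: "(real^2) set \<Rightarrow> real" where
  "inradius T = Sup {r. 0 \<le> r \<and> (\<exists>x. cball x r \<subseteq> T)}"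

definition shape_regular :: "real \<Rightarrow> (real^2) set set \<Rightarrow> bool" where
  "shape_regular \<kappa> \<T> \<longleftrightarrow> (\<forall>T\<in>\<T>. diameter T \<le> \<kappa> * (2 * inradius T))"

definition quasi_uniform :: "real \<Rightarrow> (real^2) set set \<Rightarrow> bool" where
  "quasi_uniform q \<T> \<longleftrightarrow> (\<forall>T\<in>\<T>. mesh_size \<T> \<le> q * diameter T)"


section \<open>Lagrange interpolation\<close>

definition T_ref :: "(real^2) set" where
  "T_ref = convex hull {0, axis 1 1, axis 2 1}"

definition reference_map :: "(real^2 \<Rightarrow> real^2) \<Rightarrow> (real^2) set \<Rightarrow> bool" where
  "reference_map F T \<longleftrightarrow>
     (\<exists>L b. linear L \<and> F = (\<lambda>\<xi>. b + L \<xi>)) \<and> bij_betw F T_ref T"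

definition lagrange_nodes :: "nat \<Rightarrow> (real^2) set" where
  "lagrange_nodes k = {vector [real i / real k, real j / real k] | i j. i + j \<le> k}"

definition poly_le :: "nat \<Rightarrow> (real^2 \<Rightarrow> real) set" where
  "poly_le k = {p. \<exists>c. \<forall>x. p x = (\<Sum>(i, j)\<in>{(i, j). i + j \<le> k}. c i j * (x $ 1) ^ i * (x $ 2) ^ j)}"

definition ref_interp :: "nat \<Rightarrow> (real^2 \<Rightarrow> real) \<Rightarrow> real^2 \<Rightarrow> real" where
  "ref_interp k g = (THE p. p \<in> poly_le k \<and> (\<forall>z\<in>lagrange_nodes k. p z = g z))"

text \<open>
  A reference map onto a nondegenerate triangle is a bijection of the whole plane, so \<open>inv\<close> is
  its genuine inverse. For a point shared by several elements the choice of \<open>T\<close> is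
  immaterial: on a common face the local interpolants of both sides coincide.
\<close>

definition interp ::
    "nat \<Rightarrow> (real^2) set set \<Rightarrow> ((real^2) set \<Rightarrow> real^2 \<Rightarrow> real^2) \<Rightarrow> (real^2 \<Rightarrow> real) \<Rightarrow> real^2 \<Rightarrow> real" where
  "interp k \<T> F f x =
     (let T = (SOME T. T \<in> \<T> \<and> x \<in> T) in ref_interp k (f \<circ> F T) (inv (F T) x))"


section \<open>Symmetric triangulations\<close>

definition symmetric_pair :: "(real^2) set \<Rightarrow> (real^2) set \<Rightarrow> bool" where
  "symmetric_pair T1 T2 \<longleftrightarrow>
     (\<exists>x0 F1 F2. T1 \<inter> T2 = {x0} \<and> reference_map F1 T1 \<and> reference_map F2 T2 \<and>
        F1 0 = x0 \<and> F2 0 = x0 \<and> (\<forall>\<xi>\<in>T_ref. F1 \<xi> - x0 = x0 - F2 \<xi>))"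

text \<open>
  The cardinality bound for the unpaired elements is not listed: it follows from the strip
  condition together with shape regularity and quasi-uniformity, by comparing areas.
\<close>

definition symmetric_triangulation :: "(real^2) set \<Rightarrow> (real^2) set set \<Rightarrow> bool" where
  "symmetric_triangulation \<Omega> \<T> \<longleftrightarrow>
     (\<exists>\<A> \<B> \<P>. \<T> = \<A> \<union> \<B> \<and> \<A> \<inter> \<B> = {} \<and>
        partition_on \<A> \<P> \<and> (\<forall>P\<in>\<P>. \<exists>T1 T2. P = {T1, T2} \<and> symmetric_pair T1 T2) \<and>
        \<Union>\<B> \<subseteq> {x\<in>\<Omega>. infdist x (frontier \<Omega>) \<le> mesh_size \<T>})"

end

theory Submission
  imports Defs
begin

text \<open>
  On an element \<open>T\<close> expand \<open>f = p + H + R\<close> at a point \<open>x0\<close> near \<open>T\<close>, with \<open>p\<close> of degree \<open>k\<close>, \<open>H\<close>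
  homogeneous of degree \<open>k + 1\<close> about \<open>x0\<close>, and \<open>R\<close> of order \<open>k + 2\<close>. Interpolation reproduces \<open>p\<close>, and \<open>R\<close>
  contributes at the claimed order \<open>h\<close> to the power \<open>k + 2 - |\<beta>|\<close> relative to the area of \<open>T\<close>. The part
  coming from \<open>H\<close> is one order worse, but for a symmetric pair with common vertex \<open>x0\<close> it is odd
  under the reflection in \<open>x0\<close> that swaps the two elements, because \<open>k + |\<beta>|\<close> is even, and it cancels.
  The unpaired elements lie in a boundary strip of area \<open>O(h)\<close>, which makes up for the lost order.
\<close>

section \<open>Partial derivatives and Taylor remainders\<close>

text \<open>The hypothesis on \<open>f\<close> only provides iterated directional derivatives in the
  interior of \<Omega>, with continuous extensions to \<Omega>. Frechet differentiability and the
  interchange of partials must therefore be derived, and the centre of an expansion must be interior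
  to \<Omega>. The common vertex of a symmetric pair is: it is the midpoint of an interior point and
  its mirror image. No Bramble-Hilbert argument is used. Derivatives of the interpolants of
  \<open>H\<close> and \<open>R\<close> are bounded by sup norms on \<open>T\<close>, at the price
  of one factor \<open>1 / r\<close> per derivative, with \<open>r\<close> the radius of an
  inscribed ball; mesh regularity gives \<open>h / r \<le> \<rho>\<close>. The cancellation requires
  the two interpolants of \<open>H\<close> to be mirror images up to sign, although the maps
  \<open>F T\<close> are unrelated to the maps that witness the symmetry. This holds because the
  mapped node set depends on \<open>T\<close> alone. In the final factor \<open>1 + 4 / r\<close>,
  now with \<open>r\<close> the radius of a ball in \<Omega>, the 1 comes from the higher-order
  error on all elements and \<open>4 / r\<close> from the area of the boundary strip.\<close>

lemma has_real_derivative_imp_partial_deriv: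
  assumes "((\<lambda>t. f (x + t *\<^sub>R axis i 1)) has_real_derivative d) (at 0)"
  shows "has_partial_deriv i f x" "partial_deriv i f x = d"
  using assms unfolding has_partial_deriv_def partial_deriv_def
  by (auto intro: DERIV_imp_deriv simp: real_differentiable_def)

lemma has_partial_deriv_imp_line:
  assumes "has_partial_deriv i f (x + s *\<^sub>R axis i 1)"
  shows "((\<lambda>t. f (x + t *\<^sub>R axis i 1)) has_real_derivative
    partial_deriv i f (x + s *\<^sub>R axis i 1)) (at s)"
proof -
  have "(\<lambda>t. f (x + s *\<^sub>R axis i 1 + t *\<^sub>R axis i 1)) field_differentiable (at 0)"
    using assms unfolding has_partial_deriv_def
    by (metis field_differentiable_def real_differentiable_def)
  then have "((\<lambda>t. f (x + (t + s) *\<^sub>R axis i 1)) has_real_derivative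
    partial_deriv i f (x + s *\<^sub>R axis i 1)) (at 0)"
    unfolding partial_deriv_def
    by (simp add: DERIV_deriv_iff_field_differentiable scaleR_add_left add_ac)
  then show ?thesis
    using DERIV_shift[of "\<lambda>t. f (x + t *\<^sub>R axis i 1)" _ 0 s] by simp
qed

lemma eventually_line_mem:
  fixes x :: "real^2"
  assumes "open U" "x \<in> U"
  shows "\<forall>\<^sub>F t in nhds 0. x + t *\<^sub>R axis i 1 \<in> U"
proof -
  have "((\<lambda>t. x + t *\<^sub>R axis i 1) \<longlongrightarrow> x + 0 *\<^sub>R axis i 1) (nhds 0)"
    by (intro tendsto_intros) (simp add: filterlim_ident)
  then show ?thesis
    using assms topological_tendstoD by force
qed

lemma has_partial_deriv_cong_open:
  assumes "open U" "x \<in> U" "\<And>y. y \<in> U \<Longrightarrow> f y = g y"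
  shows "has_partial_deriv i f x \<longleftrightarrow> has_partial_deriv i g x"
    and "partial_deriv i f x = partial_deriv i g x"
proof -
  have ev: "\<forall>\<^sub>F t in nhds 0. f (x + t *\<^sub>R axis i 1) = g (x + t *\<^sub>R axis i 1)"
    using eventually_line_mem[OF assms(1,2)] assms(3) by (rule eventually_mono) auto
  show "partial_deriv i f x = partial_deriv i g x"
    unfolding partial_deriv_def using ev by (rule deriv_cong_ev) simp
  have "((\<lambda>t. f (x + t *\<^sub>R axis i 1)) has_real_derivative d) (at 0) \<longleftrightarrow>
        ((\<lambda>t. g (x + t *\<^sub>R axis i 1)) has_real_derivative d) (at 0)" for d
    by (rule DERIV_cong_ev) (use ev in auto)
  then show "has_partial_deriv i f x \<longleftrightarrow> has_partial_deriv i g x"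
    by (simp add: has_partial_deriv_def real_differentiable_def)
qed

lemma has_derivative_imp_partial_deriv:
  assumes "(f has_derivative f') (at x)"
  shows "has_partial_deriv i f x" "partial_deriv i f x = f' (axis i 1)"
proof -
  interpret bounded_linear f' using assms by (rule has_derivative_bounded_linear)
  have "((\<lambda>t. x + t *\<^sub>R axis i 1) has_derivative (\<lambda>t. t *\<^sub>R axis i 1)) (at 0)"
    by (auto intro!: derivative_eq_intros)
  from has_derivative_compose[OF this, of f f'] assms
  have "((\<lambda>t. f (x + t *\<^sub>R axis i 1)) has_derivative (\<lambda>t. f' (t *\<^sub>R axis i 1))) (at 0)"
    by simp
  then have "((\<lambda>t. f (x + t *\<^sub>R axis i 1)) has_real_derivative f' (axis i 1)) (at 0)"
    by (simp add: has_field_derivative_def scaleR mult.commute[of _ "f' (axis i 1)"])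
  then show "has_partial_deriv i f x" "partial_deriv i f x = f' (axis i 1)"
    by (rule has_real_derivative_imp_partial_deriv)+
qed

lemma partial_deriv_mvt:
  assumes "\<And>s. \<bar>s\<bar> \<le> \<bar>h\<bar> \<Longrightarrow> has_partial_deriv i f (x + s *\<^sub>R axis i 1)"
  shows "\<exists>s. \<bar>s\<bar> \<le> \<bar>h\<bar> \<and> f (x + h *\<^sub>R axis i 1) - f x = h * partial_deriv i f (x + s *\<^sub>R axis i 1)"
proof -
  let ?g = "\<lambda>t. f (x + t *\<^sub>R axis i 1)" and ?g' = "\<lambda>t. partial_deriv i f (x + t *\<^sub>R axis i 1)"
  have D: "(?g has_real_derivative ?g' s) (at s)" if "\<bar>s\<bar> \<le> \<bar>h\<bar>" for s
    using assms[OF that] by (rule has_partial_deriv_imp_line)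
  consider "h = 0" | "0 < h" | "h < 0" by linarith
  then show ?thesis
  proof cases
    case 2
    then obtain z where "0 < z" "z < h" "?g h - ?g 0 = (h - 0) * ?g' z"
      using MVT2[of 0 h ?g ?g'] D by force
    then show ?thesis by (intro exI[of _ z]) auto
  next
    case 3
    then obtain z where "h < z" "z < 0" "?g 0 - ?g h = (0 - h) * ?g' z"
      using MVT2[of h 0 ?g ?g'] D by force
    then show ?thesis by (intro exI[of _ z]) auto
  qed auto
qed

lemma abs_two_products_le: "\<bar>a * b + c * d\<bar> \<le> \<bar>a\<bar> * \<bar>b\<bar> + \<bar>c\<bar> * \<bar>d\<bar>"
  for a b c d :: real
  by (simp flip: abs_mult)

text \<open>Walking from \<open>x\<close> to \<open>y\<close> parallel to the axes turns the
  increment into two one-dimensional ones, and the mean value theorem evaluates each partial at a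
  point near \<open>x\<close>, where continuity applies.\<close>

lemma has_derivative_continuous_partials:
  fixes f :: "real^2 \<Rightarrow> real"
  assumes "open U" "x \<in> U" "\<And>i y. y \<in> U \<Longrightarrow> has_partial_deriv i f y"
    and "\<And>i. continuous_on U (partial_deriv i f)"
  shows "(f has_derivative (\<lambda>v. v $ 1 * partial_deriv 1 f x + v $ 2 * partial_deriv 2 f x)) (at x)"
  unfolding has_derivative_at_alt
proof (intro conjI allI impI)
  let ?A = "\<lambda>v. v $ 1 * partial_deriv 1 f x + v $ 2 * partial_deriv 2 f x"
  show "bounded_linear ?A"
    by (intro bounded_linear_add bounded_linear_mult_const bounded_linear_vec_nth)
  fix e :: real assume "e > 0"
  have "\<exists>d>0. \<forall>y. dist y x < d \<longrightarrow> y \<in> U \<and> \<bar>partial_deriv i f y - partial_deriv i f x\<bar> < e/2" for i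
  proof -
    obtain d1 where "d1 > 0" "ball x d1 \<subseteq> U" using assms(1,2) openE by blast
    moreover obtain d2 where "d2 > 0"
      "\<forall>y\<in>U. dist y x < d2 \<longrightarrow> dist (partial_deriv i f y) (partial_deriv i f x) < e/2"
      using assms(4)[of i] \<open>x \<in> U\<close> \<open>e > 0\<close> unfolding continuous_on_iff by (meson half_gt_zero)
    ultimately show ?thesis
      by (intro exI[of _ "min d1 d2"]) (auto simp: dist_real_def subset_iff dist_commute)
  qed
  then obtain d1 d2 where d: "d1 > 0" "d2 > 0"
    "\<And>y. dist y x < d1 \<Longrightarrow> y \<in> U \<and> \<bar>partial_deriv 1 f y - partial_deriv 1 f x\<bar> < e/2"
    "\<And>y. dist y x < d2 \<Longrightarrow> y \<in> U \<and> \<bar>partial_deriv 2 f y - partial_deriv 2 f x\<bar> < e/2"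
    by metis
  show "\<exists>d>0. \<forall>y. norm (y - x) < d \<longrightarrow> norm (f y - f x - ?A (y - x)) \<le> e * norm (y - x)"
  proof (intro exI[of _ "min d1 d2"] conjI allI impI)
    fix y assume y: "norm (y - x) < min d1 d2"
    define v where "v = y - x"
    \<comment> \<open>The corner of the path: the first coordinate has already moved, the second not
      yet.\<close>
    define z where "z = x + v $ 1 *\<^sub>R axis 1 1"
    have yz: "y = z + v $ 2 *\<^sub>R axis 2 1"
      by (simp add: z_def v_def vec_eq_iff forall_2 axis_def)
    have n1: "norm (s *\<^sub>R axis 1 1 :: real^2) \<le> norm v" if "\<bar>s\<bar> \<le> \<bar>v $ 1\<bar>" for s
      using that component_le_norm_cart[of v 1] by simp
    have n2: "norm (z + s *\<^sub>R axis 2 1 - x) \<le> norm v" if "\<bar>s\<bar> \<le> \<bar>v $ 2\<bar>" for s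
      by (rule norm_le_componentwise_cart)
        (use that exhaust_2 in \<open>force simp: z_def axis_def\<close>)
    have in1: "dist (x + s *\<^sub>R axis 1 1) x < min d1 d2" if "\<bar>s\<bar> \<le> \<bar>v $ 1\<bar>" for s
      using n1[OF that] y by (simp add: dist_norm v_def)
    have in2: "dist (z + s *\<^sub>R axis 2 1) x < min d1 d2" if "\<bar>s\<bar> \<le> \<bar>v $ 2\<bar>" for s
      using n2[OF that] y by (simp add: dist_norm v_def)
    obtain s1 where s1: "\<bar>s1\<bar> \<le> \<bar>v $ 1\<bar>"
      "f z - f x = v $ 1 * partial_deriv 1 f (x + s1 *\<^sub>R axis 1 1)"
      using partial_deriv_mvt[of "v $ 1" 1 f x] assms(3) in1 d(3) unfolding z_def
      by (metis min_less_iff_conj)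
    obtain s2 where s2: "\<bar>s2\<bar> \<le> \<bar>v $ 2\<bar>"
      "f y - f z = v $ 2 * partial_deriv 2 f (z + s2 *\<^sub>R axis 2 1)"
      using partial_deriv_mvt[of "v $ 2" 2 f z] assms(3) in2 d(4) unfolding yz
      by (metis min_less_iff_conj)
    have "\<bar>f y - f x - ?A v\<bar> = \<bar>v $ 1 * (partial_deriv 1 f (x + s1 *\<^sub>R axis 1 1) - partial_deriv 1 f x)
       + v $ 2 * (partial_deriv 2 f (z + s2 *\<^sub>R axis 2 1) - partial_deriv 2 f x)\<bar>"
      using s1(2) s2(2) by (simp add: algebra_simps)
    also have "\<dots> \<le> \<bar>v $ 1\<bar> * \<bar>partial_deriv 1 f (x + s1 *\<^sub>R axis 1 1) - partial_deriv 1 f x\<bar>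
       + \<bar>v $ 2\<bar> * \<bar>partial_deriv 2 f (z + s2 *\<^sub>R axis 2 1) - partial_deriv 2 f x\<bar>"
      by (rule abs_two_products_le)
    also have "\<dots> \<le> norm v * (e/2) + norm v * (e/2)"
      using d(3)[of "x + s1 *\<^sub>R axis 1 1"] d(4)[of "z + s2 *\<^sub>R axis 2 1"] in1[OF s1(1)] in2[OF s2(1)]
      by (intro add_mono mult_mono component_le_norm_cart) auto
    finally show "norm (f y - f x - ?A (y - x)) \<le> e * norm (y - x)"
      by (simp add: v_def)
  qed (use d in auto)
qed

text \<open>Two mean value steps, one per direction, evaluate the second difference over a square of
  side \<open>s\<close>. That difference is symmetric in \<open>i\<close> and \<open>j\<close>, so
  exchanging their roles yields Schwarz's theorem.\<close>

lemma mixed_difference_mvt: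
  fixes f :: "real^2 \<Rightarrow> real"
  assumes "s > 0"
    and "\<And>a b. 0 \<le> a \<Longrightarrow> a \<le> s \<Longrightarrow> 0 \<le> b \<Longrightarrow> b \<le> s \<Longrightarrow>
      has_partial_deriv i f (x + a *\<^sub>R axis i 1 + b *\<^sub>R axis j 1) \<and>
      has_partial_deriv j (partial_deriv i f) (x + a *\<^sub>R axis i 1 + b *\<^sub>R axis j 1)"
  shows "\<exists>a b. 0 \<le> a \<and> a \<le> s \<and> 0 \<le> b \<and> b \<le> s \<and>
    f (x + s *\<^sub>R axis i 1 + s *\<^sub>R axis j 1) - f (x + s *\<^sub>R axis i 1) - f (x + s *\<^sub>R axis j 1) + f x
     = s * (s * partial_deriv j (partial_deriv i f) (x + a *\<^sub>R axis i 1 + b *\<^sub>R axis j 1))"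
proof -
  let ?ei = "axis i 1 :: real^2" and ?ej = "axis j 1 :: real^2"
  have D: "((\<lambda>t. f (x + t *\<^sub>R ?ei + b *\<^sub>R ?ej)) has_real_derivative
      partial_deriv i f (x + a *\<^sub>R ?ei + b *\<^sub>R ?ej)) (at a)"
    if "0 \<le> a" "a \<le> s" "0 \<le> b" "b \<le> s" for a b
    using has_partial_deriv_imp_line[of i f "x + b *\<^sub>R ?ej" a] assms(2)[OF that]
    by (simp add: add_ac)
  define \<phi> where "\<phi> = (\<lambda>t. f (x + t *\<^sub>R ?ei + s *\<^sub>R ?ej) - f (x + t *\<^sub>R ?ei + 0 *\<^sub>R ?ej))"
  define \<psi> where "\<psi> = (\<lambda>t. partial_deriv i f (x + t *\<^sub>R ?ei + s *\<^sub>R ?ej) - partial_deriv i f (x + t *\<^sub>R ?ei + 0 *\<^sub>R ?ej))"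
  have "(\<phi> has_real_derivative \<psi> t) (at t)" if "0 \<le> t" "t \<le> s" for t
    unfolding \<phi>_def \<psi>_def using that \<open>s > 0\<close> by (intro DERIV_diff D) auto
  then obtain a where a: "0 < a" "a < s" "\<phi> s - \<phi> 0 = (s - 0) * \<psi> a"
    using MVT2[of 0 s \<phi> \<psi>] \<open>s > 0\<close> by blast
  have "((\<lambda>t. partial_deriv i f (x + a *\<^sub>R ?ei + t *\<^sub>R ?ej)) has_real_derivative
      partial_deriv j (partial_deriv i f) (x + a *\<^sub>R ?ei + t *\<^sub>R ?ej)) (at t)" if "0 \<le> t" "t \<le> s" for t
    using assms(2)[of a t] a that by (intro has_partial_deriv_imp_line) auto
  then obtain b where b: "0 < b" "b < s"
    "partial_deriv i f (x + a *\<^sub>R ?ei + s *\<^sub>R ?ej) - partial_deriv i f (x + a *\<^sub>R ?ei + 0 *\<^sub>R ?ej)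
     = (s - 0) * partial_deriv j (partial_deriv i f) (x + a *\<^sub>R ?ei + b *\<^sub>R ?ej)"
    using MVT2[of 0 s "\<lambda>t. partial_deriv i f (x + a *\<^sub>R ?ei + t *\<^sub>R ?ej)"
      "\<lambda>t. partial_deriv j (partial_deriv i f) (x + a *\<^sub>R ?ei + t *\<^sub>R ?ej)"] \<open>s > 0\<close> by blast
  show ?thesis
    using a b by (intro exI[of _ a] exI[of _ b]) (auto simp: \<phi>_def \<psi>_def)
qed

text \<open>Both mixed derivatives, each at some point of the same small square, equal the second
  difference divided by the squared side. If they differed at \<open>x\<close>, continuity would
  keep them apart on the whole square.\<close>

lemma partial_deriv_commute:
  fixes f :: "real^2 \<Rightarrow> real"
  assumes "open U" "x \<in> U" "\<And>i y. y \<in> U \<Longrightarrow> has_partial_deriv i f y"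
    and "\<And>i j y. y \<in> U \<Longrightarrow> has_partial_deriv j (partial_deriv i f) y"
    and "\<And>i j. continuous_on U (partial_deriv j (partial_deriv i f))"
  shows "partial_deriv j (partial_deriv i f) x = partial_deriv i (partial_deriv j f) x"
proof (rule ccontr)
  let ?ei = "axis i 1 :: real^2" and ?ej = "axis j 1 :: real^2"
  let ?F = "partial_deriv j (partial_deriv i f)" and ?G = "partial_deriv i (partial_deriv j f)"
  assume "?F x \<noteq> ?G x"
  then have e: "\<bar>?F x - ?G x\<bar> / 2 > 0" by simp
  obtain d0 where "d0 > 0" and d0: "ball x d0 \<subseteq> U" using assms(1,2) openE by blast
  obtain d1 where "d1 > 0" and d1: "\<And>y. y \<in> U \<Longrightarrow> dist y x < d1 \<Longrightarrow> dist (?F y) (?F x) < \<bar>?F x - ?G x\<bar> / 2"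
    using assms(5)[of j i] \<open>x \<in> U\<close> e unfolding continuous_on_iff by meson
  obtain d2 where "d2 > 0" and d2: "\<And>y. y \<in> U \<Longrightarrow> dist y x < d2 \<Longrightarrow> dist (?G y) (?G x) < \<bar>?F x - ?G x\<bar> / 2"
    using assms(5)[of i j] \<open>x \<in> U\<close> e unfolding continuous_on_iff by meson
  \<comment> \<open>Points of the square are within \<open>2 * s\<close> of \<open>x\<close>;
    dividing by 3 keeps this strictly below all three radii.\<close>
  define s where "s = min d0 (min d1 d2) / 3"
  have s: "s > 0" "2 * s < d0" "2 * s < d1" "2 * s < d2"
    using \<open>d0 > 0\<close> \<open>d1 > 0\<close> \<open>d2 > 0\<close> by (auto simp: s_def)
  have near: "dist (x + a *\<^sub>R axis k 1 + b *\<^sub>R axis l 1) x \<le> 2 * s"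
    if "0 \<le> a" "a \<le> s" "0 \<le> b" "b \<le> s" for a b and k l :: 2
  proof -
    have "norm (a *\<^sub>R axis k 1 + b *\<^sub>R axis l 1 :: real^2) \<le> norm (a *\<^sub>R axis k 1 :: real^2) + norm (b *\<^sub>R axis l 1 :: real^2)"
      by (rule norm_triangle_ineq)
    then show ?thesis using that by (simp add: dist_norm add.assoc)
  qed
  then have inU: "x + a *\<^sub>R axis k 1 + b *\<^sub>R axis l 1 \<in> U"
    if "0 \<le> a" "a \<le> s" "0 \<le> b" "b \<le> s" for a b and k l :: 2
    using near[OF that, of k l] s d0 by (auto simp: dist_commute subset_iff)
  obtain a b where ab: "0 \<le> a" "a \<le> s" "0 \<le> b" "b \<le> s"
    "f (x + s *\<^sub>R ?ei + s *\<^sub>R ?ej) - f (x + s *\<^sub>R ?ei) - f (x + s *\<^sub>R ?ej) + f x = s * (s * ?F (x + a *\<^sub>R ?ei + b *\<^sub>R ?ej))"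
    using mixed_difference_mvt[of s i f x j] s(1) assms(3,4) inU by meson
  obtain a' b' where ab': "0 \<le> a'" "a' \<le> s" "0 \<le> b'" "b' \<le> s"
    "f (x + s *\<^sub>R ?ej + s *\<^sub>R ?ei) - f (x + s *\<^sub>R ?ej) - f (x + s *\<^sub>R ?ei) + f x = s * (s * ?G (x + a' *\<^sub>R ?ej + b' *\<^sub>R ?ei))"
    using mixed_difference_mvt[of s j f x i] s(1) assms(3,4) inU by meson
  have comm: "x + s *\<^sub>R ?ej + s *\<^sub>R ?ei = x + s *\<^sub>R ?ei + s *\<^sub>R ?ej" by simp
  have "s * (s * ?F (x + a *\<^sub>R ?ei + b *\<^sub>R ?ej)) = s * (s * ?G (x + a' *\<^sub>R ?ej + b' *\<^sub>R ?ei))"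
    using ab(5) ab'(5) unfolding comm by linarith
  then have "?F (x + a *\<^sub>R ?ei + b *\<^sub>R ?ej) = ?G (x + a' *\<^sub>R ?ej + b' *\<^sub>R ?ei)"
    using s(1) by simp
  moreover have "dist (?F (x + a *\<^sub>R ?ei + b *\<^sub>R ?ej)) (?F x) < \<bar>?F x - ?G x\<bar> / 2"
    using d1 inU near s ab by (meson le_less_trans)
  moreover have "dist (?G (x + a' *\<^sub>R ?ej + b' *\<^sub>R ?ei)) (?G x) < \<bar>?F x - ?G x\<bar> / 2"
    using d2 inU near s ab' by (meson le_less_trans)
  ultimately show False by (simp add: dist_real_def) argo
qed

section \<open>The class \<open>C_derivs\<close> and its iterated derivatives\<close>

lemma C_derivs_imp_extends: "C_derivs m S f \<Longrightarrow> extends_continuously S f"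
  by (cases m) auto

lemma extends_continuously_imp_continuous_on:
  assumes "extends_continuously S f"
  shows "continuous_on (interior S) f"
proof -
  obtain g where "continuous_on S g" "\<And>x. x \<in> interior S \<Longrightarrow> g x = f x"
    using assms unfolding extends_continuously_def by blast
  then show ?thesis
    by (metis continuous_on_cong continuous_on_subset interior_subset)
qed

lemma C_derivs_imp_continuous_on: "C_derivs m S f \<Longrightarrow> continuous_on (interior S) f"
  using C_derivs_imp_extends extends_continuously_imp_continuous_on by blast

lemma C_derivs_Suc_imp: "C_derivs (Suc m) S f \<Longrightarrow> C_derivs m S f"
  by (induction m arbitrary: f) auto

lemma C_derivs_le: "C_derivs m S f \<Longrightarrow> n \<le> m \<Longrightarrow> C_derivs n S f"
  by (induction m) (auto simp only: le_Suc_eq dest: C_derivs_Suc_imp)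

lemma C_derivs_cong:
  assumes "\<And>x. x \<in> interior S \<Longrightarrow> f x = g x"
  shows "C_derivs m S f \<longleftrightarrow> C_derivs m S g"
  using assms
proof (induction m arbitrary: f g)
  case 0
  then show ?case by (simp add: extends_continuously_def)
next
  case (Suc m)
  have "C_derivs m S (partial_deriv i f) \<longleftrightarrow> C_derivs m S (partial_deriv i g)" for i
    by (rule Suc.IH, rule has_partial_deriv_cong_open(2)[of "interior S"]) (use Suc.prems in auto)
  moreover have "has_partial_deriv i f x \<longleftrightarrow> has_partial_deriv i g x" if "x \<in> interior S" for i x
    by (rule has_partial_deriv_cong_open(1)[of "interior S"]) (use that Suc.prems in auto)
  moreover have "extends_continuously S f \<longleftrightarrow> extends_continuously S g"
    using Suc.prems by (simp add: extends_continuously_def)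
  ultimately show ?case by simp
qed

text \<open>Lists of directions permit induction on a single differentiation;
  \<open>partial_derivs\<close> is the case of a block of 1s followed by a block of 2s. The last
  direction in the list is applied first.\<close>

abbreviation iter_partial_deriv :: "2 list \<Rightarrow> (real^2 \<Rightarrow> real) \<Rightarrow> real^2 \<Rightarrow> real" where
  "iter_partial_deriv \<equiv> foldr partial_deriv"

lemma C_derivs_iter:
  "C_derivs (m + length ds) S f \<Longrightarrow> C_derivs m S (iter_partial_deriv ds f)"
  by (induction ds arbitrary: m) (auto, metis C_derivs.simps(2) add_Suc)

lemma partial_derivs_eq_iter:
  "partial_derivs (a, b) f = iter_partial_deriv (replicate a 1 @ replicate b 2) f"
  by (simp add: partial_derivs_def foldr_replicate)

lemma C_derivs_partial_derivs:
  "C_derivs (m + (a + b)) S f \<Longrightarrow> C_derivs m S (partial_derivs (a, b) f)"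
  unfolding partial_derivs_eq_iter by (rule C_derivs_iter) simp

lemma iter_partial_deriv_cong_open:
  assumes "open U" "x \<in> U" "\<And>y. y \<in> U \<Longrightarrow> f y = g y"
  shows "iter_partial_deriv ds f x = iter_partial_deriv ds g x"
  using assms(2)
proof (induction ds arbitrary: x)
  case (Cons d ds)
  then show ?case
    using has_partial_deriv_cong_open(2)[of U x "iter_partial_deriv ds f" "iter_partial_deriv ds g"] assms(1)
    by simp
qed (use assms in auto)

lemma partial_derivs_cong_open:
  assumes "open U" "x \<in> U" "\<And>y. y \<in> U \<Longrightarrow> f y = g y"
  shows "partial_derivs \<beta> f x = partial_derivs \<beta> g x"
  using iter_partial_deriv_cong_open[where f=f and g=g, OF assms(1,2)] assms(3) by (metis partial_derivs_eq_iter surj_pair)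

lemma C_derivs_partial_deriv_commute:
  assumes "C_derivs 2 S f" "x \<in> interior S"
  shows "partial_deriv j (partial_deriv i f) x = partial_deriv i (partial_deriv j f) x"
proof (rule partial_deriv_commute[of "interior S"])
  have 2: "(2::nat) = Suc (Suc 0)" by simp
  have f: "C_derivs (Suc (Suc 0)) S f" using assms(1) unfolding 2 .
  show "has_partial_deriv i f y" if "y \<in> interior S" for i y
    using f that by simp
  show "has_partial_deriv j (partial_deriv i f) y" if "y \<in> interior S" for i j y
    using f that by simp
  show "continuous_on (interior S) (partial_deriv j (partial_deriv i f))" for i j
    using f by (auto intro: extends_continuously_imp_continuous_on)
qed (use assms in auto)

text \<open>\<open>partial_derivs\<close> applies all differentiations in direction 2 before those
  in direction 1, so a further one in direction 2 must be moved inwards past the latter.\<close>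

lemma C_derivs_partial_deriv_commute_iter:
  assumes "C_derivs (Suc a) S f" "x \<in> interior S"
  shows "partial_deriv j ((partial_deriv i ^^ a) f) x = (partial_deriv i ^^ a) (partial_deriv j f) x"
  using assms
proof (induction a arbitrary: x)
  case (Suc a)
  have "C_derivs 2 S ((partial_deriv i ^^ a) f)"
    using C_derivs_iter[of 2 "replicate a i" S f] Suc.prems(1) by (simp add: foldr_replicate)
  then have "partial_deriv j ((partial_deriv i ^^ Suc a) f) x
      = partial_deriv i (partial_deriv j ((partial_deriv i ^^ a) f)) x"
    using C_derivs_partial_deriv_commute Suc.prems(2) by simp
  also have "\<dots> = partial_deriv i ((partial_deriv i ^^ a) (partial_deriv j f)) x"
    by (rule has_partial_deriv_cong_open(2)[of "interior S"])
      (use Suc.prems Suc.IH C_derivs_Suc_imp in auto)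
  finally show ?case by simp
qed simp

lemma partial_derivs_has_derivative:
  assumes "C_derivs m S f" "a + b < m" "x \<in> interior S"
  shows "(partial_derivs (a, b) f has_derivative
    (\<lambda>v. v $ 1 * partial_derivs (Suc a, b) f x + v $ 2 * partial_derivs (a, Suc b) f x)) (at x)"
proof -
  have 1: "C_derivs (Suc 0) S (partial_derivs (a, b) f)"
    by (intro C_derivs_partial_derivs C_derivs_le[OF assms(1)]) (use assms(2) in simp)
  have "C_derivs (Suc a) S ((partial_deriv 2 ^^ b) f)"
    using C_derivs_iter[of "Suc a" "replicate b 2" S f] assms(1,2) C_derivs_le[of m S f "Suc a + b"]
    by (simp add: foldr_replicate)
  then have "partial_deriv 2 (partial_derivs (a, b) f) x = partial_derivs (a, Suc b) f x"
    using C_derivs_partial_deriv_commute_iter assms(3) by (simp add: partial_derivs_def)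
  moreover have "partial_deriv 1 (partial_derivs (a, b) f) x = partial_derivs (Suc a, b) f x"
    by (simp add: partial_derivs_def)
  moreover have "(partial_derivs (a, b) f has_derivative (\<lambda>v. v $ 1 * partial_deriv 1 (partial_derivs (a, b) f) x
      + v $ 2 * partial_deriv 2 (partial_derivs (a, b) f) x)) (at x)"
    by (rule has_derivative_continuous_partials[of "interior S"])
      (use 1 assms(3) in \<open>auto intro: extends_continuously_imp_continuous_on\<close>)
  ultimately show ?thesis by simp
qed

section \<open>Linearity of iterated derivatives\<close>

lemma has_partial_deriv_lincomb:
  assumes "has_partial_deriv i f x" "has_partial_deriv i g x"
  shows "has_partial_deriv i (\<lambda>x. f x + c * g x) x"
    and "partial_deriv i (\<lambda>x. f x + c * g x) x = partial_deriv i f x + c * partial_deriv i g x"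
proof -
  have "((\<lambda>t. f (x + t *\<^sub>R axis i 1)) has_real_derivative partial_deriv i f x) (at 0)"
    "((\<lambda>t. g (x + t *\<^sub>R axis i 1)) has_real_derivative partial_deriv i g x) (at 0)"
    using has_partial_deriv_imp_line[of i _ x 0] assms by auto
  then have "((\<lambda>t. f (x + t *\<^sub>R axis i 1) + c * g (x + t *\<^sub>R axis i 1)) has_real_derivative
    partial_deriv i f x + c * partial_deriv i g x) (at 0)"
    by (auto intro!: derivative_eq_intros)
  then show "has_partial_deriv i (\<lambda>x. f x + c * g x) x"
    "partial_deriv i (\<lambda>x. f x + c * g x) x = partial_deriv i f x + c * partial_deriv i g x"
    by (rule has_real_derivative_imp_partial_deriv)+
qed

lemma extends_continuously_lincomb:
  assumes "extends_continuously S f" "extends_continuously S g"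
  shows "extends_continuously S (\<lambda>x. f x + c * g x)"
proof -
  obtain f' g' where "continuous_on S f'" "\<forall>x\<in>interior S. f' x = f x"
    "continuous_on S g'" "\<forall>x\<in>interior S. g' x = g x"
    using assms unfolding extends_continuously_def by blast
  then show ?thesis
    unfolding extends_continuously_def
    by (intro exI[of _ "\<lambda>x. f' x + c * g' x"]) (auto intro!: continuous_intros)
qed

lemma C_derivs_lincomb:
  assumes "C_derivs m S f" "C_derivs m S g"
  shows "C_derivs m S (\<lambda>x. f x + c * g x)"
  using assms
proof (induction m arbitrary: f g)
  case 0
  then show ?case by (simp add: extends_continuously_lincomb)
next
  case (Suc m)
  have "C_derivs m S (partial_deriv i (\<lambda>x. f x + c * g x))" for i
  proof -
    have "C_derivs m S (\<lambda>x. partial_deriv i f x + c * partial_deriv i g x)"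
      using Suc by simp
    then show ?thesis
      by (subst C_derivs_cong[of S _ "\<lambda>x. partial_deriv i f x + c * partial_deriv i g x"])
        (use Suc.prems has_partial_deriv_lincomb in auto)
  qed
  then show ?case
    using Suc.prems by (auto simp: extends_continuously_lincomb has_partial_deriv_lincomb)
qed

lemma iter_partial_deriv_lincomb:
  assumes "C_derivs m S f" "C_derivs m S g" "length ds \<le> m" "x \<in> interior S"
  shows "iter_partial_deriv ds (\<lambda>x. f x + c * g x) x
    = iter_partial_deriv ds f x + c * iter_partial_deriv ds g x"
  using assms(3,4)
proof (induction ds arbitrary: x)
  case (Cons d ds)
  have "C_derivs (Suc 0) S (iter_partial_deriv ds f)" "C_derivs (Suc 0) S (iter_partial_deriv ds g)"
    using assms(1,2) Cons.prems(1) by (auto intro!: C_derivs_iter C_derivs_le[of m] simp del: C_derivs.simps)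
  then have D: "has_partial_deriv d (iter_partial_deriv ds f) x" "has_partial_deriv d (iter_partial_deriv ds g) x"
    using Cons.prems(2) by auto
  have "partial_deriv d (iter_partial_deriv ds (\<lambda>x. f x + c * g x)) x
     = partial_deriv d (\<lambda>x. iter_partial_deriv ds f x + c * iter_partial_deriv ds g x) x"
    by (rule has_partial_deriv_cong_open(2)[of "interior S"]) (use Cons in auto)
  then show ?case using has_partial_deriv_lincomb(2)[OF D] by simp
qed simp

lemma partial_derivs_lincomb:
  assumes "C_derivs m S f" "C_derivs m S g" "mi_order \<beta> \<le> m" "x \<in> interior S"
  shows "partial_derivs \<beta> (\<lambda>x. f x + c * g x) x = partial_derivs \<beta> f x + c * partial_derivs \<beta> g x"
proof -
  let ?ds = "replicate (fst \<beta>) 1 @ replicate (snd \<beta>) 2"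
  have eq: "partial_derivs \<beta> u = iter_partial_deriv ?ds u" for u
    using partial_derivs_eq_iter[of "fst \<beta>" "snd \<beta>"] by simp
  have "length ?ds \<le> m"
    using assms(3) by (simp add: mi_order_def)
  then show ?thesis
    unfolding eq by (rule iter_partial_deriv_lincomb[OF assms(1,2) _ assms(4)])
qed

text \<open>This takes the place of Taylor's formula with remainder. The array \<open>d\<close>
  models the derivatives of one function; going down from order \<open>m\<close>, each order gains a
  factor \<open>2 * norm (x - x0)\<close> because \<open>d a b\<close> vanishes at
  \<open>x0\<close>. The 2 bounds the two terms of the gradient by the norm of \<open>v\<close>
  each.\<close>

lemma iterated_mean_value_bound:
  fixes d :: "nat \<Rightarrow> nat \<Rightarrow> real^2 \<Rightarrow> real"
  assumes "convex U" "x0 \<in> U" "0 \<le> M"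
    and der: "\<And>a b x. a + b < m \<Longrightarrow> x \<in> U \<Longrightarrow>
      (d a b has_derivative (\<lambda>v. v $ 1 * d (Suc a) b x + v $ 2 * d a (Suc b) x)) (at x)"
    and zero: "\<And>a b. a + b < m \<Longrightarrow> d a b x0 = 0"
    and top: "\<And>a b x. a + b = m \<Longrightarrow> x \<in> U \<Longrightarrow> \<bar>d a b x\<bar> \<le> M"
    and "a + b \<le> m" "x \<in> U"
  shows "\<bar>d a b x\<bar> \<le> M * (2 * norm (x - x0)) ^ (m - (a + b))"
  using assms(7,8)
proof (induction "m - (a + b)" arbitrary: a b x)
  case 0
  then show ?case using top[of a b x] by simp
next
  case (Suc n)
  \<comment> \<open>Intersecting with the ball keeps the set convex and makes every intermediate
    point at most as far from \<open>x0\<close> as \<open>x\<close> is.\<close>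
  let ?V = "U \<inter> cball x0 (norm (x - x0))"
  define B where "B = M * (2 * norm (x - x0)) ^ n"
  have B: "B \<ge> 0" using \<open>0 \<le> M\<close> by (simp add: B_def)
  have ab: "a + b < m" "m - (a + b) = Suc n" and nth: "m - Suc (a + b) = n" using Suc.hyps(2) by auto
  have le: "\<bar>d (Suc a) b y\<bar> \<le> B" "\<bar>d a (Suc b) y\<bar> \<le> B" if "y \<in> ?V" for y
  proof -
    have "M * (2 * norm (y - x0)) ^ n \<le> B"
      unfolding B_def using that \<open>0 \<le> M\<close>
      by (intro mult_left_mono power_mono) (auto simp: dist_norm norm_minus_commute)
    moreover have "\<bar>d (Suc a) b y\<bar> \<le> M * (2 * norm (y - x0)) ^ n"
      using Suc.hyps(1)[of "Suc a" b y] that ab by (simp add: nth)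
    moreover have "\<bar>d a (Suc b) y\<bar> \<le> M * (2 * norm (y - x0)) ^ n"
      using Suc.hyps(1)[of a "Suc b" y] that ab by (simp add: nth)
    ultimately show "\<bar>d (Suc a) b y\<bar> \<le> B" "\<bar>d a (Suc b) y\<bar> \<le> B" by linarith+
  qed
  have "norm (d a b x - d a b x0) \<le> (2 * B) * norm (x - x0)"
  proof (rule differentiable_bound[of ?V])
    show "convex ?V" by (intro convex_Int \<open>convex U\<close> convex_cball)
    show "x \<in> ?V" "x0 \<in> ?V" using Suc.prems \<open>x0 \<in> U\<close> by (auto simp: dist_norm norm_minus_commute)
    fix y assume y: "y \<in> ?V"
    show "(d a b has_derivative (\<lambda>v. v $ 1 * d (Suc a) b y + v $ 2 * d a (Suc b) y)) (at y within ?V)"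
      using der[OF ab(1)] y by (simp add: has_derivative_at_withinI)
    show "onorm (\<lambda>v::real^2. v $ 1 * d (Suc a) b y + v $ 2 * d a (Suc b) y) \<le> 2 * B"
    proof (rule onorm_bound)
      fix v :: "real^2"
      have "\<bar>v $ 1 * d (Suc a) b y + v $ 2 * d a (Suc b) y\<bar> \<le> \<bar>v $ 1\<bar> * \<bar>d (Suc a) b y\<bar> + \<bar>v $ 2\<bar> * \<bar>d a (Suc b) y\<bar>"
        by (rule abs_two_products_le)
      also have "\<dots> \<le> norm v * B + norm v * B"
        using le[OF y] by (intro add_mono mult_mono component_le_norm_cart) auto
      finally show "norm (v $ 1 * d (Suc a) b y + v $ 2 * d a (Suc b) y) \<le> 2 * B * norm v"
        by (simp add: mult_ac)
    qed (use B in simp)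
  qed
  then show ?case
    using zero[OF ab(1)] by (simp add: B_def ab(2) mult_ac)
qed


section \<open>Polynomials and their derivatives\<close>

lemma real_polynomial_function_partial_deriv:
  fixes p :: "real^2 \<Rightarrow> real"
  assumes "real_polynomial_function p"
  shows "has_partial_deriv i p x" "real_polynomial_function (partial_deriv i p)"
proof -
  have "\<exists>q. real_polynomial_function q \<and>
    (\<forall>x. ((\<lambda>t. p (x + t *\<^sub>R axis i 1)) has_real_derivative q x) (at 0))"
    using assms
  proof (induction p rule: real_polynomial_function.induct)
    case (linear f)
    then interpret bounded_linear f .
    have "((\<lambda>t. f (x + t *\<^sub>R axis i 1)) has_real_derivative f (axis i 1)) (at 0)" for x
      by (auto simp: add scaleR intro!: derivative_eq_intros)
    then show ?case by blast
  next
    case (const c)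
    then show ?case by (intro exI[of _ "\<lambda>_. 0"]) auto
  next
    case (add f g)
    then obtain f' g' where
      "real_polynomial_function f'" "\<And>x. ((\<lambda>t. f (x + t *\<^sub>R axis i 1)) has_real_derivative f' x) (at 0)"
      "real_polynomial_function g'" "\<And>x. ((\<lambda>t. g (x + t *\<^sub>R axis i 1)) has_real_derivative g' x) (at 0)"
      by blast
    then show ?case by (intro exI[of _ "\<lambda>x. f' x + g' x"]) (auto intro!: derivative_eq_intros)
  next
    case (mult f g)
    then obtain f' g' where
      "real_polynomial_function f'" "\<And>x. ((\<lambda>t. f (x + t *\<^sub>R axis i 1)) has_real_derivative f' x) (at 0)"
      "real_polynomial_function g'" "\<And>x. ((\<lambda>t. g (x + t *\<^sub>R axis i 1)) has_real_derivative g' x) (at 0)"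
      by blast
    with mult(1,2) show ?case
      by (intro exI[of _ "\<lambda>x. f' x * g x + f x * g' x"]) (auto intro!: derivative_eq_intros)
  qed
  then obtain q where q: "real_polynomial_function q"
    "\<And>x. ((\<lambda>t. p (x + t *\<^sub>R axis i 1)) has_real_derivative q x) (at 0)"
    by blast
  then have "partial_deriv i p = q"
    using has_real_derivative_imp_partial_deriv(2) by blast
  then show "has_partial_deriv i p x" "real_polynomial_function (partial_deriv i p)"
    using q has_real_derivative_imp_partial_deriv(1) by blast+
qed

lemma real_polynomial_function_iter_partial_deriv:
  "real_polynomial_function p \<Longrightarrow> real_polynomial_function (iter_partial_deriv ds p)"
  by (induction ds) (auto intro: real_polynomial_function_partial_deriv)

lemma continuous_on_real_polynomial_function:
  "real_polynomial_function p \<Longrightarrow> continuous_on S p"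
  by (simp add: continuous_on_polymonial_function real_polynomial_function_eq)

lemma C_derivs_real_polynomial_function:
  "real_polynomial_function p \<Longrightarrow> C_derivs m S p"
proof (induction m arbitrary: p)
  case 0
  then show ?case
    by (auto simp: extends_continuously_def intro!: exI[of _ p] continuous_on_real_polynomial_function)
next
  case (Suc m)
  then show ?case
    by (auto simp: extends_continuously_def real_polynomial_function_partial_deriv
        intro!: exI[of _ p] continuous_on_real_polynomial_function)
qed

lemma iter_partial_deriv_zero [simp]: "iter_partial_deriv ds (\<lambda>x. 0) = (\<lambda>x. 0)"
proof
  have 0: "C_derivs (length ds) UNIV (\<lambda>x. 0)"
    by (rule C_derivs_real_polynomial_function) auto
  fix x show "iter_partial_deriv ds (\<lambda>x. 0) x = 0"
    using iter_partial_deriv_lincomb[OF 0 0, of ds x 1] by simp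
qed

lemma iter_partial_deriv_sum:
  assumes "finite I" "\<And>i. i \<in> I \<Longrightarrow> real_polynomial_function (p i)"
  shows "iter_partial_deriv ds (\<lambda>x. \<Sum>i\<in>I. c i * p i x) x = (\<Sum>i\<in>I. c i * iter_partial_deriv ds (p i) x)"
  using assms
proof (induction I)
  case (insert i I)
  have "iter_partial_deriv ds (\<lambda>x. (\<Sum>i\<in>I. c i * p i x) + c i * p i x) x
    = iter_partial_deriv ds (\<lambda>x. \<Sum>i\<in>I. c i * p i x) x + c i * iter_partial_deriv ds (p i) x"
    by (rule iter_partial_deriv_lincomb[of "length ds" UNIV])
      (use insert in \<open>auto intro!: C_derivs_real_polynomial_function real_polynomial_function_sum real_polynomial_function.intros(4)\<close>)
  then show ?case using insert by (simp add: add.commute)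
qed simp

lemma real_polynomial_function_has_derivative:
  fixes p :: "real^2 \<Rightarrow> real"
  assumes "real_polynomial_function p"
  shows "(p has_derivative (\<lambda>v. \<Sum>j\<in>UNIV. v $ j * partial_deriv j p x)) (at x)"
  using partial_derivs_has_derivative[OF C_derivs_real_polynomial_function[OF assms], of 0 0 1 x UNIV]
  by (simp add: partial_derivs_def sum_2)

lemma partial_deriv_affine_compose:
  fixes p :: "real^2 \<Rightarrow> real"
  assumes "real_polynomial_function p" "linear L"
  shows "partial_deriv i (\<lambda>x. p (L x + c)) x = (\<Sum>j\<in>UNIV. L (axis i 1) $ j * partial_deriv j p (L x + c))"
proof -
  have "((\<lambda>x. L x + c) has_derivative L) (at x)"
    using linear_imp_has_derivative[OF assms(2)] by (auto intro!: derivative_eq_intros)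
  from has_derivative_compose[OF this real_polynomial_function_has_derivative[OF assms(1)]]
  show ?thesis by (rule has_derivative_imp_partial_deriv(2))
qed

lemma real_polynomial_function_affine_compose:
  fixes L :: "real^2 \<Rightarrow> real^2"
  assumes "real_polynomial_function p" "linear L"
  shows "real_polynomial_function (\<lambda>x. p (L x + c))"
proof -
  have "polynomial_function (\<lambda>x. L x + c)"
    using assms(2) by (intro polynomial_function_add polynomial_function_bounded_linear polynomial_function_const)
      (auto simp: linear_conv_bounded_linear)
  then show ?thesis
    using real_polynomial_function_compose[OF _ assms(1)] by (simp add: o_def)
qed

text \<open>By the chain rule each differentiation releases one entry of \<open>L\<close>, and the
  derivatives of \<open>p\<close> that remain are bounded on the compact set \<open>S\<close>. So
  \<open>K\<close> depends on \<open>p\<close>, \<open>S\<close> and \<open>ds\<close>, but not on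
  the affine map. The induction removes the innermost derivative, which leaves polynomials composed
  with the same map.\<close>

lemma iter_partial_deriv_affine_bound:
  fixes p :: "real^2 \<Rightarrow> real"
  assumes "real_polynomial_function p" "compact S"
  shows "\<exists>K\<ge>0. \<forall>L c \<Lambda> x. linear L \<longrightarrow> (\<forall>i j. \<bar>L (axis i 1) $ j\<bar> \<le> \<Lambda>) \<longrightarrow> L x + c \<in> S \<longrightarrow>
    \<bar>iter_partial_deriv ds (\<lambda>x. p (L x + c)) x\<bar> \<le> K * \<Lambda> ^ length ds"
  using assms(1)
proof (induction ds arbitrary: p rule: rev_induct)
  case Nil
  have "bounded (p ` S)"
    using Nil assms(2) by (intro compact_imp_bounded compact_continuous_image continuous_on_real_polynomial_function)
  then obtain K where "\<And>y. y \<in> S \<Longrightarrow> \<bar>p y\<bar> \<le> K"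
    unfolding bounded_iff by auto
  then show ?case by (intro exI[of _ "max K 0"]) (auto simp: le_max_iff_disj)
next
  case (snoc i ds)
  have "\<exists>K\<ge>0. \<forall>L c \<Lambda> x. linear L \<longrightarrow> (\<forall>i j. \<bar>L (axis i 1) $ j\<bar> \<le> \<Lambda>) \<longrightarrow> L x + c \<in> S \<longrightarrow>
    \<bar>iter_partial_deriv ds (\<lambda>x. partial_deriv j p (L x + c)) x\<bar> \<le> K * \<Lambda> ^ length ds" for j
    by (rule snoc.IH[OF real_polynomial_function_partial_deriv(2)[OF snoc.prems]])
  then obtain K where K: "\<And>j. K j \<ge> 0" "\<And>j L c \<Lambda> x. linear L \<Longrightarrow> (\<forall>i j. \<bar>L (axis i 1) $ j\<bar> \<le> \<Lambda>) \<Longrightarrow> L x + c \<in> S \<Longrightarrow>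
    \<bar>iter_partial_deriv ds (\<lambda>x. partial_deriv j p (L x + c)) x\<bar> \<le> K j * \<Lambda> ^ length ds"
    by metis
  show ?case
  proof (intro exI[of _ "\<Sum>j\<in>UNIV. K j"] conjI allI impI)
    fix L :: "real^2 \<Rightarrow> real^2" and c \<Lambda> x
    assume L: "linear L" and \<Lambda>: "\<forall>i j. \<bar>L (axis i 1) $ j\<bar> \<le> \<Lambda>" and x: "L x + c \<in> S"
    have "\<Lambda> \<ge> 0" using \<Lambda> by (meson abs_ge_zero order_trans)
    have "partial_deriv i (\<lambda>x. p (L x + c)) = (\<lambda>x. \<Sum>j\<in>UNIV. L (axis i 1) $ j * partial_deriv j p (L x + c))"
      using partial_deriv_affine_compose[OF snoc.prems L] by blast
    then have "iter_partial_deriv (ds @ [i]) (\<lambda>x. p (L x + c)) x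
        = (\<Sum>j\<in>UNIV. L (axis i 1) $ j * iter_partial_deriv ds (\<lambda>x. partial_deriv j p (L x + c)) x)"
      using snoc.prems L
      by (simp add: iter_partial_deriv_sum real_polynomial_function_affine_compose real_polynomial_function_partial_deriv)
    also have "\<bar>\<dots>\<bar> \<le> (\<Sum>j\<in>UNIV. \<bar>L (axis i 1) $ j\<bar> * \<bar>iter_partial_deriv ds (\<lambda>x. partial_deriv j p (L x + c)) x\<bar>)"
      by (rule order_trans[OF sum_abs]) (simp add: abs_mult)
    also have "\<dots> \<le> (\<Sum>j\<in>UNIV. \<Lambda> * (K j * \<Lambda> ^ length ds))"
      using \<Lambda> \<open>\<Lambda> \<ge> 0\<close> K(2)[OF L \<Lambda> x] by (intro sum_mono mult_mono) auto
    finally show "\<bar>iter_partial_deriv (ds @ [i]) (\<lambda>x. p (L x + c)) x\<bar> \<le> (\<Sum>j\<in>UNIV. K j) * \<Lambda> ^ length (ds @ [i])"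
      by (simp add: sum_distrib_right sum_distrib_left mult_ac)
  qed (simp add: K sum_nonneg)
qed

lemma iter_partial_deriv_reflect:
  fixes p :: "real^2 \<Rightarrow> real"
  assumes "real_polynomial_function p"
  shows "iter_partial_deriv ds (\<lambda>x. p (c - x)) x = (-1) ^ length ds * iter_partial_deriv ds p (c - x)"
proof (induction ds arbitrary: x)
  case (Cons d ds)
  let ?q = "iter_partial_deriv ds p"
  have q: "real_polynomial_function ?q"
    by (rule real_polynomial_function_iter_partial_deriv[OF assms])
  have lin: "linear (\<lambda>x::real^2. - x)" by (rule bounded_linear.linear) (rule bounded_linear_minus[OF bounded_linear_ident])
  have "partial_deriv d (\<lambda>x. ?q (c - x)) x = (\<Sum>j\<in>UNIV. (- axis d 1) $ j * partial_deriv j ?q (c - x))"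
    using partial_deriv_affine_compose[OF q lin, of d c x] by simp
  also have "\<dots> = - partial_deriv d ?q (c - x)"
    by (auto simp: axis_def if_distrib if_distribR sum_negf cong: if_cong)
  finally have *: "partial_deriv d (\<lambda>x. ?q (c - x)) x = - partial_deriv d ?q (c - x)" .
  have q': "real_polynomial_function (\<lambda>x. ?q (c - x))"
    using real_polynomial_function_affine_compose[OF q lin, of c] by simp
  \<comment> \<open>The leading 0 puts the scalar multiple into the shape of
    \<open>has_partial_deriv_lincomb\<close>.\<close>
  have "iter_partial_deriv ds (\<lambda>x. p (c - x)) = (\<lambda>x. 0 + (-1) ^ length ds * ?q (c - x))"
    using Cons.IH by auto
  then have "partial_deriv d (iter_partial_deriv ds (\<lambda>x. p (c - x))) x
      = partial_deriv d (\<lambda>x. 0 + (-1) ^ length ds * ?q (c - x)) x"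
    by simp
  also have "\<dots> = partial_deriv d (\<lambda>x. 0) x + (-1) ^ length ds * partial_deriv d (\<lambda>x. ?q (c - x)) x"
    by (intro has_partial_deriv_lincomb real_polynomial_function_partial_deriv q') auto
  also have "partial_deriv d (\<lambda>x. 0) x = 0"
    using iter_partial_deriv_zero[of "[d]"] by (simp add: fun_eq_iff)
  finally show ?case using * by simp
qed simp

text \<open>With the factorials split off, \<open>c i j\<close> is the derivative of order
  \<open>(i, j)\<close> at \<open>a\<close>, and differentiation merely shifts indices.
  \<open>N\<close> only caps each index separately; total degree and homogeneity are imposed by the
  vanishing of \<open>c\<close>.\<close>

definition taylor_poly :: "nat \<Rightarrow> (nat \<Rightarrow> nat \<Rightarrow> real) \<Rightarrow> real^2 \<Rightarrow> real^2 \<Rightarrow> real" where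
  "taylor_poly N c a x =
     (\<Sum>i\<le>N. \<Sum>j\<le>N. c i j * ((x $ 1 - a $ 1) ^ i / fact i) * ((x $ 2 - a $ 2) ^ j / fact j))"

lemma real_polynomial_function_nth [intro]: "real_polynomial_function (\<lambda>x::real^2. x $ i)"
  by (intro real_polynomial_function.intros(1) bounded_linear_vec_nth)

lemma real_polynomial_function_taylor_poly [intro]: "real_polynomial_function (taylor_poly N c a)"
  unfolding taylor_poly_def[abs_def]
  by (intro real_polynomial_function_sum real_polynomial_function.intros(4) real_polynomial_function_divide
      real_polynomial_function_power real_polynomial_function_diff real_polynomial_function_nth
      real_polynomial_function.intros(2)) auto

lemma taylor_sum_has_derivative:
  assumes "C (Suc N) = 0"
  shows "((\<lambda>t. \<Sum>i\<le>N. C i * ((y + t) ^ i / fact i)) has_real_derivative (\<Sum>i\<le>N. C (Suc i) * (y ^ i / fact i))) (at 0)"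
proof -
  have "((\<lambda>t. \<Sum>i\<le>N. C i * ((y + t) ^ i / fact i)) has_real_derivative
      (\<Sum>i\<le>N. C i * (real i * y ^ (i - 1) / fact i))) (at 0)"
    by (auto intro!: derivative_eq_intros sum.cong)
  also have "(\<Sum>i\<le>N. C i * (real i * y ^ (i - 1) / fact i)) = (\<Sum>i<N. C (Suc i) * (real (Suc i) * y ^ i / fact (Suc i)))"
    unfolding lessThan_Suc_atMost[symmetric] by (subst sum.lessThan_Suc_shift) simp
  also have "\<dots> = (\<Sum>i<N. C (Suc i) * (y ^ i / fact i))"
    by (intro sum.cong refl) (simp add: field_simps del: of_nat_Suc)
  \<comment> \<open>The new term \<open>i = N\<close> carries the coefficient
    \<open>C (Suc N)\<close>, which is zero.\<close>
  also have "\<dots> = (\<Sum>i\<le>N. C (Suc i) * (y ^ i / fact i))"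
    using assms by (simp flip: lessThan_Suc_atMost)
  finally show ?thesis .
qed

lemma partial_deriv_taylor_poly:
  "(\<And>j. c (Suc N) j = 0) \<Longrightarrow> partial_deriv 1 (taylor_poly N c a) = taylor_poly N (\<lambda>i j. c (Suc i) j) a"
  "(\<And>i. c i (Suc N) = 0) \<Longrightarrow> partial_deriv 2 (taylor_poly N c a) = taylor_poly N (\<lambda>i j. c i (Suc j)) a"
proof -
  assume c: "\<And>j. c (Suc N) j = 0"
  show "partial_deriv 1 (taylor_poly N c a) = taylor_poly N (\<lambda>i j. c (Suc i) j) a"
  proof
    fix x :: "real^2"
    define C where "C i = (\<Sum>j\<le>N. c i j * ((x $ 2 - a $ 2) ^ j / fact j))" for i
    have *: "taylor_poly N (\<lambda>i. c (f i)) a (x + t *\<^sub>R axis 1 1) = (\<Sum>i\<le>N. C (f i) * ((x $ 1 - a $ 1 + t) ^ i / fact i))"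
      for t f
      unfolding taylor_poly_def C_def sum_distrib_right
      by (intro sum.cong refl) (simp add: axis_def algebra_simps)
    have "C (Suc N) = 0" by (simp add: C_def c)
    from taylor_sum_has_derivative[of C, OF this, of "x $ 1 - a $ 1"]
    have "((\<lambda>t. taylor_poly N c a (x + t *\<^sub>R axis 1 1)) has_real_derivative
      taylor_poly N (\<lambda>i. c (Suc i)) a (x + 0 *\<^sub>R axis 1 1)) (at 0)"
      unfolding *[of "\<lambda>i. i"] *[of Suc] by simp
    then show "partial_deriv 1 (taylor_poly N c a) x = taylor_poly N (\<lambda>i j. c (Suc i) j) a x"
      using has_real_derivative_imp_partial_deriv(2) by simp
  qed
next
  assume c: "\<And>i. c i (Suc N) = 0"
  show "partial_deriv 2 (taylor_poly N c a) = taylor_poly N (\<lambda>i j. c i (Suc j)) a"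
  proof
    fix x :: "real^2"
    define C where "C j = (\<Sum>i\<le>N. c i j * ((x $ 1 - a $ 1) ^ i / fact i))" for j
    have *: "taylor_poly N (\<lambda>i j. c i (f j)) a (x + t *\<^sub>R axis 2 1) = (\<Sum>i\<le>N. C (f i) * ((x $ 2 - a $ 2 + t) ^ i / fact i))"
      for t f
      unfolding taylor_poly_def C_def sum_distrib_right
      by (subst sum.swap, intro sum.cong refl) (simp add: axis_def algebra_simps)
    have "C (Suc N) = 0" by (simp add: C_def c)
    from taylor_sum_has_derivative[of C, OF this, of "x $ 2 - a $ 2"]
    have "((\<lambda>t. taylor_poly N c a (x + t *\<^sub>R axis 2 1)) has_real_derivative
      taylor_poly N (\<lambda>i j. c i (Suc j)) a (x + 0 *\<^sub>R axis 2 1)) (at 0)"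
      unfolding *[of "\<lambda>i. i"] *[of Suc] by simp
    then show "partial_deriv 2 (taylor_poly N c a) x = taylor_poly N (\<lambda>i j. c i (Suc j)) a x"
      using has_real_derivative_imp_partial_deriv(2) by simp
  qed
qed

text \<open>The vanishing of \<open>c\<close> beyond total degree \<open>N\<close> ensures that a
  shift never brings in coefficients cut off by the summation range.\<close>

lemma partial_derivs_taylor_poly:
  assumes "\<And>i j. i + j > N \<Longrightarrow> c i j = 0"
  shows "partial_derivs (p, q) (taylor_poly N c a) = taylor_poly N (\<lambda>i j. c (i + p) (j + q)) a"
proof -
  have 2: "(partial_deriv 2 ^^ q) (taylor_poly N c a) = taylor_poly N (\<lambda>i j. c i (j + q)) a"
    by (induction q) (simp_all add: partial_deriv_taylor_poly assms)
  have "(partial_deriv 1 ^^ p) (taylor_poly N (\<lambda>i j. c i (j + q)) a) = taylor_poly N (\<lambda>i j. c (i + p) (j + q)) a"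
    by (induction p) (simp_all add: partial_deriv_taylor_poly assms)
  then show ?thesis by (simp add: partial_derivs_def 2)
qed

lemma taylor_poly_centre: "taylor_poly N c a a = c 0 0"
proof -
  have *: "(\<Sum>j\<le>N. g j * (0 ^ j / fact j)) = g 0" for g :: "nat \<Rightarrow> real"
    by (subst sum.remove[of _ 0]) (auto simp: power_0_left intro!: sum.neutral)
  have "taylor_poly N c a a = (\<Sum>i\<le>N. (\<Sum>j\<le>N. c i j * (0 ^ j / fact j)) * (0 ^ i / fact i))"
    unfolding taylor_poly_def sum_distrib_right by (intro sum.cong refl) (simp add: mult_ac)
  then show ?thesis by (simp only: *)
qed

lemma taylor_poly_reflect:
  assumes "\<And>i j. i + j \<noteq> m \<Longrightarrow> c i j = 0"
  shows "taylor_poly N c a (2 *\<^sub>R a - x) = (-1) ^ m * taylor_poly N c a x"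
  unfolding taylor_poly_def sum_distrib_left
proof (intro sum.cong refl)
  fix i j
  show "c i j * (((2 *\<^sub>R a - x) $ 1 - a $ 1) ^ i / fact i) * (((2 *\<^sub>R a - x) $ 2 - a $ 2) ^ j / fact j)
    = (-1) ^ m * (c i j * ((x $ 1 - a $ 1) ^ i / fact i) * ((x $ 2 - a $ 2) ^ j / fact j))"
  proof (cases "i + j = m")
    case True
    have "((2 *\<^sub>R a - x) $ l - a $ l) ^ n = (-1) ^ n * (x $ l - a $ l) ^ n" for l n
      by (simp flip: power_mult_distrib)
    then show ?thesis by (simp add: True[symmetric] power_add)
  qed (simp add: assms)
qed

lemma taylor_poly_constant:
  assumes "\<And>i j. i + j > 0 \<Longrightarrow> c i j = 0"
  shows "taylor_poly N c a x = c 0 0"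
proof -
  have "taylor_poly N c a x = (\<Sum>i\<le>N. if i = 0 then c 0 0 else 0)"
    unfolding taylor_poly_def
  proof (intro sum.cong refl)
    fix i
    have "(\<Sum>j\<le>N. c i j * ((x $ 1 - a $ 1) ^ i / fact i) * ((x $ 2 - a $ 2) ^ j / fact j))
      = (\<Sum>j\<le>N. if j = 0 then c i 0 * ((x $ 1 - a $ 1) ^ i / fact i) else 0)"
      by (intro sum.cong refl) (simp add: assms)
    then show "(\<Sum>j\<le>N. c i j * ((x $ 1 - a $ 1) ^ i / fact i) * ((x $ 2 - a $ 2) ^ j / fact j))
      = (if i = 0 then c 0 0 else 0)"
      by (simp add: assms)
  qed
  then show ?thesis by simp
qed

lemma taylor_poly_add:
  "taylor_poly N c a x + taylor_poly N d a x = taylor_poly N (\<lambda>i j. c i j + d i j) a x"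
  by (simp add: taylor_poly_def sum.distrib[symmetric] algebra_simps add_divide_distrib)

lemma partial_derivs_0 [simp]: "partial_derivs (0, 0) f = f"
  by (simp add: partial_derivs_def)


section \<open>Lagrange interpolation on the reference triangle\<close>

lemma finite_degree_indices [simp]: "finite {(i, j). i + j \<le> (k::nat)}"
  by (rule finite_subset[of _ "{..k} \<times> {..k}"]) auto

lemma degree_indices_eq_Sigma: "{(i, j). i + j \<le> (k::nat)} = Sigma {..k} (\<lambda>i. {..k - i})"
  by auto

lemma poly_le_iff:
  "p \<in> poly_le k \<longleftrightarrow> (\<exists>c. \<forall>x. p x = (\<Sum>i\<le>k. \<Sum>j\<le>k - i. c i j * (x $ 1) ^ i * (x $ 2) ^ j))"
  unfolding poly_le_def degree_indices_eq_Sigma by (simp add: sum.Sigma)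

lemma poly_le_imp_real_polynomial_function:
  assumes "p \<in> poly_le k"
  shows "real_polynomial_function p"
proof -
  obtain c where c: "\<And>x. p x = (\<Sum>(i, j)\<in>{(i, j). i + j \<le> k}. c i j * (x $ 1) ^ i * (x $ 2) ^ j)"
    using assms unfolding poly_le_def by blast
  have "real_polynomial_function (\<lambda>x::real^2. \<Sum>(i, j)\<in>{(i, j). i + j \<le> k}. c i j * (x $ 1) ^ i * (x $ 2) ^ j)"
    unfolding case_prod_unfold
    by (intro real_polynomial_function_sum real_polynomial_function.intros(2,4) real_polynomial_function_power
        real_polynomial_function_nth finite_degree_indices[unfolded case_prod_unfold])
  then show ?thesis using c by presburger
qed

lemma poly_le_lincomb:
  assumes "p \<in> poly_le k" "q \<in> poly_le k"
  shows "(\<lambda>x. a * p x + b * q x) \<in> poly_le k"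
proof -
  obtain c d where "\<And>x. p x = (\<Sum>(i, j)\<in>{(i, j). i + j \<le> k}. c i j * (x $ 1) ^ i * (x $ 2) ^ j)"
    "\<And>x. q x = (\<Sum>(i, j)\<in>{(i, j). i + j \<le> k}. d i j * (x $ 1) ^ i * (x $ 2) ^ j)"
    using assms unfolding poly_le_def by blast
  then have "a * p x + b * q x = (\<Sum>(i, j)\<in>{(i, j). i + j \<le> k}. (a * c i j + b * d i j) * (x $ 1) ^ i * (x $ 2) ^ j)" for x
    by (simp add: sum_distrib_left sum.distrib[symmetric] case_prod_unfold algebra_simps)
  then show ?thesis unfolding poly_le_def by (intro CollectI exI[of _ "\<lambda>i j. a * c i j + b * d i j"]) simp
qed

lemma poly_le_monomial:
  assumes "i + j \<le> k"
  shows "(\<lambda>x. c * (x $ 1) ^ i * (x $ 2) ^ j) \<in> poly_le k"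
proof -
  have "c * (x $ 1) ^ i * (x $ 2) ^ j =
    (\<Sum>(i', j')\<in>{(i, j). i + j \<le> k}. (if (i', j') = (i, j) then c else 0) * (x $ 1) ^ i' * (x $ 2) ^ j')"
    for x :: "real^2"
    by (subst sum.remove[of _ "(i, j)"]) (use assms in \<open>auto intro!: sum.neutral split: if_splits\<close>)
  then show ?thesis unfolding poly_le_def
    by (intro CollectI exI[of _ "\<lambda>i' j'. if (i', j') = (i, j) then c else 0"]) simp
qed

lemma poly_le_const: "(\<lambda>x. c) \<in> poly_le k"
  using poly_le_monomial[of 0 0 k c] by simp

lemma poly_le_scale: "p \<in> poly_le k \<Longrightarrow> (\<lambda>x. a * p x) \<in> poly_le k"
  using poly_le_lincomb[of p k p a 0] by simp

lemma poly_le_add: "p \<in> poly_le k \<Longrightarrow> q \<in> poly_le k \<Longrightarrow> (\<lambda>x. p x + q x) \<in> poly_le k"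
  using poly_le_lincomb[of p k q 1 1] by simp

lemma poly_le_sum:
  assumes "finite I" "\<And>i. i \<in> I \<Longrightarrow> p i \<in> poly_le k"
  shows "(\<lambda>x. \<Sum>i\<in>I. p i x) \<in> poly_le k"
  using assms
proof (induction I)
  case (insert i I)
  then show ?case using poly_le_lincomb[of "p i" k "\<lambda>x. \<Sum>i\<in>I. p i x" 1 1] by simp
qed (simp add: poly_le_const)

lemma poly_le_induct [consumes 1, case_names monomial sum]:
  assumes "p \<in> poly_le k"
    and "\<And>i j c. i + j \<le> k \<Longrightarrow> P (\<lambda>x. c * (x $ 1) ^ i * (x $ 2) ^ j)"
    and "\<And>p q. P p \<Longrightarrow> P q \<Longrightarrow> P (\<lambda>x. p x + q x)"
  shows "P p"
proof -
  obtain c where c: "p = (\<lambda>x. \<Sum>(i, j)\<in>{(i, j). i + j \<le> k}. c i j * (x $ 1) ^ i * (x $ 2) ^ j)"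
    using assms(1) unfolding poly_le_def by blast
  have "P (\<lambda>x. \<Sum>(i, j)\<in>A. c i j * (x $ 1) ^ i * (x $ 2) ^ j)"
    if "finite A" "A \<subseteq> {(i, j). i + j \<le> k}" for A
    using that
  proof (induction A)
    case empty
    then show ?case using assms(2)[of 0 0 0] by simp
  next
    case (insert a A)
    then show ?case by (cases a) (auto intro!: assms(2,3))
  qed
  from this[OF finite_degree_indices subset_refl] show ?thesis unfolding c .
qed

lemma poly_le_mult:
  assumes "p \<in> poly_le k" "q \<in> poly_le l"
  shows "(\<lambda>x. p x * q x) \<in> poly_le (k + l)"
  using assms(1)
proof (induction p rule: poly_le_induct)
  case (monomial i j c)
  from assms(2) show ?case
  proof (induction q rule: poly_le_induct)
    case (monomial i' j' d)
    have "(\<lambda>x. (c * d) * (x $ 1) ^ (i + i') * (x $ 2) ^ (j + j')) \<in> poly_le (k + l)"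
      using \<open>i + j \<le> k\<close> monomial by (intro poly_le_monomial) auto
    then show ?case by (simp add: power_add mult_ac)
  next
    case (sum p q)
    then show ?case using poly_le_add by (simp add: distrib_left)
  qed
next
  case (sum p q)
  then show ?case using poly_le_add by (simp add: distrib_right)
qed

lemma poly_le_power: "u \<in> poly_le 1 \<Longrightarrow> (\<lambda>x. u x ^ n) \<in> poly_le n"
  by (induction n) (use poly_le_mult[of u 1] poly_le_const in auto)

lemma poly_le_mono:
  assumes "p \<in> poly_le k" "k \<le> l"
  shows "p \<in> poly_le l"
  using poly_le_mult[OF assms(1) poly_le_const[of 1 "l - k"]] assms(2) by simp

lemma poly_le_nth: "(\<lambda>x. x $ i) \<in> poly_le 1"
  using exhaust_2[of i] poly_le_monomial[of 1 0 1 1] poly_le_monomial[of 0 1 1 1] by auto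

lemma poly_le_affine_component:
  fixes L :: "real^2 \<Rightarrow> real^2"
  assumes "linear L"
  shows "(\<lambda>x. (L x + c) $ i) \<in> poly_le 1"
proof -
  have "x = x $ 1 *\<^sub>R axis 1 1 + x $ 2 *\<^sub>R axis 2 1" for x :: "real^2"
    by (simp add: vec_eq_iff forall_2 axis_def)
  then have "L x = L (x $ 1 *\<^sub>R axis 1 1 + x $ 2 *\<^sub>R axis 2 1)" for x by simp
  then have L: "L x = x $ 1 *\<^sub>R L (axis 1 1) + x $ 2 *\<^sub>R L (axis 2 1)" for x
    unfolding linear_add[OF assms] linear_scale[OF assms] .
  have "(L x + c) $ i = 1 * (L (axis 1 1) $ i * x $ 1 + L (axis 2 1) $ i * x $ 2) + 1 * c $ i" for x
    by (subst L) simp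
  then show ?thesis by (simp only:) (intro poly_le_lincomb poly_le_nth poly_le_const)
qed

lemma poly_le_affine_compose:
  fixes L :: "real^2 \<Rightarrow> real^2"
  assumes "p \<in> poly_le k" "linear L"
  shows "(\<lambda>x. p (L x + c)) \<in> poly_le k"
  using assms(1)
proof (induction p rule: poly_le_induct)
  case (monomial i j d)
  have "(\<lambda>x. ((L x + c) $ 1) ^ i * ((L x + c) $ 2) ^ j) \<in> poly_le (i + j)"
    by (intro poly_le_mult poly_le_power poly_le_affine_component assms(2))
  then show ?case using poly_le_scale[OF poly_le_mono[OF _ monomial], of _ d] by (simp add: mult.assoc)
next
  case (sum p q)
  then show ?case by (rule poly_le_add)
qed

lemma taylor_poly_in_poly_le:
  assumes "\<And>i j. i + j > m \<Longrightarrow> c i j = 0"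
  shows "taylor_poly N c a \<in> poly_le m"
proof -
  have u: "(\<lambda>x. x $ l - a $ l) \<in> poly_le 1" for l
    using poly_le_lincomb[OF poly_le_nth[of l] poly_le_const[of "a $ l"], of 1 "-1"] by simp
  have "(\<lambda>x. c i j * ((x $ 1 - a $ 1) ^ i / fact i) * ((x $ 2 - a $ 2) ^ j / fact j)) \<in> poly_le m" for i j
  proof (cases "i + j \<le> m")
    case True
    have "(\<lambda>x. (x $ 1 - a $ 1) ^ i * (x $ 2 - a $ 2) ^ j) \<in> poly_le (i + j)"
      by (intro poly_le_mult poly_le_power u)
    then show ?thesis
      using poly_le_scale[OF poly_le_mono[OF _ True], of _ "c i j / fact i / fact j"] by (simp add: mult.assoc)
  qed (use assms poly_le_const[of 0] in simp)
  then show ?thesis unfolding taylor_poly_def[abs_def] by (intro poly_le_sum) auto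
qed

text \<open>Unisolvence of the triangular lattice. On the line \<open>x $ 1 = 0\<close> the
  polynomial has more roots than its degree permits, so \<open>x $ 1\<close> splits off; the
  cofactor has one degree less and vanishes on the remaining lattice. The spacing \<delta> is
  independent of \<open>k\<close> because the induction lowers \<open>k\<close> while the spacing
  stays.\<close>

lemma poly_le_zero_on_lattice:
  assumes "p \<in> poly_le k" "\<delta> \<noteq> 0"
    and "\<And>i j. i + j \<le> k \<Longrightarrow> p (vector [real i * \<delta>, real j * \<delta>]) = 0"
  shows "p x = 0"
  using assms(1,3)
proof (induction k arbitrary: p x)
  case 0
  then obtain c where "\<And>x. p x = c (0::nat) (0::nat)"
    unfolding poly_le_iff by auto
  then show ?case using 0(2)[of 0 0] by simp
next
  case (Suc k)
  obtain c where c: "\<And>x. p x = (\<Sum>i\<le>Suc k. \<Sum>j\<le>Suc k - i. c i j * (x $ 1) ^ i * (x $ 2) ^ j)"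
    using Suc.prems(1) unfolding poly_le_iff by blast
  define r :: "real^2 \<Rightarrow> real" where "r x = (\<Sum>i\<le>k. \<Sum>j\<le>k - i. c (Suc i) j * (x $ 1) ^ i * (x $ 2) ^ j)" for x
  have r: "r \<in> poly_le k" unfolding poly_le_iff r_def by (intro exI[of _ "\<lambda>i. c (Suc i)"]) simp
  define q where "q y = (\<Sum>j\<le>Suc k. c 0 j * y ^ j)" for y
  have split: "p x = q (x $ 2) + x $ 1 * r x" for x
    unfolding c r_def q_def sum_distrib_left by (subst sum.atMost_Suc_shift) (simp add: mult_ac)
  have "c 0 j = 0" if "j \<le> Suc k" for j
  proof (rule ccontr)
    assume "c 0 j \<noteq> 0"
    with that have "\<exists>j\<le>Suc k. c 0 j \<noteq> 0" by blast
    from polyfun_rootbound[OF this]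
    have fin: "finite {y. q y = 0}" "card {y. q y = 0} \<le> Suc k"
      unfolding q_def by blast+
    have "(\<lambda>j. real j * \<delta>) ` {..Suc k} \<subseteq> {y. q y = 0}"
    proof safe
      fix j assume "j \<le> Suc k"
      then show "q (real j * \<delta>) = 0"
        using Suc.prems(2)[of 0 j] split[of "vector [real 0 * \<delta>, real j * \<delta>]"] by simp
    qed
    then have "card ((\<lambda>j. real j * \<delta>) ` {..Suc k}) \<le> Suc k"
      using fin card_mono order_trans by blast
    moreover have "inj_on (\<lambda>j. real j * \<delta>) {..Suc k}"
      by (simp add: inj_on_def assms(2))
    ultimately show False by (simp add: card_image)
  qed
  then have "q y = 0" for y
    unfolding q_def by (intro sum.neutral) auto
  then have p: "p x = x $ 1 * r x" for x
    by (simp add: split)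
  have lin: "linear (\<lambda>x::real^2. x)" by (rule linear_ident)
  \<comment> \<open>Translation by one spacing moves the remaining nodes, those with first index at
    least 1, back to a lattice that starts at the origin.\<close>
  have "r (x + axis 1 \<delta>) = 0" for x
  proof (rule Suc.IH[of "\<lambda>x. r (x + axis 1 \<delta>)"])
    show "(\<lambda>x. r (x + axis 1 \<delta>)) \<in> poly_le k"
      by (rule poly_le_affine_compose[OF r lin])
    fix i j :: nat assume "i + j \<le> k"
    then have "p (vector [real (Suc i) * \<delta>, real j * \<delta>]) = 0" using Suc.prems(2)[of "Suc i" j] by simp
    moreover have "vector [real i * \<delta>, real j * \<delta>] + axis 1 \<delta> = (vector [real (Suc i) * \<delta>, real j * \<delta>] :: real^2)"
      by (simp add: vec_eq_iff forall_2 axis_def algebra_simps)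
    ultimately show "r (vector [real i * \<delta>, real j * \<delta>] + axis 1 \<delta>) = 0"
      using p[of "vector [real (Suc i) * \<delta>, real j * \<delta>]"] assms(2) by (simp del: of_nat_Suc)
  qed
  from this[of "x - axis 1 \<delta>"] show ?case by (simp add: p)
qed

section \<open>The explicit Lagrange basis\<close>

definition lagrange_node :: "nat \<Rightarrow> nat \<times> nat \<Rightarrow> real^2" where
  "lagrange_node k = (\<lambda>(i, j). vector [real i / real k, real j / real k])"

text \<open>The generalised binomial coefficient of \<open>t\<close> over \<open>n\<close>: among
  the integers from 0 to \<open>n\<close> it is 1 at \<open>n\<close> and 0 elsewhere.\<close>

definition falling_quotient :: "nat \<Rightarrow> real \<Rightarrow> real" where
  "falling_quotient n t = (\<Prod>a<n. (t - real a) / (real n - real a))"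

text \<open>One factor for each barycentric coordinate, scaled by \<open>k\<close> so that nodes
  have integer coordinates; the degrees of the factors add up to \<open>k\<close>.\<close>

definition lagrange_basis :: "nat \<Rightarrow> nat \<times> nat \<Rightarrow> real^2 \<Rightarrow> real" where
  "lagrange_basis k = (\<lambda>(i, j) x. falling_quotient i (real k * x $ 1) *
     (falling_quotient j (real k * x $ 2) * falling_quotient (k - i - j) (real k * (1 - x $ 1 - x $ 2))))"

lemma lagrange_nodes_eq: "lagrange_nodes k = lagrange_node k ` {(i, j). i + j \<le> k}"
  by (auto simp: lagrange_nodes_def lagrange_node_def)

lemma falling_quotient_self: "falling_quotient n (real n) = 1"
  by (simp add: falling_quotient_def)

lemma falling_quotient_less: "m < n \<Longrightarrow> falling_quotient n (real m) = 0"
  unfolding falling_quotient_def by (rule prod_zero) auto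

lemma poly_le_falling_quotient:
  assumes "u \<in> poly_le 1"
  shows "(\<lambda>x. falling_quotient n (u x)) \<in> poly_le n"
proof -
  have "(\<lambda>x. \<Prod>a<m. (u x - real a) / (real n - real a)) \<in> poly_le m" for m
  proof (induction m)
    case (Suc m)
    have "(\<lambda>x. (1 / (real n - real m)) * u x + (- 1 / (real n - real m)) * real m) \<in> poly_le 1"
      by (intro poly_le_lincomb assms poly_le_const)
    from poly_le_mult[OF Suc this] show ?case by (simp add: diff_divide_distrib)
  qed (simp add: poly_le_const)
  then show ?thesis by (simp add: falling_quotient_def)
qed

lemma lagrange_basis_in_poly_le:
  assumes "i + j \<le> k"
  shows "lagrange_basis k (i, j) \<in> poly_le k"
proof -
  have u: "(\<lambda>x. real k * x $ 1) \<in> poly_le 1" "(\<lambda>x. real k * x $ 2) \<in> poly_le 1"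
    by (intro poly_le_scale poly_le_nth)+
  have "(\<lambda>x. real k * (1 * (1 * 1 + (-1) * x $ 1) + (-1) * x $ 2)) \<in> poly_le 1"
    by (intro poly_le_scale poly_le_nth poly_le_lincomb poly_le_const)
  then have "(\<lambda>x. real k * (1 - x $ 1 - x $ 2)) \<in> poly_le 1" by simp
  with u have "lagrange_basis k (i, j) \<in> poly_le (i + (j + (k - i - j)))"
    unfolding lagrange_basis_def by (auto intro!: poly_le_mult poly_le_falling_quotient)
  then show ?thesis using assms by simp
qed

lemma lagrange_basis_node:
  assumes "1 \<le> k" "i + j \<le> k" "i' + j' \<le> k"
  shows "lagrange_basis k (i, j) (lagrange_node k (i', j')) = (if (i, j) = (i', j') then 1 else 0)"
proof -
  have "real k * (1 - real i' / real k - real j' / real k) = real (k - i' - j')"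
    using assms(1,3) by (simp add: field_simps of_nat_diff)
  then have eq: "lagrange_basis k (i, j) (lagrange_node k (i', j'))
    = falling_quotient i (real i') * (falling_quotient j (real j') * falling_quotient (k - i - j) (real (k - i' - j')))"
    using assms(1) by (simp add: lagrange_basis_def lagrange_node_def)
  show ?thesis
  proof (cases "(i, j) = (i', j')")
    case False
    \<comment> \<open>Both index triples sum to \<open>k\<close>, so if they differ, some entry of
      the node's triple is strictly smaller, and the corresponding factor vanishes.\<close>
    then have "i' < i \<or> j' < j \<or> k - i' - j' < k - i - j" using assms(2,3) by auto
    then show ?thesis using False by (auto simp: eq falling_quotient_less)
  next
    case True
    then show ?thesis unfolding eq by (simp add: falling_quotient_self)
  qed
qed

lemma poly_le_eqI:
  assumes "1 \<le> k" "p \<in> poly_le k" "q \<in> poly_le k" "\<And>z. z \<in> lagrange_nodes k \<Longrightarrow> p z = q z"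
  shows "p = q"
proof
  fix x
  have "(\<lambda>x. p x - q x) \<in> poly_le k" using poly_le_lincomb[OF assms(2,3), of 1 "-1"] by simp
  then have "p x - q x = 0"
  proof (rule poly_le_zero_on_lattice[of _ k "1 / real k"])
    fix i j :: nat assume "i + j \<le> k"
    then have "vector [real i * (1 / real k), real j * (1 / real k)] \<in> lagrange_nodes k"
      by (auto simp: lagrange_nodes_def)
    then show "p (vector [real i * (1 / real k), real j * (1 / real k)]) - q (vector [real i * (1 / real k), real j * (1 / real k)]) = 0"
      using assms(4) by simp
  qed (use assms(1) in simp)
  then show "p x = q x" by simp
qed

lemma lagrange_sum:
  fixes g :: "real^2 \<Rightarrow> real"
  assumes "1 \<le> k"
  shows "(\<lambda>x. \<Sum>z\<in>{(i, j). i + j \<le> k}. g (lagrange_node k z) * lagrange_basis k z x) \<in> poly_le k"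
      (is "?p \<in> _")
    and "z \<in> lagrange_nodes k \<Longrightarrow>
      (\<Sum>z'\<in>{(i, j). i + j \<le> k}. g (lagrange_node k z') * lagrange_basis k z' z) = g z"
proof -
  show "?p \<in> poly_le k"
    by (intro poly_le_sum) (auto intro!: poly_le_scale lagrange_basis_in_poly_le)
  assume "z \<in> lagrange_nodes k"
  then obtain i j where ij: "i + j \<le> k" "z = lagrange_node k (i, j)"
    unfolding lagrange_nodes_eq by auto
  have "?p z = (\<Sum>z'\<in>{(i, j). i + j \<le> k}. if z' = (i, j) then g z else 0)"
    unfolding ij(2) by (intro sum.cong refl) (use ij(1) assms(1) in \<open>auto simp: lagrange_basis_node split: if_splits\<close>)
  then show "?p z = g z" using ij(1) by simp
qed

text \<open>Unisolvence makes the definite description in \<open>ref_interp\<close> meaningful;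
  existence is supplied by \<open>lagrange_sum\<close>.\<close>

lemma ref_interp_unique:
  assumes "1 \<le> k" "p \<in> poly_le k" "\<And>z. z \<in> lagrange_nodes k \<Longrightarrow> p z = g z"
  shows "ref_interp k g = p"
  unfolding ref_interp_def
proof (rule the_equality)
  show "p \<in> poly_le k \<and> (\<forall>z\<in>lagrange_nodes k. p z = g z)"
    using assms by blast
  fix q assume "q \<in> poly_le k \<and> (\<forall>z\<in>lagrange_nodes k. q z = g z)"
  then show "q = p"
    using assms by (intro poly_le_eqI[OF assms(1)]) auto
qed

lemma ref_interp_eq:
  assumes "1 \<le> k"
  shows "ref_interp k g = (\<lambda>x. \<Sum>z\<in>{(i, j). i + j \<le> k}. g (lagrange_node k z) * lagrange_basis k z x)"
  by (intro ref_interp_unique lagrange_sum assms)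

lemma ref_interp_in_poly_le: "1 \<le> k \<Longrightarrow> ref_interp k g \<in> poly_le k"
  using lagrange_sum(1)[of k g] ref_interp_eq[of k g] by simp

lemma ref_interp_node: "1 \<le> k \<Longrightarrow> z \<in> lagrange_nodes k \<Longrightarrow> ref_interp k g z = g z"
  using lagrange_sum(2)[of k z g] ref_interp_eq[of k g] by simp


section \<open>Interpolation on a mesh element\<close>

lemma T_ref_iff: "x \<in> T_ref \<longleftrightarrow> 0 \<le> x $ 1 \<and> 0 \<le> x $ 2 \<and> x $ 1 + x $ 2 \<le> 1"
proof
  assume "x \<in> T_ref"
  then show "0 \<le> x $ 1 \<and> 0 \<le> x $ 2 \<and> x $ 1 + x $ 2 \<le> 1"
    unfolding T_ref_def convex_hull_3_alt by (auto simp: axis_def)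
next
  assume *: "0 \<le> x $ 1 \<and> 0 \<le> x $ 2 \<and> x $ 1 + x $ 2 \<le> 1"
  have "x = 0 + x $ 1 *\<^sub>R (axis 1 1 - 0) + x $ 2 *\<^sub>R (axis 2 1 - 0)"
    by (simp add: vec_eq_iff forall_2 axis_def)
  with * show "x \<in> T_ref"
    unfolding T_ref_def convex_hull_3_alt by blast
qed

lemma compact_T_ref: "compact T_ref"
  unfolding T_ref_def by (intro finite_imp_compact_convex_hull) simp

text \<open>\<open>reference_map\<close> only speaks about \<open>T_ref\<close>. Since
  \<open>T_ref\<close> has interior points, a kernel vector of \<open>L\<close> would identify two
  of its points.\<close>

lemma inj_of_inj_on_T_ref:
  assumes "linear L" "inj_on (\<lambda>\<xi>. b + L \<xi>) T_ref"
  shows "inj L"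
proof -
  have "v = 0" if "L v = 0" for v
  proof (rule ccontr)
    assume "v \<noteq> 0"
    \<comment> \<open>The displacement from the centroid then has coordinates of total absolute
      value at most 1/3, which is exactly the slack of the centroid in each of the three
      inequalities of \<open>T_ref_iff\<close>.\<close>
    define t where "t = 1 / (3 * (\<bar>v $ 1\<bar> + \<bar>v $ 2\<bar> + 1))"
    have "t > 0" by (simp add: t_def add_nonneg_pos)
    have "t * (\<bar>v $ 1\<bar> + \<bar>v $ 2\<bar>) \<le> 1/3"
      by (simp add: t_def field_simps)
    then have "\<bar>t * v $ 1\<bar> + \<bar>t * v $ 2\<bar> \<le> 1/3"
      using \<open>t > 0\<close> by (simp add: abs_mult distrib_left)
    then have "vector [1/3, 1/3] \<in> T_ref" "vector [1/3, 1/3] + t *\<^sub>R v \<in> T_ref"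
      unfolding T_ref_iff by (auto simp: abs_le_iff)
    moreover have "b + L (vector [1/3, 1/3] + t *\<^sub>R v) = b + L (vector [1/3, 1/3])"
      using that by (simp add: linear_add[OF assms(1)] linear_scale[OF assms(1)])
    ultimately have "vector [1/3, 1/3] + t *\<^sub>R v = vector [1/3, 1/3]"
      using assms(2) unfolding inj_on_def by blast
    then show False using \<open>t > 0\<close> \<open>v \<noteq> 0\<close> by simp
  qed
  then show ?thesis using linear_injective_0[OF assms(1)] by blast
qed

lemma reference_mapE:
  assumes "reference_map F T"
  obtains L b L' c where "linear L" "inj L" "F = (\<lambda>\<xi>. L \<xi> + b)" "linear L'" "inv F = (\<lambda>x. L' x + c)"
    "\<And>x. F (inv F x) = x" "\<And>x. inv F (F x) = x" "F ` T_ref = T"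
proof -
  obtain L b where L: "linear L" "F = (\<lambda>\<xi>. b + L \<xi>)" and bij: "bij_betw F T_ref T"
    using assms unfolding reference_map_def by blast
  have inj: "inj L"
    using inj_of_inj_on_T_ref[OF L(1)] bij unfolding L(2) bij_betw_def by blast
  obtain L' where L': "linear L'" "\<And>x. L' (L x) = x" "\<And>x. L (L' x) = x"
    using linear_injective_isomorphism[OF L(1) inj] by blast
  have inv: "inv F = (\<lambda>x. L' x + L' (- b))"
    by (rule inv_equality) (simp_all add: L(2) linear_add[OF L(1)] linear_add[OF L'(1)] linear_diff[OF L'(1)] linear_neg[OF L'(1)] linear_diff[OF L(1)] linear_neg[OF L(1)] L')
  show ?thesis
  proof (rule that[OF L(1) inj _ L'(1) inv])
    show "F = (\<lambda>\<xi>. L \<xi> + b)" by (simp add: L(2) add.commute)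
    show "F (inv F x) = x" "inv F (F x) = x" for x
      unfolding inv by (simp_all add: L(2) linear_add[OF L(1)] linear_add[OF L'(1)] linear_diff[OF L'(1)] linear_neg[OF L'(1)] linear_diff[OF L(1)] linear_neg[OF L(1)] L')
    show "F ` T_ref = T" using bij by (simp add: bij_betw_def)
  qed
qed

lemma reference_map_inj: "reference_map F T \<Longrightarrow> inj F"
  by (elim reference_mapE) (metis injI)

lemma lagrange_nodes_subset_T_ref: "lagrange_nodes k \<subseteq> T_ref"
proof (cases "k = 0")
  case False
  then show ?thesis
    by (auto simp: lagrange_nodes_def T_ref_iff field_simps simp flip: of_nat_add)
qed (auto simp: lagrange_nodes_def T_ref_iff)

text \<open>Extreme points describe the vertices of \<open>T\<close> without reference to the
  parametrisation or to an ordering.\<close>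

lemma extreme_points_of_reference_triangle:
  assumes "reference_map F T"
  shows "{v. v extreme_point_of T} = F ` {0, axis 1 1, axis 2 1}"
proof -
  obtain L b where L: "linear L" "inj L" "F = (\<lambda>\<xi>. L \<xi> + b)" "F ` T_ref = T"
    using reference_mapE[OF assms] by metis
  have "independent {axis 1 1, axis 2 1 :: real^2}"
    by (rule independent_mono[OF independent_Basis]) (auto simp: Basis_vec_def)
  then have "\<not> affine_dependent {0, axis 1 1, axis 2 1 :: real^2}"
    using affine_dependent_iff_dependent[of 0 "{axis 1 1, axis 2 1 :: real^2}"] by simp
  then have ext: "{v. v extreme_point_of T_ref} = {0, axis 1 1, axis 2 1}"
    unfolding T_ref_def by (auto simp: extreme_point_of_convex_hull_affine_independent)
  have F: "F = (+) b \<circ> L" using L(3) by (auto simp: add.commute)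
  have "L v extreme_point_of L ` T_ref \<longleftrightarrow> v extreme_point_of T_ref" for v
    using face_of_linear_image[OF L(1,2), of "{v}" T_ref] by (simp add: face_of_singleton)
  then have "{v. v extreme_point_of L ` T_ref} = L ` {v. v extreme_point_of T_ref}"
    unfolding extreme_point_of_def by blast
  then have "{v. v extreme_point_of T} = (+) b ` L ` {v. v extreme_point_of T_ref}"
    unfolding L(4)[symmetric] F image_comp[symmetric]
    by (simp add: extreme_points_of_translation)
  then show ?thesis unfolding ext F by (simp add: image_comp)
qed

lemma reference_map_lagrange_node:
  assumes "reference_map F T" "1 \<le> k" "a + i + j = k"
  shows "F (lagrange_node k (i, j)) =
    (real a / real k) *\<^sub>R F 0 + (real i / real k) *\<^sub>R F (axis 1 1) + (real j / real k) *\<^sub>R F (axis 2 1)"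
proof -
  obtain L b where L: "linear L" "F = (\<lambda>\<xi>. L \<xi> + b)"
    using reference_mapE[OF assms(1)] by metis
  have "lagrange_node k (i, j) = (real i / real k) *\<^sub>R axis 1 1 + (real j / real k) *\<^sub>R axis 2 1"
    by (simp add: lagrange_node_def vec_eq_iff forall_2 axis_def)
  then have "F (lagrange_node k (i, j)) = (real i / real k) *\<^sub>R L (axis 1 1) + (real j / real k) *\<^sub>R L (axis 2 1) + b"
    by (simp add: L linear_add[OF L(1)] linear_scale[OF L(1)])
  moreover have "b = (real a / real k) *\<^sub>R b + (real i / real k) *\<^sub>R b + (real j / real k) *\<^sub>R b"
    using assms(2) by (simp flip: scaleR_add_left add_divide_distrib of_nat_add add: assms(3))
  ultimately show ?thesis
    by (simp add: L linear_0[OF L(1)] scaleR_add_right add_ac)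
qed

text \<open>The right-hand side mentions only \<open>T\<close> and \<open>k\<close>: the nodes are
  the convex combinations of the vertices with weights in multiples of \<open>1 / k\<close>. Hence
  different reference maps of \<open>T\<close> give the same nodes.\<close>

lemma reference_map_image_lagrange_nodes:
  assumes "reference_map F T" "1 \<le> k"
  defines "V \<equiv> {v. v extreme_point_of T}"
  shows "F ` lagrange_nodes k =
    {\<Sum>v\<in>V. (real (m v) / real k) *\<^sub>R v |m :: real^2 \<Rightarrow> nat. (\<Sum>v\<in>V. m v) = k}"
proof -
  have V: "V = {F 0, F (axis 1 1), F (axis 2 1)}"
    unfolding V_def extreme_points_of_reference_triangle[OF assms(1)] by simp
  have ne: "(axis 1 1 :: real^2) \<noteq> axis 2 1" "(0 :: real^2) \<noteq> axis 1 1" "(0 :: real^2) \<noteq> axis 2 1"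
    by (auto simp: axis_eq_axis vec_eq_iff axis_def)
  then have dist: "F 0 \<noteq> F (axis 1 1)" "F 0 \<noteq> F (axis 2 1)" "F (axis 1 1) \<noteq> F (axis 2 1)"
    using inj_eq[OF reference_map_inj[OF assms(1)]] by simp_all
  have sumV: "(\<Sum>v\<in>V. g v) = g (F 0) + g (F (axis 1 1)) + g (F (axis 2 1))" for g :: "real^2 \<Rightarrow> 'b::comm_monoid_add"
    unfolding V using dist by (simp add: add.assoc)
  show ?thesis
  proof (intro equalityI subsetI)
    fix x assume "x \<in> F ` lagrange_nodes k"
    then obtain i j where ij: "i + j \<le> k" "x = F (lagrange_node k (i, j))"
      by (auto simp: lagrange_nodes_eq)
    define m where "m v = (if v = F 0 then k - i - j else if v = F (axis 1 1) then i else j)" for v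
    have m: "m (F 0) = k - i - j" "m (F (axis 1 1)) = i" "m (F (axis 2 1)) = j"
      using dist by (auto simp: m_def)
    have "x = (\<Sum>v\<in>V. (real (m v) / real k) *\<^sub>R v)"
      unfolding sumV m ij(2) by (rule reference_map_lagrange_node[OF assms(1,2)]) (use ij(1) in simp)
    moreover have "(\<Sum>v\<in>V. m v) = k"
      unfolding sumV m using ij(1) by simp
    ultimately show "x \<in> {\<Sum>v\<in>V. (real (m v) / real k) *\<^sub>R v |m. (\<Sum>v\<in>V. m v) = k}" by blast
  next
    fix x assume "x \<in> {\<Sum>v\<in>V. (real (m v) / real k) *\<^sub>R v |m. (\<Sum>v\<in>V. m v) = k}"
    then obtain m where x: "x = (\<Sum>v\<in>V. (real (m v) / real k) *\<^sub>R v)" and m: "(\<Sum>v\<in>V. m v) = k"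
      by blast
    have "x = F (lagrange_node k (m (F (axis 1 1)), m (F (axis 2 1))))"
      unfolding x sumV using m[unfolded sumV]
      by (intro reference_map_lagrange_node[OF assms(1,2), symmetric]) simp
    moreover have "m (F (axis 1 1)) + m (F (axis 2 1)) \<le> k" using m[unfolded sumV] by simp
    ultimately show "x \<in> F ` lagrange_nodes k" by (auto simp: lagrange_nodes_eq)
  qed
qed

lemma reference_map_nodes_unique:
  assumes "reference_map F T" "reference_map G T" "1 \<le> k"
  shows "F ` lagrange_nodes k = G ` lagrange_nodes k"
  using reference_map_image_lagrange_nodes assms by presburger

text \<open>The interpolant of a single element as a polynomial on the whole plane; unlike
  \<open>interp\<close> it involves no choice of an element.\<close>

definition local_interp :: "nat \<Rightarrow> (real^2 \<Rightarrow> real^2) \<Rightarrow> (real^2 \<Rightarrow> real) \<Rightarrow> real^2 \<Rightarrow> real" where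
  "local_interp k F g = (\<lambda>x. ref_interp k (g \<circ> F) (inv F x))"

lemma local_interp_in_poly_le:
  assumes "reference_map F T" "1 \<le> k"
  shows "local_interp k F g \<in> poly_le k"
proof -
  obtain L' c where "linear L'" "inv F = (\<lambda>x. L' x + c)"
    using reference_mapE[OF assms(1)] by metis
  then show ?thesis
    unfolding local_interp_def by (simp add: poly_le_affine_compose ref_interp_in_poly_le[OF assms(2)])
qed

lemma local_interp_node:
  assumes "reference_map F T" "1 \<le> k" "z \<in> F ` lagrange_nodes k"
  shows "local_interp k F g z = g z"
proof -
  obtain \<xi> where \<xi>: "\<xi> \<in> lagrange_nodes k" "z = F \<xi>" using assms(3) by blast
  have "inv F z = \<xi>"
    using reference_map_inj[OF assms(1)] by (simp add: \<xi>(2))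
  then show ?thesis
    using \<xi> by (simp add: local_interp_def ref_interp_node[OF assms(2)])
qed

text \<open>The working characterisation of the interpolant: reproduction of polynomials, linearity
  and behaviour under reflection all follow by checking node values.\<close>

lemma local_interp_unique:
  assumes "reference_map F T" "1 \<le> k" "p \<in> poly_le k" "\<And>z. z \<in> F ` lagrange_nodes k \<Longrightarrow> p z = g z"
  shows "local_interp k F g = p"
proof -
  obtain L b where L: "linear L" "F = (\<lambda>\<xi>. L \<xi> + b)" and inv: "\<And>x. F (inv F x) = x"
    using reference_mapE[OF assms(1)] by metis
  have "(\<lambda>\<xi>. p (L \<xi> + b)) \<in> poly_le k"
    by (rule poly_le_affine_compose[OF assms(3) L(1)])
  then have "p \<circ> F \<in> poly_le k" by (simp add: L(2) o_def)
  then have "ref_interp k (g \<circ> F) = p \<circ> F"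
    using assms(4) by (intro ref_interp_unique[OF assms(2)]) auto
  then show ?thesis by (simp add: local_interp_def inv)
qed

lemma local_interp_poly: "reference_map F T \<Longrightarrow> 1 \<le> k \<Longrightarrow> p \<in> poly_le k \<Longrightarrow> local_interp k F p = p"
  by (rule local_interp_unique) auto

lemma local_interp_lincomb:
  assumes "reference_map F T" "1 \<le> k"
  shows "local_interp k F (\<lambda>x. a * f x + b * g x) = (\<lambda>x. a * local_interp k F f x + b * local_interp k F g x)"
proof (rule local_interp_unique[OF assms])
  show "(\<lambda>x. a * local_interp k F f x + b * local_interp k F g x) \<in> poly_le k"
    by (intro poly_le_lincomb local_interp_in_poly_le[OF assms])
  fix z assume "z \<in> F ` lagrange_nodes k"
  then show "a * local_interp k F f z + b * local_interp k F g z = a * f z + b * g z"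
    by (simp only: local_interp_node[OF assms])
qed

text \<open>The reflection carries the nodes of \<open>T1\<close> to those of \<open>T2\<close>, so
  pulling back the interpolant on \<open>T2\<close> solves the interpolation problem on
  \<open>T1\<close>. \<open>F1\<close> and \<open>F2\<close> need not be related to each
  other.\<close>

lemma local_interp_reflect:
  assumes F: "reference_map F1 T1" "reference_map F2 T2" and "1 \<le> k" and T2: "T2 = (\<lambda>x. a - x) ` T1"
    and g: "\<And>x. g (a - x) = s * g x"
  shows "local_interp k F2 g (a - x) = s * local_interp k F1 g x"
proof -
  obtain L b where L: "linear L" "F1 = (\<lambda>\<xi>. L \<xi> + b)" "F1 ` T_ref = T1"
    using reference_mapE[OF F(1)] by metis
  \<comment> \<open>A second reference map of \<open>T2\<close>, usually different from
    \<open>F2\<close>; it serves only to identify the node set.\<close>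
  have "reference_map (\<lambda>\<xi>. a - F1 \<xi>) T2"
    unfolding reference_map_def
  proof (intro conjI exI)
    show "linear (\<lambda>\<xi>. - L \<xi>)" by (rule linear_compose_neg[OF L(1)])
    show "(\<lambda>\<xi>. a - F1 \<xi>) = (\<lambda>\<xi>. (a - b) + - L \<xi>)" by (simp add: L(2) algebra_simps)
    show "bij_betw (\<lambda>\<xi>. a - F1 \<xi>) T_ref T2"
      unfolding bij_betw_def T2 L(3)[symmetric]
      using reference_map_inj[OF F(1)] by (auto simp: inj_on_def image_image)
  qed
  then have nodes: "F2 ` lagrange_nodes k = (\<lambda>\<xi>. a - F1 \<xi>) ` lagrange_nodes k"
    using reference_map_nodes_unique F(2) \<open>1 \<le> k\<close> by blast
  have lin: "linear (\<lambda>x::real^2. - x)" by (rule linear_compose_neg[OF linear_ident])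
  have "local_interp k F1 (\<lambda>x. s * g x + 0 * g x) = (\<lambda>x. local_interp k F2 g (- x + a))"
  proof (rule local_interp_unique[OF F(1) \<open>1 \<le> k\<close>])
    show "(\<lambda>x. local_interp k F2 g (- x + a)) \<in> poly_le k"
      by (rule poly_le_affine_compose[OF local_interp_in_poly_le[OF F(2) \<open>1 \<le> k\<close>] lin])
    fix z assume "z \<in> F1 ` lagrange_nodes k"
    then have "a - z \<in> F2 ` lagrange_nodes k" unfolding nodes by blast
    then show "local_interp k F2 g (- z + a) = s * g z + 0 * g z"
      using local_interp_node[OF F(2) \<open>1 \<le> k\<close>] g by simp
  qed
  then show ?thesis
    unfolding local_interp_lincomb[OF F(1) \<open>1 \<le> k\<close>] by (simp add: fun_eq_iff)
qed

text \<open>A step of length \<open>r\<close> from the centre stays in \<open>T\<close>, and its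
  image stays in \<open>T_ref\<close>, where coordinates differ by at most 1.\<close>

lemma inverse_reference_map_bound:
  fixes y :: "real^2" and L' :: "real^2 \<Rightarrow> real^2"
  assumes "0 < r" "cball y r \<subseteq> T" "linear L'" "\<And>x. x \<in> T \<Longrightarrow> L' x + c \<in> T_ref"
  shows "\<bar>L' (axis i 1) $ j\<bar> \<le> 1 / r"
proof -
  have "y \<in> T" "y + r *\<^sub>R axis i 1 \<in> T"
    using assms(1) by (auto intro!: subsetD[OF assms(2)] simp: dist_norm[of y "y + _"])
  then have "L' y + c \<in> T_ref" "L' y + r *\<^sub>R L' (axis i 1) + c \<in> T_ref"
    using assms(4) by (auto simp: linear_add[OF assms(3)] linear_scale[OF assms(3)] dest: assms(4))
  then have "\<bar>r * L' (axis i 1) $ j\<bar> \<le> 1"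
    using exhaust_2[of j] unfolding T_ref_iff by (auto simp: abs_le_iff)
  then show ?thesis using assms(1) by (simp add: abs_mult field_simps)
qed

text \<open>Stability and inverse estimate in one: node values are bounded by \<open>B\<close>, and
  each basis function is a fixed polynomial composed with the inverse reference map, whose matrix
  entries are at most \<open>1 / r\<close>. So \<open>K\<close> is the same for all elements and all
  \<open>g\<close>.\<close>

lemma local_interp_iter_partial_deriv_bound:
  assumes "1 \<le> k"
  shows "\<exists>K\<ge>0. \<forall>F T g (B::real) y (r::real) x. reference_map F T \<longrightarrow> 0 < r \<longrightarrow> cball y r \<subseteq> T \<longrightarrow> (\<forall>z\<in>T. \<bar>g z\<bar> \<le> B) \<longrightarrow> x \<in> T
    \<longrightarrow> \<bar>iter_partial_deriv ds (local_interp k F g) x\<bar> \<le> K * B * (1 / r) ^ length ds"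
proof -
  let ?I = "{(i, j). i + j \<le> k}"
  have "\<exists>K\<ge>0. \<forall>L c \<Lambda> x. linear L \<longrightarrow> (\<forall>i j. \<bar>L (axis i 1) $ j\<bar> \<le> \<Lambda>) \<longrightarrow> L x + c \<in> T_ref \<longrightarrow>
    \<bar>iter_partial_deriv ds (\<lambda>x. lagrange_basis k z (L x + c)) x\<bar> \<le> K * \<Lambda> ^ length ds" if "z \<in> ?I" for z
    by (rule iter_partial_deriv_affine_bound[OF poly_le_imp_real_polynomial_function compact_T_ref])
      (use that lagrange_basis_in_poly_le in auto)
  then obtain K where K: "\<And>z. z \<in> ?I \<Longrightarrow> K z \<ge> 0"
    "\<And>z L c \<Lambda> x. z \<in> ?I \<Longrightarrow> linear L \<Longrightarrow> (\<forall>i j. \<bar>L (axis i 1) $ j\<bar> \<le> \<Lambda>) \<Longrightarrow> L x + c \<in> T_ref \<Longrightarrow>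
    \<bar>iter_partial_deriv ds (\<lambda>x. lagrange_basis k z (L x + c)) x\<bar> \<le> K z * \<Lambda> ^ length ds"
    by metis
  show ?thesis
  proof (intro exI[of _ "\<Sum>z\<in>?I. K z"] conjI allI impI)
    fix F T g and B :: real and y and r :: real and x
    assume F: "reference_map F T" and r: "0 < r" "cball y r \<subseteq> T" and g: "\<forall>z\<in>T. \<bar>g z\<bar> \<le> B" and x: "x \<in> T"
    obtain L' c where L': "linear L'" "inv F = (\<lambda>x. L' x + c)" and inv: "\<And>x. inv F (F x) = x" "F ` T_ref = T"
      using reference_mapE[OF F] by metis
    have T_ref: "L' x + c \<in> T_ref" if "x \<in> T" for x
      using that inv L'(2) by (metis imageE)
    have \<Lambda>: "\<forall>i j. \<bar>L' (axis i 1) $ j\<bar> \<le> 1 / r"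
      using inverse_reference_map_bound[OF r L'(1) T_ref] by blast
    have node: "\<bar>g (F (lagrange_node k z))\<bar> \<le> B" if "z \<in> ?I" for z
    proof -
      have "lagrange_node k z \<in> T_ref"
        using lagrange_nodes_subset_T_ref that unfolding lagrange_nodes_eq by blast
      then show ?thesis using g inv(2) by blast
    qed
    have poly: "real_polynomial_function (\<lambda>x. lagrange_basis k z (L' x + c))" if "z \<in> ?I" for z
    proof -
      have "lagrange_basis k z \<in> poly_le k" using that lagrange_basis_in_poly_le by auto
      then show ?thesis
        by (intro real_polynomial_function_affine_compose L'(1) poly_le_imp_real_polynomial_function)
    qed
    have "local_interp k F g = (\<lambda>x. \<Sum>z\<in>?I. g (F (lagrange_node k z)) * lagrange_basis k z (L' x + c))"
      unfolding local_interp_def ref_interp_eq[OF assms] L'(2) by simp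
    then have "iter_partial_deriv ds (local_interp k F g) x
      = (\<Sum>z\<in>?I. g (F (lagrange_node k z)) * iter_partial_deriv ds (\<lambda>x. lagrange_basis k z (L' x + c)) x)"
      using iter_partial_deriv_sum[OF finite_degree_indices poly] by presburger
    also have "\<bar>\<dots>\<bar> \<le> (\<Sum>z\<in>?I. \<bar>g (F (lagrange_node k z))\<bar> * \<bar>iter_partial_deriv ds (\<lambda>x. lagrange_basis k z (L' x + c)) x\<bar>)"
      by (rule order_trans[OF sum_abs]) (simp add: abs_mult)
    also have "\<dots> \<le> (\<Sum>z\<in>?I. B * (K z * (1 / r) ^ length ds))"
    proof (intro sum_mono mult_mono)
      show "0 \<le> B" using g x by (meson abs_ge_zero order_trans)
      fix z assume z: "z \<in> ?I"
      show "\<bar>iter_partial_deriv ds (\<lambda>x. lagrange_basis k z (L' x + c)) x\<bar> \<le> K z * (1 / r) ^ length ds"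
        by (rule K(2)[OF z L'(1) \<Lambda> T_ref[OF x]])
    qed (use node in auto)
    finally show "\<bar>iter_partial_deriv ds (local_interp k F g) x\<bar> \<le> (\<Sum>z\<in>?I. K z) * B * (1 / r) ^ length ds"
      by (simp add: sum_distrib_right sum_distrib_left mult_ac)
  qed (use K(1) in \<open>auto intro: sum_nonneg\<close>)
qed

lemma finite_mi_order_le: "finite {\<beta>. mi_order \<beta> \<le> m}"
  by (rule finite_subset[of _ "{..m} \<times> {..m}"]) (auto simp: mi_order_def)

text \<open>Only finitely many multi-indices have order at most \<open>m\<close>, so the sum of the
  individual constants serves them all.\<close>

lemma local_interp_partial_derivs_bound:
  assumes "1 \<le> k"
  shows "\<exists>K\<ge>0. \<forall>\<beta> F T g (B::real) y (r::real) x. mi_order \<beta> \<le> m \<longrightarrow> reference_map F T \<longrightarrow> 0 < r \<longrightarrow> cball y r \<subseteq> T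
    \<longrightarrow> (\<forall>z\<in>T. \<bar>g z\<bar> \<le> B) \<longrightarrow> x \<in> T
    \<longrightarrow> \<bar>partial_derivs \<beta> (local_interp k F g) x\<bar> \<le> K * B * (1 / r) ^ mi_order \<beta>"
proof -
  have "\<exists>K\<ge>0. \<forall>F T g (B::real) y (r::real) x. reference_map F T \<longrightarrow> 0 < r \<longrightarrow> cball y r \<subseteq> T \<longrightarrow> (\<forall>z\<in>T. \<bar>g z\<bar> \<le> B) \<longrightarrow> x \<in> T
    \<longrightarrow> \<bar>partial_derivs \<beta> (local_interp k F g) x\<bar> \<le> K * B * (1 / r) ^ mi_order \<beta>" for \<beta>
    using local_interp_iter_partial_deriv_bound[OF assms, of "replicate (fst \<beta>) 1 @ replicate (snd \<beta>) 2"]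
    by (simp add: mi_order_def partial_derivs_def foldr_replicate)
  then obtain K where K: "\<And>\<beta>. K \<beta> \<ge> 0" "\<And>\<beta> F T g (B::real) y (r::real) x. reference_map F T \<Longrightarrow> 0 < r \<Longrightarrow> cball y r \<subseteq> T
    \<Longrightarrow> \<forall>z\<in>T. \<bar>g z\<bar> \<le> B \<Longrightarrow> x \<in> T
    \<Longrightarrow> \<bar>partial_derivs \<beta> (local_interp k F g) x\<bar> \<le> K \<beta> * B * (1 / r) ^ mi_order \<beta>"
    by metis
  let ?K = "\<Sum>\<beta>\<in>{\<beta>. mi_order \<beta> \<le> m}. K \<beta>"
  show ?thesis
  proof (intro exI[of _ ?K] conjI allI impI)
    fix \<beta> F T g and B :: real and y and r :: real and x
    assume *: "mi_order \<beta> \<le> m" "reference_map F T" "0 < r" "cball y r \<subseteq> T" "\<forall>z\<in>T. \<bar>g z\<bar> \<le> B" "x \<in> T"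
    have "B \<ge> 0" using *(5,6) by (meson abs_ge_zero order_trans)
    have "K \<beta> \<le> ?K"
      by (rule member_le_sum) (use *(1) K(1) finite_mi_order_le in auto)
    then have "K \<beta> * B * (1 / r) ^ mi_order \<beta> \<le> ?K * B * (1 / r) ^ mi_order \<beta>"
      using \<open>B \<ge> 0\<close> \<open>0 < r\<close> by (intro mult_right_mono) auto
    then show "\<bar>partial_derivs \<beta> (local_interp k F g) x\<bar> \<le> ?K * B * (1 / r) ^ mi_order \<beta>"
      using K(2)[OF *(2-6), of \<beta>] by linarith
  qed (use K(1) in \<open>auto intro: sum_nonneg\<close>)
qed


section \<open>Meshes and integrals over elements\<close>

lemma two_simplex_facts:
  fixes T :: "(real^2) set"
  assumes "2 simplex T"
  shows "compact T" "convex T" "interior T \<noteq> {}" "closure (interior T) = T"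
proof -
  show c: "compact T" "convex T" using assms by (auto intro: compact_simplex convex_simplex)
  have ad: "aff_dim T = 2" using assms by (rule aff_dim_simplex)
  then have "T \<noteq> {}" by auto
  moreover have "interior T = rel_interior T"
    using ad by (simp add: interior_rel_interior_gen)
  ultimately show "interior T \<noteq> {}"
    using rel_interior_eq_empty[OF c(2)] by simp
  then show "closure (interior T) = T"
    using convex_closure_interior[OF c(2)] closure_closed[OF compact_imp_closed[OF c(1)]] by simp
qed

text \<open>A face that meets the interior is the whole simplex. Applied in both elements this
  forces equality, so the choice in \<open>interp\<close> is determined inside each element.\<close>

lemma triangulation_interior_unique:
  assumes "triangulation \<T>" "T \<in> \<T>" "T' \<in> \<T>" "x \<in> interior T" "x \<in> T'"
  shows "T' = T"
proof -
  have f: "T \<inter> T' face_of T" "T' \<inter> T face_of T'"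
    using assms(1-3) unfolding triangulation_def by blast+
  have x: "x \<in> T" using assms(4) interior_subset by blast
  have "T \<inter> T' = T"
    using face_of_disjoint_interior[OF f(1)] assms(4,5) x by blast
  then have "T \<subseteq> T'" by blast
  then have "x \<in> interior T'" using assms(4) interior_mono by blast
  then have "T' \<inter> T = T'"
    using face_of_disjoint_interior[OF f(2)] assms(5) x by blast
  with \<open>T \<subseteq> T'\<close> show ?thesis by blast
qed

lemma negligible_triangulation_Int:
  fixes T T' :: "(real^2) set"
  assumes "triangulation \<T>" "T \<in> \<T>" "T' \<in> \<T>" "T \<noteq> T'" "convex T"
  shows "negligible (T \<inter> T')"
proof (rule negligible_subset[OF negligible_convex_frontier[OF assms(5)]])
  have "x \<notin> interior T" if "x \<in> T'" for x
    using triangulation_interior_unique[OF assms(1-3)] assms(4) that by blast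
  then show "T \<inter> T' \<subseteq> frontier T"
    unfolding frontier_def using closure_subset by blast
qed

lemma sum_measure_triangulation:
  fixes \<T> :: "(real^2) set set"
  assumes "triangulation \<T>" "\<And>T. T \<in> \<T> \<Longrightarrow> 2 simplex T" "\<S> \<subseteq> \<T>"
  shows "(\<Sum>T\<in>\<S>. measure lebesgue T) = measure lebesgue (\<Union>\<S>)"
proof (rule measure_negligible_finite_Union[symmetric])
  show "finite \<S>"
    using assms(1,3) finite_subset unfolding triangulation_def by blast
  show "T \<in> lmeasurable" if "T \<in> \<S>" for T
    using that assms(2,3) two_simplex_facts(1) lmeasurable_compact by blast
  show "pairwise (\<lambda>S T. negligible (S \<inter> T)) \<S>"
    using negligible_triangulation_Int[OF assms(1)] assms(2,3) two_simplex_facts(2)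
    unfolding pairwise_def by blast
qed

text \<open>
  Shrinking a convex body towards the centre of an inscribed ball moves it away from its boundary
  at linear rate.
\<close>
lemma measure_boundary_strip:
  fixes \<Omega> S :: "(real^2) set"
  assumes "convex \<Omega>" "compact \<Omega>" "0 < r" "cball c r \<subseteq> \<Omega>" "0 < h" "S \<in> lmeasurable"
    and S: "S \<subseteq> {x\<in>\<Omega>. infdist x (frontier \<Omega>) \<le> h}"
  shows "measure lebesgue S \<le> 4 / r * measure lebesgue \<Omega> * h"
\<comment> \<open>For larger \<open>h\<close> the claimed bound already exceeds the area of
  \<Omega>.\<close>
proof (cases "2 * h / r < 1")
  case False
  then have "1 \<le> 4 / r * h" using assms(3) by (simp add: field_simps)
  then have "measure lebesgue \<Omega> \<le> 4 / r * measure lebesgue \<Omega> * h"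
    using mult_right_mono[of 1 "4 / r * h" "measure lebesgue \<Omega>"] by (simp add: mult_ac)
  moreover have "measure lebesgue S \<le> measure lebesgue \<Omega>"
    using S assms(2,6) by (intro measure_mono_fmeasurable) (auto simp: lmeasurable_compact)
  ultimately show ?thesis by simp
next
  case True
  \<comment> \<open>The shrunken copy keeps a ball of radius \<open>t * r\<close> around each of its
    points inside \<Omega>; the factor 2 makes this radius exceed \<open>h\<close>, so the copy
    misses the strip.\<close>
  define t where "t = 2 * h / r"
  have t: "0 < t" "t < 1" "t * r > h" using True assms(3,5) by (auto simp: t_def)
  let ?f = "\<lambda>x. (1 - t) *\<^sub>R x + t *\<^sub>R c"
  have ball: "ball (?f x) (t * r) \<subseteq> \<Omega>" if "x \<in> \<Omega>" for x
  proof
    fix y assume y: "y \<in> ball (?f x) (t * r)"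
    \<comment> \<open>Solves \<open>y = (1 - t) *\<^sub>R x + t *\<^sub>R w\<close>; since
      \<open>y\<close> is close to \<open>?f x\<close>, the point \<open>w\<close> falls into the
      ball around \<open>c\<close>.\<close>
    define w where "w = c + (1/t) *\<^sub>R (y - ?f x)"
    have "c - w = (1/t) *\<^sub>R (?f x - y)" by (simp add: w_def algebra_simps)
    then have "dist c w = dist (?f x) y / t" using t(1) by (simp add: dist_norm)
    then have "dist c w < r" using y t(1) by (simp add: divide_less_eq mult.commute)
    then have "w \<in> \<Omega>" using assms(4) by auto
    moreover have "y = (1 - t) *\<^sub>R x + t *\<^sub>R w"
      using t(1) by (simp add: w_def scaleR_add_right)
    ultimately show "y \<in> \<Omega>"
      using assms(1) \<open>x \<in> \<Omega>\<close> t by (simp add: convex_def)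
  qed
  have sub: "?f ` \<Omega> \<subseteq> \<Omega>"
  proof safe
    fix x assume "x \<in> \<Omega>"
    have "?f x \<in> ball (?f x) (t * r)" using t(1) assms(3) by simp
    then show "?f x \<in> \<Omega>" using ball[OF \<open>x \<in> \<Omega>\<close>] by blast
  qed
  have "c \<in> \<Omega>" using assms(3,4) by auto
  then have front: "frontier \<Omega> \<noteq> {}"
    using compact_imp_bounded[OF assms(2)] not_bounded_UNIV frontier_eq_empty[of \<Omega>] by auto
  have disj: "S \<inter> ?f ` \<Omega> = {}"
  proof (rule ccontr)
    assume "S \<inter> ?f ` \<Omega> \<noteq> {}"
    then obtain x where x: "x \<in> \<Omega>" "?f x \<in> S" by blast
    then have "infdist (?f x) (frontier \<Omega>) \<le> h" using S by auto
    then obtain z where "z \<in> frontier \<Omega>" "dist (?f x) z \<le> h"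
      using infdist_attains_inf[OF frontier_closed front] by metis
    then have "z \<in> ball (?f x) (t * r)" using t by simp
    then have "z \<in> interior \<Omega>" using interior_maximal[OF ball[OF x(1)] open_ball] by blast
    with \<open>z \<in> frontier \<Omega>\<close> show False by (simp add: frontier_def)
  qed
  \<comment> \<open>The plane contributes the square. What the copy leaves uncovered is at most a
    fraction \<open>2 * t\<close>, that is \<open>4 * h / r\<close>, of the area.\<close>
  have img: "measure lebesgue (?f ` \<Omega>) = (1 - t)\<^sup>2 * measure lebesgue \<Omega>"
    using measure_lebesgue_affine[of "1 - t" "t *\<^sub>R c" \<Omega>] by simp
  have meas: "?f ` \<Omega> \<in> lmeasurable"
    by (intro lmeasurable_compact compact_continuous_image assms(2) continuous_intros)
  have "measure lebesgue S + measure lebesgue (?f ` \<Omega>) = measure lebesgue (S \<union> ?f ` \<Omega>)"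
    using measure_Un3[OF assms(6) meas] disj by simp
  also have "\<dots> \<le> measure lebesgue \<Omega>"
    using sub S assms(2,6) meas by (intro measure_mono_fmeasurable) (auto simp: lmeasurable_compact)
  finally have "measure lebesgue S \<le> (1 - (1 - t)\<^sup>2) * measure lebesgue \<Omega>"
    unfolding img by (simp add: algebra_simps)
  also have "\<dots> \<le> (2 * t) * measure lebesgue \<Omega>"
    by (intro mult_right_mono) (auto simp: power2_eq_square algebra_simps)
  finally show ?thesis by (simp add: t_def field_simps)
qed

text \<open>Nothing is assumed about \<open>g\<close> on the frontier, which is a null set for
  convex \<open>T\<close>. Integrability of \<open>g\<close> is part of the work: it stays within
  \<open>B\<close> of \<open>q\<close>, which is bounded on the compact \<open>T\<close>.\<close>

lemma set_integral_approx:
  fixes g q :: "real^2 \<Rightarrow> real"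
  assumes "convex T" "compact T" "continuous_on (interior T) g" "continuous_on T q" "0 \<le> B"
    and B: "\<And>x. x \<in> interior T \<Longrightarrow> \<bar>g x - q x\<bar> \<le> B"
  shows "\<bar>(LINT x:T|lebesgue. g x) - (LINT x:T|lebesgue. q x)\<bar> \<le> B * measure lebesgue T"
proof -
  let ?U = "interior T"
  have UT: "?U \<subseteq> T" by (rule interior_subset)
  have N: "negligible (T - ?U)"
    by (rule negligible_subset[OF negligible_convex_frontier[OF assms(1)]])
      (use closure_subset in \<open>auto simp: frontier_def\<close>)
  have T: "T \<in> lmeasurable" using assms(2) by (rule lmeasurable_compact)
  have U: "?U \<in> lmeasurable"
    using lmeasurable_interior[OF compact_imp_bounded[OF assms(2)]] negligible_convex_frontier[OF assms(1)] by blast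
  obtain b where b: "\<And>x. x \<in> T \<Longrightarrow> \<bar>q x\<bar> \<le> b"
    using compact_imp_bounded[OF compact_continuous_image[OF assms(4,2)]] unfolding bounded_iff by auto
  have int: "u absolutely_integrable_on ?U" if "continuous_on ?U u" "\<And>x. x \<in> ?U \<Longrightarrow> \<bar>u x\<bar> \<le> C" for u :: "real^2 \<Rightarrow> real" and C
    by (rule measurable_bounded_by_integrable_imp_absolutely_integrable[where g = "\<lambda>_. C"])
      (use that U in \<open>auto intro: continuous_imp_measurable_on_sets_lebesgue integrable_on_const fmeasurableD\<close>)
  have gU: "g absolutely_integrable_on ?U"
  proof (rule int[OF assms(3)])
    fix x assume "x \<in> ?U"
    then show "\<bar>g x\<bar> \<le> B + b" using B[of x] b[of x] UT by (auto simp: abs_le_iff)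
  qed
  have qU: "q absolutely_integrable_on ?U"
    by (rule int[OF continuous_on_subset[OF assms(4) UT]]) (use b UT in blast)
  have spike: "u absolutely_integrable_on T" "integral T u = integral ?U u"
    if "u absolutely_integrable_on ?U" for u :: "real^2 \<Rightarrow> real"
  proof -
    have n: "negligible {x \<in> T - ?U. u x \<noteq> 0}" "negligible {x \<in> ?U - T. u x \<noteq> 0}"
      using negligible_subset[OF N] UT by (auto intro: negligible_subset[OF N])
    show "u absolutely_integrable_on T"
      using absolutely_integrable_spike_set_eq[OF n] that by simp
    show "integral T u = integral ?U u"
      by (rule integral_spike_set[OF n])
  qed
  have "(LINT x:T|lebesgue. g x) - (LINT x:T|lebesgue. q x) = integral ?U g - integral ?U q"
    using set_lebesgue_integral_eq_integral(2)[OF spike(1)[OF gU]] set_lebesgue_integral_eq_integral(2)[OF spike(1)[OF qU]]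
      spike(2)[OF gU] spike(2)[OF qU] by simp
  also have "\<dots> = integral ?U (\<lambda>x. g x - q x)"
    using gU qU by (intro Henstock_Kurzweil_Integration.integral_diff[symmetric]) (auto simp: absolutely_integrable_on_def)
  also have "norm \<dots> \<le> integral ?U (\<lambda>_. B)"
    using gU qU U B by (intro Henstock_Kurzweil_Integration.integral_norm_bound_integral)
      (auto intro!: Henstock_Kurzweil_Integration.integrable_diff integrable_on_const simp: absolutely_integrable_on_def)
  also have "\<dots> = B * measure lebesgue ?U"
    using lmeasure_integral[OF U] Henstock_Kurzweil_Integration.integral_mult_right[of ?U B "\<lambda>_. 1"] by simp
  also have "\<dots> \<le> B * measure lebesgue T"
    using U T UT \<open>0 \<le> B\<close> by (intro mult_left_mono measure_mono_fmeasurable) (auto intro: fmeasurableD)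
  finally show ?thesis by simp
qed

lemma set_integral_point_reflection:
  fixes q :: "real^2 \<Rightarrow> real"
  assumes "compact T" "continuous_on UNIV q"
  shows "(LINT x:(\<lambda>x. a - x) ` T|lebesgue. q x) = (LINT x:T|lebesgue. q (a - x))"
proof -
  let ?S = "(\<lambda>x. a - x) ` T" and ?R = "\<lambda>x. a - x"
  \<comment> \<open>The library's affine substitution scales each coordinate; with all factors -1 it
    is the reflection, and the density is 1.\<close>
  have R: "(\<lambda>x. a + (\<Sum>j\<in>Basis. (- 1 * (x \<bullet> j)) *\<^sub>R j)) = ?R"
    by (simp add: sum_negf euclidean_representation)
  have leb: "distr lebesgue lebesgue ?R = lebesgue"
    using lebesgue_affine_euclidean[of "\<lambda>_. -1" a] unfolding R by (simp add: density_1)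
  have Rm: "?R \<in> lebesgue \<rightarrow>\<^sub>M lebesgue"
    using lebesgue_affine_measurable[of "\<lambda>_. -1" a] unfolding R by simp
  have S: "?S \<in> sets lebesgue"
    using assms(1) by (intro fmeasurableD lmeasurable_compact compact_continuous_image continuous_intros)
  have q: "q \<in> borel_measurable lebesgue"
    using assms(2) continuous_imp_measurable_on_sets_lebesgue[of UNIV q] by simp
  have m: "(\<lambda>x. indicat_real ?S x *\<^sub>R q x) \<in> borel_measurable lebesgue"
    using S q by (intro borel_measurable_scaleR borel_measurable_indicator)
  have "(LINT x:?S|lebesgue. q x) = (LINT x|distr lebesgue lebesgue ?R. indicat_real ?S x *\<^sub>R q x)"
    unfolding set_lebesgue_integral_def leb ..
  also have "\<dots> = (LINT x|lebesgue. indicat_real ?S (a - x) *\<^sub>R q (a - x))"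
    by (rule integral_distr[OF Rm m])
  also have "(\<lambda>x. indicat_real ?S (a - x)) = indicat_real T"
    by (auto simp: indicator_def image_iff fun_eq_iff)
  then have "(LINT x|lebesgue. indicat_real ?S (a - x) *\<^sub>R q (a - x)) = (LINT x:T|lebesgue. q (a - x))"
    unfolding set_lebesgue_integral_def by (metis (no_types))
  finally show ?thesis .
qed

text \<open>A boundary point is a limit point of the interior, so the limit in \<open>D_on\<close>
  is unique there and agrees with any continuous extension.\<close>

lemma D_on_extension:
  assumes "closure (interior S) = S" "continuous_on S g" "\<And>x. x \<in> interior S \<Longrightarrow> g x = partial_derivs \<beta> f x"
    and "x \<in> S"
  shows "D_on S \<beta> f x = g x"
proof (cases "x \<in> interior S")
  case False
  then have "x islimpt interior S"
    using assms(1,4) by (auto simp: closure_def)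
  then have nt: "\<not> trivial_limit (at x within interior S)"
    by (simp add: trivial_limit_within)
  have "(g \<longlongrightarrow> g x) (at x within interior S)"
    using assms(2,4) interior_subset unfolding continuous_on_def by (blast intro: tendsto_within_subset)
  moreover have "\<forall>\<^sub>F y in at x within interior S. g y = partial_derivs \<beta> f y"
    using assms(3) by (simp add: eventually_at_filter)
  ultimately have "(partial_derivs \<beta> f \<longlongrightarrow> g x) (at x within interior S)"
    using tendsto_cong by force
  then show ?thesis
    using False nt by (simp add: D_on_def tendsto_Lim)
qed (simp add: D_on_def assms(3))

text \<open>The supremum inside \<open>C_norm\<close> is an upper bound only if the set is bounded
  above; this comes from the continuous extension of the derivative to the compact
  \<open>S\<close>.\<close>

lemma partial_derivs_le_C_norm:
  assumes "compact S" "closure (interior S) = S" "C_derivs m S f" "mi_order \<beta> \<le> m" "x \<in> interior S"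
  shows "\<bar>partial_derivs \<beta> f x\<bar> \<le> C_norm m S f"
proof -
  obtain a b where ab: "\<beta> = (a, b)" by fastforce
  have "C_derivs 0 S (partial_derivs \<beta> f)"
    unfolding ab by (intro C_derivs_partial_derivs C_derivs_le[OF assms(3)])
      (use assms(4) in \<open>simp add: ab mi_order_def\<close>)
  then obtain g where g: "continuous_on S g" "\<And>x. x \<in> interior S \<Longrightarrow> g x = partial_derivs \<beta> f x"
    unfolding C_derivs.simps extends_continuously_def by blast
  have "D_on S \<beta> f y = g y" if "y \<in> S" for y
    using D_on_extension[OF assms(2) g that] by simp
  moreover have "bounded (g ` S)"
    by (intro compact_imp_bounded compact_continuous_image g assms(1))
  then obtain B where "\<And>y. y \<in> S \<Longrightarrow> \<bar>g y\<bar> \<le> B"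
    unfolding bounded_iff by auto
  ultimately have "bdd_above ((\<lambda>y. \<bar>D_on S \<beta> f y\<bar>) ` S)"
    by (intro bdd_aboveI2[of _ _ B]) auto
  then have "\<bar>D_on S \<beta> f x\<bar> \<le> (SUP y\<in>S. \<bar>D_on S \<beta> f y\<bar>)"
    using assms(5) interior_subset by (intro cSUP_upper) auto
  also have "\<dots> \<le> C_norm m S f"
    unfolding C_norm_def by (intro Max_ge) (use finite_mi_order_le assms(4) in auto)
  finally show ?thesis using assms(5) by (simp add: D_on_def)
qed

lemma shape_regular_inscribed_ball:
  fixes \<T> :: "(real^2) set set"
  assumes "finite \<T>" "T \<in> \<T>" "2 simplex T" "shape_regular \<kappa> \<T>" "quasi_uniform q \<T>"
  shows "0 < mesh_size \<T>" "diameter T \<le> mesh_size \<T>"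
    and "\<exists>y r. 0 < r \<and> cball y r \<subseteq> T \<and> mesh_size \<T> / r \<le> 4 * \<bar>\<kappa> * q\<bar>"
proof -
  note T = two_simplex_facts[OF assms(3)]
  have bT: "bounded T" using T(1) by (rule compact_imp_bounded)
  obtain x e where e: "e > 0" "cball x e \<subseteq> T"
    using T(3) mem_interior_cball by blast
  show dm: "diameter T \<le> mesh_size \<T>"
    unfolding mesh_size_def using assms(1,2) by (intro Max_ge) auto
  have rad: "2 * r \<le> diameter T" if "0 \<le> r" "cball y r \<subseteq> T" for y r
    using diameter_subset[OF that(2) bT] that(1) by simp
  have d: "0 < diameter T" using rad[OF _ e(2)] e(1) by simp
  then show h: "0 < mesh_size \<T>" using dm by simp
  have qd: "mesh_size \<T> \<le> q * diameter T" and \<kappa>: "diameter T \<le> \<kappa> * (2 * inradius T)"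
    using assms(2,4,5) by (auto simp: shape_regular_def quasi_uniform_def)
  let ?R = "{r. 0 \<le> r \<and> (\<exists>x. cball x r \<subseteq> T)}"
  have "bdd_above ?R" by (rule bdd_aboveI[of _ "diameter T / 2"]) (use rad in force)
  then have "e \<le> inradius T"
    unfolding inradius_def using e by (intro cSup_upper) auto
  with e(1) have in0: "0 < inradius T" by simp
  then have "inradius T / 2 < Sup ?R" by (simp add: inradius_def)
  moreover have "?R \<noteq> {}" using e less_imp_le[OF e(1)] by blast
  \<comment> \<open>A ball of more than half the supremal radius suffices, so the supremum need not
    be attained. This 2, together with the 2 in \<open>shape_regular\<close>, gives the factor
    4.\<close>
  ultimately obtain r y where r: "inradius T / 2 < r" "cball y r \<subseteq> T"
    using less_cSupD[of ?R "inradius T / 2"] by blast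
  have "q > 0" using qd h d by (smt (verit) mult_nonpos_nonneg)
  have "\<kappa> > 0" using \<kappa> d in0 by (smt (verit) mult_nonpos_nonneg)
  have "mesh_size \<T> \<le> q * (\<kappa> * (2 * inradius T))"
    using qd \<kappa> \<open>q > 0\<close> by (meson mult_left_mono less_imp_le order_trans)
  also have "\<dots> \<le> q * (\<kappa> * (4 * r))"
    using r(1) \<open>q > 0\<close> \<open>\<kappa> > 0\<close> by simp
  finally have "mesh_size \<T> / r \<le> 4 * \<bar>\<kappa> * q\<bar>"
    using r(1) in0 \<open>q > 0\<close> \<open>\<kappa> > 0\<close> by (simp add: divide_simps abs_mult mult_ac)
  moreover have "0 < r" using r(1) in0 by simp
  ultimately show "\<exists>y r. 0 < r \<and> cball y r \<subseteq> T \<and> mesh_size \<T> / r \<le> 4 * \<bar>\<kappa> * q\<bar>"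
    using r(2) by blast
qed

lemma symmetric_pair_reflection:
  assumes "symmetric_pair T1 T2"
  obtains x0 where "x0 \<in> T1" "T1 \<inter> T2 = {x0}" "T2 = (\<lambda>x. 2 *\<^sub>R x0 - x) ` T1"
proof -
  obtain x0 F1 F2 where *: "T1 \<inter> T2 = {x0}" "reference_map F1 T1" "reference_map F2 T2"
    "\<And>\<xi>. \<xi> \<in> T_ref \<Longrightarrow> F1 \<xi> - x0 = x0 - F2 \<xi>"
    using assms unfolding symmetric_pair_def by blast
  have T: "T1 = F1 ` T_ref" "T2 = F2 ` T_ref"
    using *(2,3) by (auto simp: reference_map_def bij_betw_def)
  have "F2 \<xi> = 2 *\<^sub>R x0 - F1 \<xi>" if "\<xi> \<in> T_ref" for \<xi>
    using *(4)[OF that] by (simp add: scaleR_2 algebra_simps)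
  then have "T2 = (\<lambda>x. 2 *\<^sub>R x0 - x) ` T1"
    unfolding T image_image by (intro image_cong) auto
  moreover have "x0 \<in> T1" using *(1) by blast
  ultimately show ?thesis using that *(1) by blast
qed

text \<open>\<open>x0\<close> lies halfway between an interior point of \<open>T\<close> and its
  mirror image in \<Omega>. This makes the common vertex of a symmetric pair an admissible centre of
  expansion.\<close>

lemma midpoint_mem_interior:
  fixes x0 :: "'a::euclidean_space"
  assumes "convex \<Omega>" "T \<subseteq> \<Omega>" "(\<lambda>x. 2 *\<^sub>R x0 - x) ` T \<subseteq> \<Omega>" "interior T \<noteq> {}"
  shows "x0 \<in> interior \<Omega>"
proof -
  obtain y where y: "y \<in> interior T" using assms(4) by blast
  have "y \<in> interior \<Omega>" using y interior_mono[OF assms(2)] by blast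
  moreover have "2 *\<^sub>R x0 - y \<in> \<Omega>" using assms(3) y interior_subset by blast
  ultimately have "(2 *\<^sub>R x0 - y) - (1/2) *\<^sub>R ((2 *\<^sub>R x0 - y) - y) \<in> interior \<Omega>"
    by (intro mem_interior_convex_shrink[OF assms(1)]) auto
  moreover have "2 *\<^sub>R x0 - y - y = 2 *\<^sub>R (x0 - y)" by (simp add: scaleR_2)
  then have "(1/2) *\<^sub>R (2 *\<^sub>R x0 - y - y) = x0 - y" by (simp only:) simp
  then have "(2 *\<^sub>R x0 - y) - (1/2) *\<^sub>R ((2 *\<^sub>R x0 - y) - y) = x0"
    by (simp only:) (simp add: scaleR_2)
  ultimately show ?thesis by simp
qed


section \<open>Taylor expansion and cancellation\<close>

text \<open>
  Here \<open>f = p + H + R\<close> is the Taylor expansion of \<open>f\<close> at \<open>x0\<close>, with \<open>p\<close> collecting the terms of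
  degree at most \<open>k\<close>, \<open>H\<close> those of degree exactly \<open>k + 1\<close>, and \<open>R\<close> the remainder.
\<close>
definition taylor_split ::
    "(real^2) set \<Rightarrow> nat \<Rightarrow> (real^2 \<Rightarrow> real) \<Rightarrow> real^2 \<Rightarrow> (real^2 \<Rightarrow> real) \<Rightarrow> (real^2 \<Rightarrow> real) \<Rightarrow> bool" where
  "taylor_split \<Omega> k f x0 p H \<longleftrightarrow> p \<in> poly_le k \<and> real_polynomial_function H \<and>
     (\<forall>x. H (2 *\<^sub>R x0 - x) = (-1) ^ (k + 1) * H x) \<and>
     (\<forall>\<beta> x. mi_order \<beta> \<le> k + 1 \<longrightarrow>
        \<bar>partial_derivs \<beta> H x\<bar> \<le> C_norm (k + 2) \<Omega> f * (2 * norm (x - x0)) ^ (k + 1 - mi_order \<beta>)) \<and>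
     (\<forall>\<beta> x. mi_order \<beta> = k + 2 \<longrightarrow> partial_derivs \<beta> H x = 0) \<and>
     (\<forall>\<beta>. \<forall>x\<in>interior \<Omega>. mi_order \<beta> \<le> k + 2 \<longrightarrow>
        \<bar>partial_derivs \<beta> (\<lambda>x. f x - p x - H x) x\<bar>
          \<le> C_norm (k + 2) \<Omega> f * (2 * norm (x - x0)) ^ (k + 2 - mi_order \<beta>)) \<and>
     (\<forall>x\<in>\<Omega>. \<bar>f x - p x - H x\<bar> \<le> C_norm (k + 2) \<Omega> f * (2 * norm (x - x0)) ^ (k + 2))"

text \<open>The derivatives of the remainder below order \<open>k + 2\<close> vanish at
  \<open>x0\<close>, and those of order \<open>k + 2\<close> are those of \<open>f\<close>, so
  \<open>iterated_mean_value_bound\<close> applies on the interior of \<Omega>. The same lemma with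
  top order \<open>k + 1\<close>, on the whole plane, bounds the derivatives of
  \<open>H\<close>.\<close>

lemma taylor_split_exists:
  assumes "compact \<Omega>" "convex \<Omega>" "closure (interior \<Omega>) = \<Omega>" "C_on (k + 2) \<Omega> f" "x0 \<in> interior \<Omega>"
  shows "\<exists>p H. taylor_split \<Omega> k f x0 p H"
proof -
  define M where "M = C_norm (k + 2) \<Omega> f"
  have cont: "continuous_on \<Omega> f" and Cf: "C_derivs (k + 2) \<Omega> f"
    using assms(4) by (auto simp only: C_on_def)
  have pd_le: "\<bar>partial_derivs \<beta> f x\<bar> \<le> M" if "mi_order \<beta> \<le> k + 2" "x \<in> interior \<Omega>" for \<beta> x
    unfolding M_def by (rule partial_derivs_le_C_norm[OF assms(1,3) Cf that])
  have "M \<ge> 0"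
    using pd_le[of "(0, 0)" x0] assms(5) by (simp add: mi_order_def)
  define c where "c i j = (if i + j \<le> k + 1 then partial_derivs (i, j) f x0 else 0)" for i j
  define cp where "cp i j = (if i + j \<le> k then c i j else 0)" for i j
  define cH where "cH i j = (if i + j = k + 1 then c i j else 0)" for i j
  let ?T = "\<lambda>c. taylor_poly (Suc k) c x0"
  let ?p = "?T cp" and ?H = "?T cH" and ?P = "?T c"
  let ?R = "\<lambda>x. f x - ?p x - ?H x"
  have "cp i j + cH i j = c i j" for i j
    by (auto simp: cp_def cH_def c_def)
  then have R: "?R = (\<lambda>x. f x + (-1) * ?P x)"
    using taylor_poly_add[of "Suc k" cp x0 _ cH] by (fastforce simp: algebra_simps)
  have pdT: "partial_derivs (a, b) (?T d) = ?T (\<lambda>i j. d (i + a) (j + b))"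
    if "d \<in> {cp, cH, c}" for a b d
    by (rule partial_derivs_taylor_poly) (use that in \<open>auto simp: cp_def cH_def c_def\<close>)
  have CP: "C_derivs m S (?T d)" for m S d
    by (intro C_derivs_real_polynomial_function real_polynomial_function_taylor_poly)
  have CR: "C_derivs (k + 2) \<Omega> ?R"
    unfolding R by (intro C_derivs_lincomb Cf CP)
  have pdR: "partial_derivs (a, b) ?R x = partial_derivs (a, b) f x - ?T (\<lambda>i j. c (i + a) (j + b)) x"
    if "a + b \<le> k + 2" "x \<in> interior \<Omega>" for a b x
    using partial_derivs_lincomb[OF Cf CP[of "k + 2" \<Omega> c], of "(a, b)" x "-1"] that
    unfolding R by (simp add: mi_order_def pdT)
  have bR: "\<bar>partial_derivs (a, b) ?R x\<bar> \<le> M * (2 * norm (x - x0)) ^ (k + 2 - (a + b))"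
    if "a + b \<le> k + 2" "x \<in> interior \<Omega>" for a b x
  proof (rule iterated_mean_value_bound[where d = "\<lambda>a b. partial_derivs (a, b) ?R" and U = "interior \<Omega>"])
    show "convex (interior \<Omega>)" using assms(2) by (rule convex_interior)
    show "(partial_derivs (a, b) ?R has_derivative
        (\<lambda>v. v $ 1 * partial_derivs (Suc a, b) ?R x + v $ 2 * partial_derivs (a, Suc b) ?R x)) (at x)"
      if "a + b < k + 2" "x \<in> interior \<Omega>" for a b x
      by (rule partial_derivs_has_derivative[OF CR that])
    show "partial_derivs (a, b) ?R x0 = 0" if "a + b < k + 2" for a b
      using that pdR[of a b x0] assms(5) by (simp add: taylor_poly_centre c_def)
    show "\<bar>partial_derivs (a, b) ?R x\<bar> \<le> M" if "a + b = k + 2" "x \<in> interior \<Omega>" for a b x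
    proof -
      have "(\<lambda>i j. c (i + a) (j + b)) = (\<lambda>i j. 0)" using that(1) by (auto simp: c_def fun_eq_iff)
      then have "partial_derivs (a, b) ?R x = partial_derivs (a, b) f x"
        using pdR[of a b x] that by (simp add: taylor_poly_constant)
      then show ?thesis using pd_le[of "(a, b)" x] that by (simp add: mi_order_def)
    qed
  qed (use that assms(5) \<open>M \<ge> 0\<close> in auto)
  have bH: "\<bar>partial_derivs (a, b) ?H x\<bar> \<le> M * (2 * norm (x - x0)) ^ (k + 1 - (a + b))"
    if "a + b \<le> k + 1" for a b x
  proof (rule iterated_mean_value_bound[where d = "\<lambda>a b. partial_derivs (a, b) ?H" and U = UNIV])
    show "(partial_derivs (a, b) ?H has_derivative
        (\<lambda>v. v $ 1 * partial_derivs (Suc a, b) ?H x + v $ 2 * partial_derivs (a, Suc b) ?H x)) (at x)"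
      if "a + b < k + 1" for a b x
      by (rule partial_derivs_has_derivative[OF CP[of "k + 1" UNIV cH] that]) simp
    show "partial_derivs (a, b) ?H x0 = 0" if "a + b < k + 1" for a b
      using that by (simp add: pdT taylor_poly_centre cH_def)
    show "\<bar>partial_derivs (a, b) ?H x\<bar> \<le> M" if "a + b = k + 1" for a b x
    proof -
      have "partial_derivs (a, b) ?H x = cH a b"
      proof -
        have "taylor_poly (Suc k) (\<lambda>i j. cH (i + a) (j + b)) x0 x = cH (0 + a) (0 + b)"
          by (rule taylor_poly_constant, unfold cH_def, rule if_not_P) (use that in linarith)
        then show ?thesis by (simp add: pdT)
      qed
      then show ?thesis
        using that pd_le[of "(a, b)" x0] assms(5) by (simp add: mi_order_def cH_def c_def)
    qed
  qed (use that \<open>M \<ge> 0\<close> in auto)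
  have H0: "partial_derivs (a, b) ?H x = 0" if "a + b = k + 2" for a b x
  proof -
    have "taylor_poly (Suc k) (\<lambda>i j. cH (i + a) (j + b)) x0 x = cH (0 + a) (0 + b)"
      by (rule taylor_poly_constant, unfold cH_def, rule if_not_P) (use that in linarith)
    then show ?thesis using that by (simp add: pdT cH_def)
  qed
  have cR: "\<bar>?R x\<bar> \<le> M * (2 * norm (x - x0)) ^ (k + 2)" if "x \<in> \<Omega>" for x
  proof -
    \<comment> \<open>Interpolation nodes may lie on the frontier of \<Omega>, where only continuity
      of \<open>f\<close> is available; the bound extends to them by closure.\<close>
    let ?g = "\<lambda>x. \<bar>?R x\<bar> - M * (2 * norm (x - x0)) ^ (k + 2)"
    have "?g x \<le> 0"
    proof (rule continuous_le_on_closure[of "interior \<Omega>" ?g])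
      show "continuous_on (closure (interior \<Omega>)) ?g"
        unfolding assms(3)
        by (intro continuous_intros cont continuous_on_real_polynomial_function real_polynomial_function_taylor_poly)
      show "x \<in> closure (interior \<Omega>)" using that assms(3) by simp
      show "?g y \<le> 0" if "y \<in> interior \<Omega>" for y
        using bR[of 0 0 y] that by simp
    qed
    then show ?thesis by simp
  qed
  have "taylor_split \<Omega> k f x0 ?p ?H"
    unfolding taylor_split_def M_def[symmetric]
  proof (intro conjI allI ballI impI)
    show "?p \<in> poly_le k" by (rule taylor_poly_in_poly_le) (simp add: cp_def)
    show "?H (2 *\<^sub>R x0 - x) = (-1) ^ (k + 1) * ?H x" for x
      by (rule taylor_poly_reflect) (simp add: cH_def)
    show "\<bar>partial_derivs \<beta> ?H x\<bar> \<le> M * (2 * norm (x - x0)) ^ (k + 1 - mi_order \<beta>)"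
      if "mi_order \<beta> \<le> k + 1" for \<beta> x
      using that bH[of "fst \<beta>" "snd \<beta>" x] by (simp add: mi_order_def)
    show "partial_derivs \<beta> ?H x = 0" if "mi_order \<beta> = k + 2" for \<beta> x
      using that H0[of "fst \<beta>" "snd \<beta>" x] by (simp add: mi_order_def)
    show "\<bar>partial_derivs \<beta> ?R x\<bar> \<le> M * (2 * norm (x - x0)) ^ (k + 2 - mi_order \<beta>)"
      if "x \<in> interior \<Omega>" "mi_order \<beta> \<le> k + 2" for \<beta> x
      using that bR[of "fst \<beta>" "snd \<beta>" x] by (simp add: mi_order_def)
    show "\<bar>?R x\<bar> \<le> M * (2 * norm (x - x0)) ^ (k + 2)" if "x \<in> \<Omega>" for x
      by (rule cR[OF that])
  qed (rule real_polynomial_function_taylor_poly)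
  then show ?thesis by blast
qed

text \<open>Each \<open>1 / r\<close> is traded for \<open>\<rho> / h\<close>. As \<rho> is at least
  1, the exponent \<open>m\<close> in place of \<open>b\<close> makes the constant independent of
  the order of differentiation.\<close>

lemma mesh_power_bounds:
  fixes h r \<rho> :: real
  assumes "0 < h" "0 < r" "h / r \<le> \<rho>" "1 \<le> \<rho>" "b \<le> m"
  shows "h ^ m * (1 / r) ^ b \<le> h ^ (m - b) * \<rho> ^ m"
proof -
  have "h ^ m * (1 / r) ^ b = h ^ (m - b) * (h / r) ^ b"
    using assms(5) by (simp add: power_divide power_add[symmetric])
  also have "\<dots> \<le> h ^ (m - b) * \<rho> ^ m"
    using assms by (intro mult_left_mono order_trans[OF power_mono power_increasing]) auto
  finally show ?thesis .
qed

text \<open>\<open>B\<close> will bound the pointwise error apart from the contribution of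
  \<open>H\<close>, and \<open>B / h\<close> that contribution. In \<open>B\<close> the power of 2
  stems from \<open>2 * norm (x - x0)\<close>, the term with \<open>K\<close> from interpolants, and
  the 1 from the interpolated function itself.\<close>

locale interpolated_mesh =
  fixes \<Omega> :: "(real^2) set" and \<T> :: "(real^2) set set" and F :: "(real^2) set \<Rightarrow> real^2 \<Rightarrow> real^2"
    and f :: "real^2 \<Rightarrow> real" and k :: nat and \<beta> :: multi_index and K \<rho> h M B :: real
  assumes k: "1 \<le> k" and \<Omega>: "2 simplex \<Omega>" and conf: "conforming_triangulation \<Omega> \<T>"
    and F: "\<And>T. T \<in> \<T> \<Longrightarrow> reference_map (F T) T" and f: "C_on (k + 2) \<Omega> f"
    and \<beta>: "mi_order \<beta> \<le> k + 2" and h: "0 < h" and \<rho>: "1 \<le> \<rho>" and K: "0 \<le> K"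
    and diam: "\<And>T. T \<in> \<T> \<Longrightarrow> diameter T \<le> h"
    and inball: "\<And>T. T \<in> \<T> \<Longrightarrow> \<exists>y r. 0 < r \<and> cball y r \<subseteq> T \<and> h / r \<le> \<rho>"
    and K_bound: "\<And>G T g b y r x. reference_map G T \<Longrightarrow> 0 < r \<Longrightarrow> cball y r \<subseteq> T \<Longrightarrow> (\<forall>z\<in>T. \<bar>g z\<bar> \<le> b) \<Longrightarrow> x \<in> T
      \<Longrightarrow> \<bar>partial_derivs \<beta> (local_interp k G g) x\<bar> \<le> K * b * (1 / r) ^ mi_order \<beta>"
    and M: "M = C_norm (k + 2) \<Omega> f"
    and B: "B = 2 ^ (k + 2) * (K * \<rho> ^ (k + 2) + 1) * M * h ^ (k + 2 - mi_order \<beta>)"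
begin

lemma simplex: "T \<in> \<T> \<Longrightarrow> 2 simplex T" and tri: "triangulation \<T>" and subset: "T \<in> \<T> \<Longrightarrow> T \<subseteq> \<Omega>"
  using conf by (auto simp: conforming_triangulation_def)

lemma C_derivs_f: "C_derivs (k + 2) \<Omega> f"
  using f unfolding C_on_def by blast

lemma M_nonneg: "0 \<le> M"
proof -
  note O = two_simplex_facts[OF \<Omega>]
  obtain x where "x \<in> interior \<Omega>" using O(3) by blast
  then have "\<bar>partial_derivs (0, 0) f x\<bar> \<le> M"
    unfolding M by (intro partial_derivs_le_C_norm[OF O(1,4) C_derivs_f]) (simp add: mi_order_def)
  then show ?thesis by linarith
qed

lemma B_nonneg: "0 \<le> B"
  unfolding B using M_nonneg K h \<rho> by simp

text \<open>The interpolation error of \<open>H\<close>, differentiated. It is odd in the sense that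
  reflection relates its values on the two partners of a pair with opposite signs; on a single
  element nothing cancels.\<close>

definition odd_part :: "(real^2 \<Rightarrow> real) \<Rightarrow> (real^2) set \<Rightarrow> real^2 \<Rightarrow> real" where
  "odd_part H T = partial_derivs \<beta> (\<lambda>x. local_interp k (F T) H x + (-1) * H x)"

lemma element_error_pointwise:
  assumes T: "T \<in> \<T>" and near: "\<And>x. x \<in> T \<Longrightarrow> norm (x - x0) \<le> h" and sp: "taylor_split \<Omega> k f x0 p H"
    and x: "x \<in> interior T"
  shows "\<bar>partial_derivs \<beta> (local_interp k (F T) f) x - partial_derivs \<beta> f x - odd_part H T x\<bar> \<le> B"
    and "\<bar>odd_part H T x\<bar> \<le> B / h"
proof -
  let ?I = "local_interp k (F T)" and ?R = "\<lambda>x. f x - p x - H x" and ?n = "k + 2 - mi_order \<beta>"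
  have p: "p \<in> poly_le k" and H: "real_polynomial_function H"
    and Hle: "\<And>\<gamma> x. mi_order \<gamma> \<le> k + 1 \<Longrightarrow> \<bar>partial_derivs \<gamma> H x\<bar> \<le> M * (2 * norm (x - x0)) ^ (k + 1 - mi_order \<gamma>)"
    and H0: "\<And>\<gamma> x. mi_order \<gamma> = k + 2 \<Longrightarrow> partial_derivs \<gamma> H x = 0"
    and Rle: "\<And>\<gamma> x. x \<in> interior \<Omega> \<Longrightarrow> mi_order \<gamma> \<le> k + 2 \<Longrightarrow>
      \<bar>partial_derivs \<gamma> ?R x\<bar> \<le> M * (2 * norm (x - x0)) ^ (k + 2 - mi_order \<gamma>)"
    and R0: "\<And>x. x \<in> \<Omega> \<Longrightarrow> \<bar>?R x\<bar> \<le> M * (2 * norm (x - x0)) ^ (k + 2)"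
    using sp unfolding taylor_split_def M by blast+
  obtain y r where r: "0 < r" "cball y r \<subseteq> T" "h / r \<le> \<rho>" using inball[OF T] by blast
  note FT = F[OF T] and M0 = M_nonneg
  have xT: "x \<in> T" and x\<Omega>: "x \<in> interior \<Omega>"
    using x interior_subset interior_mono[OF subset[OF T]] by auto
  have pow: "(2 * norm (z - x0)) ^ m \<le> (2 * h) ^ m" if "z \<in> T" for z m
    using near[OF that] by (intro power_mono) auto
  have poly: "real_polynomial_function (?I g)" for g
    by (rule poly_le_imp_real_polynomial_function[OF local_interp_in_poly_le[OF FT k]])
  have CI: "C_derivs m S (?I g)" for m S g
    by (rule C_derivs_real_polynomial_function[OF poly])
  have CH: "C_derivs m S H" for m S
    by (rule C_derivs_real_polynomial_function[OF H])
  have CR: "C_derivs (k + 2) \<Omega> ?R"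
  proof -
    have "C_derivs (k + 2) \<Omega> (\<lambda>x. (f x + (-1) * p x) + (-1) * H x)"
      by (intro C_derivs_lincomb C_derivs_f CH C_derivs_real_polynomial_function
          poly_le_imp_real_polynomial_function[OF p])
    then show ?thesis by simp
  qed
  have main: "h ^ (k + 2) * (1 / r) ^ mi_order \<beta> \<le> h ^ ?n * \<rho> ^ (k + 2)"
    by (rule mesh_power_bounds[OF h r(1,3) \<rho> \<beta>])
  have two: "(2::real) ^ m \<le> 2 ^ (k + 2)" if "m \<le> k + 2" for m
    using that by (intro power_increasing) auto
  have Beq: "B = K * M * 2 ^ (k + 2) * (h ^ ?n * \<rho> ^ (k + 2)) + M * 2 ^ (k + 2) * h ^ ?n"
    unfolding B by (simp add: algebra_simps)
  \<comment> \<open>As \<open>p\<close> is reproduced exactly, it drops out of the error, which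
    leaves those of \<open>H\<close> and of the remainder.\<close>
  have If: "?I f = (\<lambda>x. (p x + ?I H x) + ?I ?R x)"
  proof -
    have "?I (\<lambda>x. 1 * (1 * p x + 1 * H x) + 1 * ?R x) = (\<lambda>x. 1 * (1 * ?I p x + 1 * ?I H x) + 1 * ?I ?R x)"
      unfolding local_interp_lincomb[OF FT k] ..
    then show ?thesis by (simp add: local_interp_poly[OF FT k p])
  qed
  have "partial_derivs \<beta> (?I f) x + (-1) * partial_derivs \<beta> f x = partial_derivs \<beta> (\<lambda>x. ?I f x + (-1) * f x) x"
    by (rule partial_derivs_lincomb[OF CI C_derivs_f \<beta> x\<Omega>, symmetric])
  also have "(\<lambda>x. ?I f x + (-1) * f x) = (\<lambda>x. (?I H x + (-1) * H x) + 1 * (?I ?R x + (-1) * ?R x))"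
    unfolding If by (simp add: algebra_simps)
  also have "partial_derivs \<beta> \<dots> x = odd_part H T x + 1 * partial_derivs \<beta> (\<lambda>x. ?I ?R x + (-1) * ?R x) x"
    unfolding odd_part_def
    by (rule partial_derivs_lincomb[OF _ _ \<beta> x\<Omega>]) (intro C_derivs_lincomb CI CH CR)+
  also have "partial_derivs \<beta> (\<lambda>x. ?I ?R x + (-1) * ?R x) x = partial_derivs \<beta> (?I ?R) x + (-1) * partial_derivs \<beta> ?R x"
    by (rule partial_derivs_lincomb[OF CI CR \<beta> x\<Omega>])
  finally have eq: "partial_derivs \<beta> (?I f) x - partial_derivs \<beta> f x - odd_part H T x
     = partial_derivs \<beta> (?I ?R) x - partial_derivs \<beta> ?R x" by simp
  have "\<forall>z\<in>T. \<bar>?R z\<bar> \<le> M * (2 * h) ^ (k + 2)"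
  proof
    fix z assume "z \<in> T"
    then have "z \<in> \<Omega>" using subset[OF T] by blast
    show "\<bar>?R z\<bar> \<le> M * (2 * h) ^ (k + 2)"
      using R0[OF \<open>z \<in> \<Omega>\<close>] mult_left_mono[OF pow[OF \<open>z \<in> T\<close>, of "k + 2"] M0] by linarith
  qed
  from K_bound[OF FT r(1,2) this xT]
  have "\<bar>partial_derivs \<beta> (?I ?R) x\<bar> \<le> K * M * 2 ^ (k + 2) * (h ^ (k + 2) * (1 / r) ^ mi_order \<beta>)"
    unfolding power_mult_distrib by (simp only: mult_ac)
  also have "\<dots> \<le> K * M * 2 ^ (k + 2) * (h ^ ?n * \<rho> ^ (k + 2))"
    using main M0 K by (intro mult_left_mono) auto
  finally have 1: "\<bar>partial_derivs \<beta> (?I ?R) x\<bar> \<le> K * M * 2 ^ (k + 2) * (h ^ ?n * \<rho> ^ (k + 2))" .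
  have "\<bar>partial_derivs \<beta> ?R x\<bar> \<le> M * (2 * norm (x - x0)) ^ ?n"
    by (rule Rle[OF x\<Omega> \<beta>])
  also have "\<dots> \<le> M * (2 * h) ^ ?n"
    by (rule mult_left_mono[OF pow[OF xT] M0])
  also have "\<dots> \<le> M * 2 ^ (k + 2) * h ^ ?n"
    unfolding power_mult_distrib mult.assoc[symmetric]
    using two[of ?n] M0 h by (intro mult_right_mono mult_left_mono) auto
  finally show "\<bar>partial_derivs \<beta> (?I f) x - partial_derivs \<beta> f x - odd_part H T x\<bar> \<le> B"
    unfolding eq Beq using 1 by linarith
  \<comment> \<open>\<open>H\<close> is only of size \<open>h ^ (k + 1)\<close>. Multiplying its
    estimates by \<open>h\<close> reduces them to those for the remainder, whence
    \<open>B / h\<close>.\<close>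
  have "\<forall>z\<in>T. \<bar>H z\<bar> \<le> M * (2 * h) ^ (k + 1)"
  proof
    fix z assume "z \<in> T"
    have "\<bar>H z\<bar> \<le> M * (2 * norm (z - x0)) ^ (k + 1)"
      using Hle[of "(0, 0)" z] by (simp add: mi_order_def)
    then show "\<bar>H z\<bar> \<le> M * (2 * h) ^ (k + 1)"
      using mult_left_mono[OF pow[OF \<open>z \<in> T\<close>, of "k + 1"] M0] by linarith
  qed
  from K_bound[OF FT r(1,2) this xT]
  have "\<bar>partial_derivs \<beta> (?I H) x\<bar> * h \<le> (K * (M * (2 * h) ^ (k + 1)) * (1 / r) ^ mi_order \<beta>) * h"
    using h by (intro mult_right_mono) auto
  also have "\<dots> = K * M * 2 ^ (k + 1) * (h ^ (k + 2) * (1 / r) ^ mi_order \<beta>)"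
    by (simp add: power_mult_distrib mult_ac)
  also have "\<dots> \<le> K * M * 2 ^ (k + 2) * (h ^ ?n * \<rho> ^ (k + 2))"
    using M0 K h r(1) two[of "k + 1"] by (intro mult_mono[OF _ main] mult_left_mono) auto
  finally have 2: "\<bar>partial_derivs \<beta> (?I H) x\<bar> * h \<le> K * M * 2 ^ (k + 2) * (h ^ ?n * \<rho> ^ (k + 2))" .
  have 3: "\<bar>partial_derivs \<beta> H x\<bar> * h \<le> M * 2 ^ (k + 2) * h ^ ?n"
  \<comment> \<open>At top order the truncated difference \<open>k + 1 - mi_order \<beta>\<close>
    would be 0 instead of -1; there the derivative of \<open>H\<close> vanishes.\<close>
  proof (cases "mi_order \<beta> = k + 2")
    case True
    then show ?thesis using H0 M0 h by simp
  next
    case False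
    then have le: "mi_order \<beta> \<le> k + 1" using \<beta> by simp
    have "\<bar>partial_derivs \<beta> H x\<bar> \<le> M * (2 * norm (x - x0)) ^ (k + 1 - mi_order \<beta>)"
      by (rule Hle[OF le])
    also have "\<dots> \<le> M * (2 * h) ^ (k + 1 - mi_order \<beta>)"
      by (rule mult_left_mono[OF pow[OF xT] M0])
    finally have "\<bar>partial_derivs \<beta> H x\<bar> * h \<le> M * (2 * h) ^ (k + 1 - mi_order \<beta>) * h"
      using h by (intro mult_right_mono) auto
    also have "\<dots> = M * 2 ^ (k + 1 - mi_order \<beta>) * h ^ ?n"
      using le by (simp add: power_mult_distrib Suc_diff_le)
    also have "\<dots> \<le> M * 2 ^ (k + 2) * h ^ ?n"
      using two[of "k + 1 - mi_order \<beta>"] M0 h by (intro mult_right_mono mult_left_mono) auto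
    finally show ?thesis .
  qed
  have "odd_part H T x = partial_derivs \<beta> (?I H) x + (-1) * partial_derivs \<beta> H x"
    unfolding odd_part_def by (rule partial_derivs_lincomb[OF CI CH \<beta> x\<Omega>])
  then have "\<bar>odd_part H T x\<bar> \<le> \<bar>partial_derivs \<beta> (?I H) x\<bar> + \<bar>partial_derivs \<beta> H x\<bar>" by linarith
  then have "\<bar>odd_part H T x\<bar> * h \<le> (\<bar>partial_derivs \<beta> (?I H) x\<bar> + \<bar>partial_derivs \<beta> H x\<bar>) * h"
    using h by (intro mult_right_mono) auto
  then have "\<bar>odd_part H T x\<bar> * h \<le> B"
    unfolding Beq using 2 3 by (simp add: distrib_right)
  then show "\<bar>odd_part H T x\<bar> \<le> B / h" using h by (simp add: field_simps)
qed

definition err :: "(real^2) set \<Rightarrow> real" where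
  "err T = (LINT x:T|lebesgue. D_on T \<beta> (interp k \<T> F f) x - D_on \<Omega> \<beta> f x)"

lemma odd_part_polynomial:
  assumes "T \<in> \<T>" "real_polynomial_function H"
  shows "real_polynomial_function (\<lambda>x. local_interp k (F T) H x + (-1) * H x)"
    and "real_polynomial_function (odd_part H T)"
proof -
  show 1: "real_polynomial_function (\<lambda>x. local_interp k (F T) H x + (-1) * H x)"
    using poly_le_imp_real_polynomial_function[OF local_interp_in_poly_le[OF F[OF assms(1)] k]] assms(2)
    by (intro real_polynomial_function.intros(2,3,4)) auto
  show "real_polynomial_function (odd_part H T)"
    using real_polynomial_function_iter_partial_deriv[OF 1]
    unfolding odd_part_def by (cases \<beta>) (simp only: partial_derivs_eq_iter)
qed

text \<open>Inside an element the choice in \<open>interp\<close> must return \<open>T\<close>, and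
  derivatives at a point of an open set depend only on values in that set.\<close>

lemma D_on_difference:
  assumes "T \<in> \<T>" "x \<in> interior T"
  shows "D_on T \<beta> (interp k \<T> F f) x - D_on \<Omega> \<beta> f x =
    partial_derivs \<beta> (local_interp k (F T) f) x - partial_derivs \<beta> f x"
proof -
  have "interp k \<T> F f y = local_interp k (F T) f y" if y: "y \<in> interior T" for y
  proof -
    have "(SOME T'. T' \<in> \<T> \<and> y \<in> T') = T"
    proof (rule some_equality)
      show "T \<in> \<T> \<and> y \<in> T" using assms(1) y interior_subset by blast
      show "T' = T" if "T' \<in> \<T> \<and> y \<in> T'" for T'
        using triangulation_interior_unique[OF tri assms(1) _ y] that by blast
    qed
    then show ?thesis by (simp add: interp_def local_interp_def)
  qed
  then have "partial_derivs \<beta> (interp k \<T> F f) x = partial_derivs \<beta> (local_interp k (F T) f) x"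
    by (intro partial_derivs_cong_open[of "interior T"] assms(2)) auto
  moreover have "x \<in> interior \<Omega>" using assms(2) interior_mono[OF subset[OF assms(1)]] by blast
  ultimately show ?thesis using assms(2) by (simp add: D_on_def)
qed

lemma element_error:
  assumes T: "T \<in> \<T>" and near: "\<And>x. x \<in> T \<Longrightarrow> norm (x - x0) \<le> h" and sp: "taylor_split \<Omega> k f x0 p H"
  shows "\<bar>err T - (LINT x:T|lebesgue. odd_part H T x)\<bar> \<le> B * measure lebesgue T"
    and "\<bar>LINT x:T|lebesgue. odd_part H T x\<bar> \<le> B / h * measure lebesgue T"
proof -
  note Tf = two_simplex_facts[OF simplex[OF T]]
  have H: "real_polynomial_function H" using sp unfolding taylor_split_def by blast
  have q: "continuous_on S (odd_part H T)" for S
    by (rule continuous_on_real_polynomial_function[OF odd_part_polynomial(2)[OF T H]])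
  have "C_derivs 0 \<Omega> (partial_derivs (fst \<beta>, snd \<beta>) f)"
    by (rule C_derivs_partial_derivs[OF C_derivs_le[OF C_derivs_f]]) (use \<beta> in \<open>simp add: mi_order_def\<close>)
  then have "continuous_on (interior \<Omega>) (partial_derivs \<beta> f)"
    using C_derivs_imp_continuous_on by fastforce
  then have cf: "continuous_on (interior T) (partial_derivs \<beta> f)"
    using continuous_on_subset interior_mono[OF subset[OF T]] by blast
  have "real_polynomial_function (local_interp k (F T) f)"
    by (rule poly_le_imp_real_polynomial_function[OF local_interp_in_poly_le[OF F[OF T] k]])
  from real_polynomial_function_iter_partial_deriv[OF this]
  have "real_polynomial_function (partial_derivs \<beta> (local_interp k (F T) f))"
    by (cases \<beta>) (simp only: partial_derivs_eq_iter)
  then have "continuous_on (interior T) (\<lambda>x. partial_derivs \<beta> (local_interp k (F T) f) x - partial_derivs \<beta> f x)"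
    by (intro continuous_on_diff continuous_on_real_polynomial_function cf)
  then have g: "continuous_on (interior T) (\<lambda>x. D_on T \<beta> (interp k \<T> F f) x - D_on \<Omega> \<beta> f x)"
    by (rule continuous_on_eq) (simp add: D_on_difference[OF T])
  show "\<bar>err T - (LINT x:T|lebesgue. odd_part H T x)\<bar> \<le> B * measure lebesgue T"
    unfolding err_def
    by (rule set_integral_approx[OF Tf(2,1) g q B_nonneg])
      (use element_error_pointwise(1)[OF T near sp] in \<open>simp add: D_on_difference[OF T]\<close>)
  have "\<bar>(LINT x:T|lebesgue. odd_part H T x) - (LINT x:T|lebesgue. 0)\<bar> \<le> B / h * measure lebesgue T"
    by (rule set_integral_approx[OF Tf(2,1) q continuous_on_const])
      (use element_error_pointwise(2)[OF T near sp] B_nonneg h in auto)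
  then show "\<bar>LINT x:T|lebesgue. odd_part H T x\<bar> \<le> B / h * measure lebesgue T"
    by (simp add: set_lebesgue_integral_def)
qed

lemma mesh_near:
  assumes "T \<in> \<T>" "x0 \<in> T" "x \<in> T"
  shows "norm (x - x0) \<le> h"
  using diameter_bounded_bound[OF compact_imp_bounded[OF two_simplex_facts(1)[OF simplex[OF assms(1)]]] assms(3,2)]
    diam[OF assms(1)] by (simp add: dist_norm)

lemma taylor_split_ex:
  assumes "x0 \<in> interior \<Omega>"
  obtains p H where "taylor_split \<Omega> k f x0 p H"
  using taylor_split_exists[OF two_simplex_facts(1,2,4)[OF \<Omega>] f assms] that by blast

text \<open>With no partner to cancel against, any interior point of \<open>T\<close> can serve as
  centre, and \<open>B / h\<close> is paid in full.\<close>

lemma single_error: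
  assumes T: "T \<in> \<T>"
  shows "\<bar>err T\<bar> \<le> (B + B / h) * measure lebesgue T"
proof -
  obtain x0 where x0: "x0 \<in> interior T" using two_simplex_facts(3)[OF simplex[OF T]] by blast
  then have "x0 \<in> interior \<Omega>" "x0 \<in> T"
    using interior_mono[OF subset[OF T]] interior_subset by auto
  then obtain p H where sp: "taylor_split \<Omega> k f x0 p H" using taylor_split_ex by blast
  show ?thesis
    using element_error[OF T mesh_near[OF T \<open>x0 \<in> T\<close>] sp] by (simp add: distrib_right)
qed

text \<open>
  Under reflection in the common vertex the degree \<open>k + 1\<close> part of the error picks up the sign
  \<open>(-1) ^ (k + 1)\<close> from \<open>H\<close> and \<open>(-1) ^ |\<beta>|\<close> from the derivative, hence is odd.
\<close>
lemma pair_error: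
  assumes T: "T1 \<in> \<T>" "T2 \<in> \<T>" and sym: "symmetric_pair T1 T2" and ev: "even (k + 2 - mi_order \<beta>)"
  shows "\<bar>err T1 + err T2\<bar> \<le> B * (measure lebesgue T1 + measure lebesgue T2)"
proof -
  obtain x0 where x0: "x0 \<in> T1" "T1 \<inter> T2 = {x0}" and T2: "T2 = (\<lambda>x. 2 *\<^sub>R x0 - x) ` T1"
    using symmetric_pair_reflection[OF sym] by metis
  let ?a = "2 *\<^sub>R x0"
  have "x0 \<in> T2" using x0(2) by blast
  have "x0 \<in> interior \<Omega>"
    using midpoint_mem_interior[OF two_simplex_facts(2)[OF \<Omega>] subset[OF T(1)]] subset[OF T(2)]
      two_simplex_facts(3)[OF simplex[OF T(1)]] unfolding T2 by blast
  then obtain p H where sp: "taylor_split \<Omega> k f x0 p H" using taylor_split_ex by blast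
  have H: "real_polynomial_function H" and Hsym: "\<And>x. H (?a - x) = (-1) ^ (k + 1) * H x"
    using sp unfolding taylor_split_def by blast+
  define v where "v T = (\<lambda>x. local_interp k (F T) H x + (-1) * H x)" for T
  have odd_part: "odd_part H T = partial_derivs \<beta> (v T)" for T
    by (simp add: odd_part_def v_def)
  let ?ds = "replicate (fst \<beta>) 1 @ replicate (snd \<beta>) 2"
  have it: "partial_derivs \<beta> u = iter_partial_deriv ?ds u" for u
    using partial_derivs_eq_iter[of "fst \<beta>" "snd \<beta>" u] by simp
  have len: "length ?ds = mi_order \<beta>" by (simp add: mi_order_def)
  have vpoly: "real_polynomial_function (v T1)" "real_polynomial_function (v T2)"
    using odd_part_polynomial(1)[OF T(1) H] odd_part_polynomial(1)[OF T(2) H] by (simp_all add: v_def)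
  have vsym: "v T2 (?a - x) = (-1) ^ (k + 1) * v T1 x" for x
    using local_interp_reflect[where g = H, OF F[OF T(1)] F[OF T(2)] k T2 Hsym] Hsym
    by (simp add: v_def algebra_simps)
  have oddness: "odd_part H T2 (?a - x) = - odd_part H T1 x" for x
  proof -
    have "(-1) ^ mi_order \<beta> * odd_part H T2 (?a - x) = iter_partial_deriv ?ds (\<lambda>x. v T2 (?a - x)) x"
      using iter_partial_deriv_reflect[OF vpoly(2), of ?ds ?a x] unfolding odd_part it len by simp
    \<comment> \<open>The one-element sum lets \<open>iter_partial_deriv_sum\<close> pull out the
      scalar.\<close>
    also have "\<dots> = iter_partial_deriv ?ds (\<lambda>x. \<Sum>i\<in>{()}. (-1) ^ (k + 1) * v T1 x) x"
      by (simp add: vsym)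
    also have "\<dots> = (-1) ^ (k + 1) * odd_part H T1 x"
      using iter_partial_deriv_sum[of "{()}" "\<lambda>_. v T1" ?ds "\<lambda>_. (-1) ^ (k + 1)" x] vpoly(1)
      unfolding odd_part it by simp
    finally have "(-1) ^ mi_order \<beta> * ((-1) ^ mi_order \<beta> * odd_part H T2 (?a - x))
      = (-1) ^ mi_order \<beta> * ((-1) ^ (k + 1) * odd_part H T1 x)" by simp
    moreover have "(-1 :: real) ^ mi_order \<beta> * (-1) ^ mi_order \<beta> = 1"
      by (simp flip: power_add)
    moreover have "(-1 :: real) ^ mi_order \<beta> * (-1) ^ (k + 1) = - 1"
    proof -
      \<comment> \<open>The bound on the order of \<beta> excludes truncation in the subtraction, so
        the evenness hypothesis really compares the parities of \<open>k\<close> and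
        \<beta>.\<close>
      have "odd (mi_order \<beta> + (k + 1))" using ev \<beta> by presburger
      then show ?thesis by (simp only: power_add[symmetric] uminus_power_if) simp
    qed
    ultimately show ?thesis by (simp add: mult.assoc[symmetric])
  qed
  have "(LINT x:T2|lebesgue. odd_part H T2 x) = (LINT x:T1|lebesgue. odd_part H T2 (?a - x))"
    unfolding T2
    by (rule set_integral_point_reflection[OF two_simplex_facts(1)[OF simplex[OF T(1)]]
          continuous_on_real_polynomial_function]) (use odd_part_polynomial(2)[OF T(2) H] T2 in simp)
  also have "\<dots> = - (LINT x:T1|lebesgue. odd_part H T1 x)"
    by (simp add: oddness set_lebesgue_integral_def)
  finally show ?thesis
    using element_error(1)[OF T(1) mesh_near[OF T(1) x0(1)] sp]
      element_error(1)[OF T(2) mesh_near[OF T(2) \<open>x0 \<in> T2\<close>] sp]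
    by (simp add: distrib_left)
qed

lemma total_error:
  assumes sym: "symmetric_triangulation \<Omega> \<T>" and mesh: "h = mesh_size \<T>"
    and ev: "even (k + 2 - mi_order \<beta>)" and ball: "0 < r" "cball c r \<subseteq> \<Omega>"
  shows "\<bar>\<Sum>T\<in>\<T>. err T\<bar> \<le> B * (measure lebesgue \<Omega> * (1 + 4 / r))"
proof -
  let ?m = "measure lebesgue"
  obtain \<A> \<B> \<P> where split: "\<T> = \<A> \<union> \<B> \<and> \<A> \<inter> \<B> = {} \<and> partition_on \<A> \<P> \<and>
      (\<forall>P\<in>\<P>. \<exists>T1 T2. P = {T1, T2} \<and> symmetric_pair T1 T2) \<and>
      \<Union>\<B> \<subseteq> {x\<in>\<Omega>. infdist x (frontier \<Omega>) \<le> mesh_size \<T>}"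
    using sym unfolding symmetric_triangulation_def by (elim exE)
  have AB: "\<T> = \<A> \<union> \<B>" "\<A> \<inter> \<B> = {}" and P: "partition_on \<A> \<P>"
    "\<And>P. P \<in> \<P> \<Longrightarrow> \<exists>T1 T2. P = {T1, T2} \<and> symmetric_pair T1 T2"
    using split by auto
  have strip: "\<Union>\<B> \<subseteq> {x\<in>\<Omega>. infdist x (frontier \<Omega>) \<le> h}"
    using split unfolding mesh by argo
  have fin: "finite \<A>" "finite \<B>" "finite \<T>"
    using tri AB unfolding triangulation_def by auto
  have UP: "\<Union>\<P> = \<A>" using partition_onD1[OF P(1)] by simp
  have disj: "\<forall>P\<in>\<P>. \<forall>P'\<in>\<P>. P \<noteq> P' \<longrightarrow> P \<inter> P' = {}"
    using partition_onD2[OF P(1)] by (auto simp: disjoint_def)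
  have finP: "\<forall>P\<in>\<P>. finite P" using P(2) by fastforce
  have sumP: "(\<Sum>T\<in>\<A>. u T) = (\<Sum>P\<in>\<P>. \<Sum>T\<in>P. u T)" for u :: "(real^2) set \<Rightarrow> real"
    using sum.Union_disjoint[OF finP disj, of u] by (simp add: UP)
  have pair: "\<bar>\<Sum>T\<in>P. err T\<bar> \<le> (\<Sum>T\<in>P. B * ?m T)" if PP: "P \<in> \<P>" for P
  proof -
    obtain T1 T2 where T12: "P = {T1, T2}" "symmetric_pair T1 T2" using P(2)[OF PP] by blast
    have inT: "T1 \<in> \<T>" "T2 \<in> \<T>" using PP UP AB(1) T12(1) by auto
    \<comment> \<open>Otherwise the set \<open>P\<close> would be a singleton and its sum would
      count \<open>err T1\<close> only once. A triangle with interior cannot meet itself in a single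
      point.\<close>
    have "T1 \<noteq> T2"
    proof
      assume "T1 = T2"
      obtain x0 where "T1 \<inter> T2 = {x0}" by (rule symmetric_pair_reflection[OF T12(2)])
      then have "T1 = {x0}" using \<open>T1 = T2\<close> by simp
      then show False using two_simplex_facts(3)[OF simplex[OF inT(1)]] by simp
    qed
    then show ?thesis
      using pair_error[OF inT T12(2) ev] by (simp add: T12(1) distrib_left)
  qed
  have "\<bar>\<Sum>T\<in>\<A>. err T\<bar> \<le> (\<Sum>P\<in>\<P>. \<bar>\<Sum>T\<in>P. err T\<bar>)"
    unfolding sumP by (rule sum_abs)
  also have "\<dots> \<le> (\<Sum>P\<in>\<P>. \<Sum>T\<in>P. B * ?m T)"
    by (rule sum_mono[OF pair])
  also have "\<dots> = B * (\<Sum>T\<in>\<A>. ?m T)"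
    by (simp add: sumP[symmetric] sum_distrib_left)
  finally have A: "\<bar>\<Sum>T\<in>\<A>. err T\<bar> \<le> B * (\<Sum>T\<in>\<A>. ?m T)" .
  have "\<bar>\<Sum>T\<in>\<B>. err T\<bar> \<le> (\<Sum>T\<in>\<B>. \<bar>err T\<bar>)" by (rule sum_abs)
  also have "\<dots> \<le> (\<Sum>T\<in>\<B>. (B + B / h) * ?m T)"
    by (intro sum_mono single_error) (use AB in auto)
  also have "\<dots> = B * (\<Sum>T\<in>\<B>. ?m T) + B / h * (\<Sum>T\<in>\<B>. ?m T)"
    unfolding sum_distrib_left[symmetric] by (rule distrib_right)
  \<comment> \<open>The area of the strip supplies the factor \<open>h\<close> that cancels the
    division.\<close>
  also have "B / h * (\<Sum>T\<in>\<B>. ?m T) \<le> B / h * (4 / r * ?m \<Omega> * h)"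
  proof (rule mult_left_mono)
    have "(\<Sum>T\<in>\<B>. ?m T) = ?m (\<Union>\<B>)"
      by (rule sum_measure_triangulation[OF tri simplex]) (use AB in auto)
    also have "\<dots> \<le> 4 / r * ?m \<Omega> * h"
    proof (rule measure_boundary_strip[OF two_simplex_facts(2,1)[OF \<Omega>] ball h _ strip])
      show "\<Union>\<B> \<in> lmeasurable"
        by (intro fmeasurable.finite_Union fin)
          (use AB simplex two_simplex_facts(1) lmeasurable_compact in blast)
    qed
    finally show "(\<Sum>T\<in>\<B>. ?m T) \<le> 4 / r * ?m \<Omega> * h" .
  qed (use B_nonneg h in simp)
  finally have Bb: "\<bar>\<Sum>T\<in>\<B>. err T\<bar> \<le> B * (\<Sum>T\<in>\<B>. ?m T) + B * (4 / r * ?m \<Omega>)"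
    using h by simp
  have "(\<Sum>T\<in>\<A>. ?m T) + (\<Sum>T\<in>\<B>. ?m T) = (\<Sum>T\<in>\<T>. ?m T)"
    unfolding AB(1) by (rule sum.union_disjoint[OF fin(1,2) AB(2), symmetric])
  also have "\<dots> = ?m \<Omega>"
    using sum_measure_triangulation[OF tri simplex subset_refl] conf
    by (simp add: conforming_triangulation_def)
  finally have tot: "(\<Sum>T\<in>\<A>. ?m T) + (\<Sum>T\<in>\<B>. ?m T) = ?m \<Omega>" .
  have "\<bar>\<Sum>T\<in>\<T>. err T\<bar> \<le> \<bar>\<Sum>T\<in>\<A>. err T\<bar> + \<bar>\<Sum>T\<in>\<B>. err T\<bar>"
    unfolding AB(1) sum.union_disjoint[OF fin(1,2) AB(2)] by (rule abs_triangle_ineq)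
  also have "\<dots> \<le> B * ((\<Sum>T\<in>\<A>. ?m T) + (\<Sum>T\<in>\<B>. ?m T)) + B * (4 / r * ?m \<Omega>)"
    using A Bb by (simp add: distrib_left)
  finally show ?thesis unfolding tot by (simp add: algebra_simps)
qed

end

theorem theorem3p2:
  fixes \<Omega> :: "(real^2) set" and k :: nat and h0 \<kappa> q :: real
  assumes "1 \<le> k" and "2 simplex \<Omega>" and "diameter \<Omega> \<le> h0"
  shows "\<exists>C::real. \<forall>\<T> h F f \<beta>.
    conforming_triangulation \<Omega> \<T> \<and> h = mesh_size \<T> \<and> h < h0 \<and>
    shape_regular \<kappa> \<T> \<and> quasi_uniform q \<T> \<and> symmetric_triangulation \<Omega> \<T> \<and>
    (\<forall>T\<in>\<T>. reference_map (F T) T) \<and>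
    C_on (k + 2) \<Omega> f \<and>
    mi_order \<beta> \<le> k + 2 \<and> even (k + 2 - mi_order \<beta>) \<longrightarrow>
    \<bar>\<Sum>T\<in>\<T>. LINT x:T|lebesgue. D_on T \<beta> (interp k \<T> F f) x - D_on \<Omega> \<beta> f x\<bar>
      \<le> C * h ^ (k + 2 - mi_order \<beta>) * C_norm (k + 2) \<Omega> f"
proof -
  obtain K where K: "0 \<le> K" "\<And>\<beta> G T g b y r x. mi_order \<beta> \<le> k + 2 \<Longrightarrow> reference_map G T \<Longrightarrow> 0 < r \<Longrightarrow>
      cball y r \<subseteq> T \<Longrightarrow> (\<forall>z\<in>T. \<bar>g z\<bar> \<le> b) \<Longrightarrow> x \<in> T \<Longrightarrow>
      \<bar>partial_derivs \<beta> (local_interp k G g) x\<bar> \<le> K * b * (1 / r) ^ mi_order \<beta>"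
    using local_interp_partial_derivs_bound[OF assms(1), of "k + 2"] by blast
  \<comment> \<open>A ball in \<Omega>, fixed before any mesh; it enters the constant through the
    strip estimate.\<close>
  obtain c r where ball: "0 < r" "cball c r \<subseteq> \<Omega>"
    using two_simplex_facts(3)[OF assms(2)] mem_interior_cball by blast
  \<comment> \<open>The maximum with 1 makes powers of \<rho> increase with the exponent, as
    \<open>mesh_power_bounds\<close> requires.\<close>
  define \<rho> where "\<rho> = max 1 (4 * \<bar>\<kappa> * q\<bar>)"
  define A where "A = 2 ^ (k + 2) * (K * \<rho> ^ (k + 2) + 1)"
  show ?thesis
  proof (intro exI[of _ "A * (measure lebesgue \<Omega> * (1 + 4 / r))"] allI impI, elim conjE)
    fix \<T> h F f \<beta>
    assume conf: "conforming_triangulation \<Omega> \<T>" and mesh: "h = mesh_size \<T>"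
      and sr: "shape_regular \<kappa> \<T>" and qu: "quasi_uniform q \<T>" and sym: "symmetric_triangulation \<Omega> \<T>"
      and F: "\<forall>T\<in>\<T>. reference_map (F T) T" and f: "C_on (k + 2) \<Omega> f"
      and \<beta>: "mi_order \<beta> \<le> k + 2" and ev: "even (k + 2 - mi_order \<beta>)"
    have fin: "finite \<T>" and simp: "\<And>T. T \<in> \<T> \<Longrightarrow> 2 simplex T"
      using conf by (auto simp: conforming_triangulation_def triangulation_def)
    note reg = shape_regular_inscribed_ball[OF fin _ simp sr qu, folded mesh]
    \<comment> \<open>Some element must exist, since its positive diameter is what yields
      \<open>0 < h\<close>.\<close>
    have "\<Union>\<T> \<noteq> {}"
      using conf ball by (auto simp: conforming_triangulation_def)
    then obtain T0 where "T0 \<in> \<T>" by blast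
    interpret interpolated_mesh \<Omega> \<T> F f k \<beta> K \<rho> h "C_norm (k + 2) \<Omega> f"
      "A * C_norm (k + 2) \<Omega> f * h ^ (k + 2 - mi_order \<beta>)"
    proof
      show "0 < h" by (rule reg(1)[OF \<open>T0 \<in> \<T>\<close> \<open>T0 \<in> \<T>\<close>])
      show "diameter T \<le> h" if "T \<in> \<T>" for T by (rule reg(2)[OF that that])
      show "\<exists>y r. 0 < r \<and> cball y r \<subseteq> T \<and> h / r \<le> \<rho>" if "T \<in> \<T>" for T
        using reg(3)[OF that that] unfolding \<rho>_def by (meson max.coboundedI2)
    qed (use assms conf F f \<beta> K in \<open>auto simp: \<rho>_def A_def\<close>)
    show "\<bar>\<Sum>T\<in>\<T>. LINT x:T|lebesgue. D_on T \<beta> (interp k \<T> F f) x - D_on \<Omega> \<beta> f x\<bar>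
      \<le> A * (measure lebesgue \<Omega> * (1 + 4 / r)) * h ^ (k + 2 - mi_order \<beta>) * C_norm (k + 2) \<Omega> f"
      using total_error[OF sym mesh ev ball] by (simp only: err_def mult_ac)
  qed
qed

end
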